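(* Any $d$-flag sortable simplicial complex $\Gamma$ is vertex decomposable. In particular, $\Gamma$ is Cohen-Macaulay if and only if it is pure.
   Context: Let $\Gamma$ be a simplicial complex on $[n]$. $\Gamma$ is $d$-flag if all its minimal non-faces have cardinality $d$. Sorting: let $S=K[x_1,\dots,x_n]$ over a field $K$ and $\mathbf{x}_F=\prod_{i\in F}x_i$ ($\mathbf{x}_\emptyset=1$). For monomials $u,v\in S$ write $uv=x_{i_1}\cdots x_{i_r}$ with $i_1\le\cdots\le i_r$, and set $\mathrm{sort}(u,v)=(u',v')$ with $u'=\prod_{j\text{ odd}}x_{i_j}$, $v'=\prod_{j\text{ even}}x_{i_j}$. $\Gamma$ is sortable if the set $\mathcal M=\{\mathbf{x}_F:F\in\Gamma\}$ satisfies $\mathrm{sort}(u,v)\in\mathcal M\times\mathcal M$ for all $u,v\in\mathcal M$. Vertex decomposability (in the non-pure sense) is defined recursively: $\Gamma$ is vertex decomposable if either $\Gamma$ is a simplex (possibly $\{\emptyset\}$), or there is a vertex $v$ of $\Gamma$ such that the deletion $\mathrm{Del}_\Gamma(v)=\{F\in\Gamma:v\notin F\}$ and the link $\mathrm{Lk}_\Gamma(v)=\{F\in\Gamma:v\notin F,\ F\cup\{v\}\in\Gamma\}$ are both vertex decomposable and every facet of $\mathrm{Del}_\Gamma(v)$ is a facet of $\Gamma$. $\Gamma$ is Cohen-Macaulay (over $K$) if its Stanley-Reisner ring over $K$ is Cohen-Macaulay; $\Gamma$ is pure if all its facets have the same dimension. *)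

theory Defs
  imports
    "HOL-Library.Multiset"
    "HOL-Library.Poly_Mapping"
    "HOL-Library.Extended_Nat"
    "HOL-Algebra.QuotRing"
    "HOL-Algebra.Ring_Divisibility"
begin

section \<open>Simplicial complexes on $[n]$\<close>

text \<open>
  A complex is its set of faces, so the void complex (no faces at all) is excluded.
  A point of $[n]$ need not be a vertex, which keeps deletions and links complexes on $[n]$.
\<close>

definition simplicial_complex :: "nat \<Rightarrow> nat set set \<Rightarrow> bool" where
  "simplicial_complex n \<Gamma> \<longleftrightarrow>
     {} \<in> \<Gamma> \<and> \<Gamma> \<subseteq> Pow {1..n} \<and> (\<forall>F\<in>\<Gamma>. \<forall>G. G \<subseteq> F \<longrightarrow> G \<in> \<Gamma>)"

definition minimal_nonface :: "nat \<Rightarrow> nat set set \<Rightarrow> nat set \<Rightarrow> bool" where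
  "minimal_nonface n \<Gamma> N \<longleftrightarrow> N \<subseteq> {1..n} \<and> N \<notin> \<Gamma> \<and> (\<forall>G. G \<subset> N \<longrightarrow> G \<in> \<Gamma>)"

definition flag_complex :: "nat \<Rightarrow> nat \<Rightarrow> nat set set \<Rightarrow> bool" where
  "flag_complex n d \<Gamma> \<longleftrightarrow> (\<forall>N. minimal_nonface n \<Gamma> N \<longrightarrow> card N = d)"

definition facet :: "'a set set \<Rightarrow> 'a set \<Rightarrow> bool" where
  "facet \<Gamma> F \<longleftrightarrow> F \<in> \<Gamma> \<and> (\<forall>G\<in>\<Gamma>. F \<subseteq> G \<longrightarrow> G = F)"

definition face_dim :: "'a set \<Rightarrow> int" where
  "face_dim F = int (card F) - 1"

definition pure_complex :: "'a set set \<Rightarrow> bool" where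
  "pure_complex \<Gamma> \<longleftrightarrow> (\<forall>F G. facet \<Gamma> F \<longrightarrow> facet \<Gamma> G \<longrightarrow> face_dim F = face_dim G)"

definition deletion :: "'a set set \<Rightarrow> 'a \<Rightarrow> 'a set set" where
  "deletion \<Gamma> v = {F \<in> \<Gamma>. v \<notin> F}"

definition link :: "'a set set \<Rightarrow> 'a \<Rightarrow> 'a set set" where
  "link \<Gamma> v = {F \<in> \<Gamma>. v \<notin> F \<and> F \<union> {v} \<in> \<Gamma>}"

inductive vertex_decomposable :: "'a set set \<Rightarrow> bool" where
  simplex: "finite A \<Longrightarrow> vertex_decomposable (Pow A)"
| shed: "{v} \<in> \<Gamma> \<Longrightarrow> vertex_decomposable (deletion \<Gamma> v) \<Longrightarrow> vertex_decomposable (link \<Gamma> v) \<Longrightarrow>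
    (\<And>F. facet (deletion \<Gamma> v) F \<Longrightarrow> facet \<Gamma> F) \<Longrightarrow> vertex_decomposable \<Gamma>"


section \<open>Sorting\<close>

text \<open>
  A monomial is represented by the multiset of the indices of its variables, with
  multiplicity; the product of monomials is the sum of multisets.
\<close>

type_synonym mon = "nat multiset"

definition face_mon :: "nat set \<Rightarrow> mon" where
  "face_mon F = mset_set F"

text \<open>
  List positions start at 0, so the factors $x_{i_j}$ with $j$ odd are at the even positions.
\<close>

definition sort_pair :: "mon \<Rightarrow> mon \<Rightarrow> mon \<times> mon" where
  "sort_pair u v =
     (let w = sorted_list_of_multiset (u + v)
      in (mset (nths w {j. even j}), mset (nths w {j. odd j})))"

definition sortable :: "nat set set \<Rightarrow> bool" where
  "sortable \<Gamma> \<longleftrightarrow>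
     (let M = face_mon ` \<Gamma> in \<forall>u\<in>M. \<forall>v\<in>M. sort_pair u v \<in> M \<times> M)"


section \<open>The Stanley-Reisner ring\<close>

text \<open>
  $K[x_1,\dots,x_n]$ is the subring, on the variables in $[n]$, of the monoid algebra over $K$
  of all monomials; the field $K$ is the type \<open>'k\<close>.
\<close>

definition poly_ring :: "nat \<Rightarrow> (mon \<Rightarrow>\<^sub>0 'k::field) ring" where
  "poly_ring n =
     \<lparr>carrier = {p. \<forall>u \<in> Poly_Mapping.keys p. set_mset u \<subseteq> {1..n}},
      monoid.mult = (*), one = 1, zero = 0, add = (+)\<rparr>"

definition face_poly :: "nat set \<Rightarrow> (mon \<Rightarrow>\<^sub>0 'k::field)" where
  "face_poly F = Poly_Mapping.single (face_mon F) 1"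

definition stanley_reisner_ideal :: "nat \<Rightarrow> nat set set \<Rightarrow> (mon \<Rightarrow>\<^sub>0 'k::field) set" where
  "stanley_reisner_ideal n \<Gamma> = genideal (poly_ring n) {face_poly F | F. F \<subseteq> {1..n} \<and> F \<notin> \<Gamma>}"

definition stanley_reisner_ring ::
    "'k::field itself \<Rightarrow> nat \<Rightarrow> nat set set \<Rightarrow> (mon \<Rightarrow>\<^sub>0 'k) set ring" where
  "stanley_reisner_ring K n \<Gamma> = poly_ring n Quot stanley_reisner_ideal n \<Gamma>"


section \<open>Cohen-Macaulay rings\<close>

text \<open>
  A regular sequence: each entry is a nonzerodivisor modulo the ideal generated by its
  predecessors, and the entries together generate a proper ideal.
\<close>

definition regular_seq :: "('a, 'b) ring_scheme \<Rightarrow> 'a list \<Rightarrow> bool" where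
  "regular_seq R xs \<longleftrightarrow>
     set xs \<subseteq> carrier R \<and>
     (\<forall>i<length xs. \<forall>a\<in>carrier R.
        xs ! i \<otimes>\<^bsub>R\<^esub> a \<in> genideal R (set (take i xs)) \<longrightarrow> a \<in> genideal R (set (take i xs))) \<and>
     genideal R (set xs) \<noteq> carrier R"

definition ideal_depth :: "('a, 'b) ring_scheme \<Rightarrow> 'a set \<Rightarrow> enat" where
  "ideal_depth R I = Sup {enat (length xs) | xs. regular_seq R xs \<and> set xs \<subseteq> I}"

text \<open>The list \<open>Qs\<close> ranges over the strict chains of primes properly contained in \<open>P\<close>.\<close>

definition prime_height :: "('a, 'b) ring_scheme \<Rightarrow> 'a set \<Rightarrow> enat" where
  "prime_height R P =
     Sup {enat (length Qs) | Qs. sorted_wrt (\<subset>) (Qs @ [P]) \<and> (\<forall>Q\<in>set Qs. primeideal Q R)}"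

text \<open>
  The definition of Eisenbud, Commutative Algebra, Section 18.2: a Noetherian ring is
  Cohen-Macaulay if depth and height (codimension) agree at every maximal ideal.
  Depth and height are those of the localization there, so this avoids localizing.
\<close>

definition cohen_macaulay_ring :: "('a, 'b) ring_scheme \<Rightarrow> bool" where
  "cohen_macaulay_ring R \<longleftrightarrow>
     cring R \<and> noetherian_ring R \<and>
     (\<forall>P. maximalideal P R \<longrightarrow> ideal_depth R P = prime_height R P)"

definition cohen_macaulay_complex :: "'k::field itself \<Rightarrow> nat \<Rightarrow> nat set set \<Rightarrow> bool" where
  "cohen_macaulay_complex K n \<Gamma> \<longleftrightarrow> cohen_macaulay_ring (stanley_reisner_ring K n \<Gamma>)"

end

theory Submission
  imports Defs "HOL-Library.Multiset_Order"
begin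

text \<open>
  Sorting two faces averages their counting functions \<open>x \<mapsto> \<bar>F \<inter> {..x}\<bar>\<close>. Iterating, one face
  can be clipped against another, and this shows that together with a minimal nonface \<open>N\<close> of
  size \<open>d\<close> every \<open>d\<close>-subset of \<open>[min N, max N]\<close> is a nonface. So \<open>\<Gamma>\<close> is given by capacity
  constraints on intervals. This class is closed under links and deletions, and the last vertex
  of a violable constraint ending first is a shedding vertex.

  A Cohen-Macaulay \<open>\<Gamma>\<close> is pure because at the irrelevant ideal the depth is at most the
  dimension of every associated prime \<open>(x\<^sub>i : i \<notin> F)\<close>, \<open>F\<close> a facet, while the height is at
  least \<open>\<bar>F\<bar>\<close>. Conversely, by Zariski's lemma a maximal ideal contains, for every \<open>i\<close>, a monic
  polynomial \<open>y\<^sub>i\<close> in \<open>x\<^sub>i\<close> of a common degree. The elements \<open>\<Sum>\<^sub>i y\<^sub>i ^ (4 ^ (k * i))\<close> for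
  \<open>1 \<le> k \<le> e\<close>, where \<open>e\<close> is the size of the facets, form a regular sequence modulo
  \<open>(x\<^sub>i : i \<notin> F)\<close> for every facet \<open>F\<close>, and the exact sequences of deletions and links extend
  this to pure vertex decomposable complexes. Since depth never exceeds height, and height
  never exceeds the dimension, all three agree.
\<close>

section \<open>Sortable flag complexes are vertex decomposable\<close>

text \<open>The definition of Cohen-Macaulay asks about every maximal ideal, not only the irrelevant
  one, and K may be finite and not algebraically closed. So neither the graded theory nor generic
  linear forms are at hand. One sequence has to lie in a given maximal ideal and be regular modulo
  every facet prime; the widely spread exponents do the work of generic coefficients, for they let
  the k-th parameter be dominated by the k-th vertex of any prescribed facet.

  Localizations, quotients and modules are avoided. Statements about R/I are statements about ideals
  above I in one fixed ring, and associated primes are prime colon ideals. That ring is the whole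
  type of polynomials in the variables \<open>X i\<close>, \<open>i\<close> any natural number. It
  is not noetherian, but \<open>nonface_ideal \<Gamma>\<close> contains all variables outside [n].
  Only at the end is everything carried over to the quotient ring of the statement.

  In the induction a link is replaced by its cone with apex v, because I : x_v is the ideal of that
  cone. This keeps the dimension constant, so one list of parameters serves all complexes that
  occur.\<close>

definition cnt :: "nat set \<Rightarrow> nat \<Rightarrow> nat" where
  "cnt F x = card (F \<inter> {..x})"

text \<open>The entries up to \<open>x\<close> form a prefix of a sorted list, and a prefix of
  length m has (m + 1) div 2 even and m div 2 odd positions, counted from 0. Removing the head swaps
  the parities.\<close>

lemma length_filter_nths_sorted:
  fixes w :: "nat list"
  assumes "sorted w"
  shows "length (filter (\<lambda>i. i \<le> x) (nths w {j. even j})) = (length (filter (\<lambda>i. i \<le> x) w) + 1) div 2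
    \<and> length (filter (\<lambda>i. i \<le> x) (nths w {j. odd j})) = length (filter (\<lambda>i. i \<le> x) w) div 2"
  using assms
proof (induction w)
  case Nil
  then show ?case by simp
next
  case (Cons a w)
  show ?case
  proof (cases "a \<le> x")
    case True
    then show ?thesis using Cons by (simp add: nths_Cons)
  next
    case False
    then have gt: "\<forall>b\<in>set (a # w). \<not> b \<le> x"
      using Cons.prems by auto
    then have "filter (\<lambda>i. i \<le> x) (a # w) = []"
      by (simp only: filter_empty_conv)
    moreover have "filter (\<lambda>i. i \<le> x) (nths (a # w) A) = []" for A
      using gt set_nths_subset[of "a # w" A] by (simp only: filter_empty_conv) blast
    ultimately show ?thesis by simp
  qed
qed

lemma cnt_eq_size: "finite F \<Longrightarrow> cnt F x = size (filter_mset (\<lambda>i. i \<le> x) (mset_set F))"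
  by (simp add: cnt_def filter_mset_mset_set Int_def)

text \<open>Only the first component of the sorted pair is used. It takes the positions 0, 2, ...,
  which is why the average is rounded up.\<close>

lemma sortable_average:
  assumes "sortable \<Gamma>" "F \<in> \<Gamma>" "G \<in> \<Gamma>" "\<And>H. H \<in> \<Gamma> \<Longrightarrow> finite H"
  shows "\<exists>U\<in>\<Gamma>. \<forall>x. cnt U x = (cnt F x + cnt G x + 1) div 2"
proof -
  define w where "w = sorted_list_of_multiset (mset_set F + mset_set G)"
  have "sort_pair (face_mon F) (face_mon G) \<in> face_mon ` \<Gamma> \<times> face_mon ` \<Gamma>"
    using assms by (auto simp: sortable_def Let_def)
  then obtain U where U: "U \<in> \<Gamma>" "mset (nths w {j. even j}) = mset_set U"
    by (auto simp: sort_pair_def face_mon_def w_def Let_def)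
  have "cnt U x = (cnt F x + cnt G x + 1) div 2" for x
  proof -
    have "cnt U x = length (filter (\<lambda>i. i \<le> x) (nths w {j. even j}))"
      using U assms(4) by (simp add: cnt_eq_size flip: U(2) mset_filter)
    also have "\<dots> = (length (filter (\<lambda>i. i \<le> x) w) + 1) div 2"
      using length_filter_nths_sorted[of w x] by (simp add: w_def)
    also have "length (filter (\<lambda>i. i \<le> x) w) = size (filter_mset (\<lambda>i. i \<le> x) (mset w))"
      by (simp flip: mset_filter)
    also have "\<dots> = cnt F x + cnt G x"
      using assms by (simp add: w_def cnt_eq_size)
    finally show ?thesis .
  qed
  then show ?thesis using U by blast
qed

text \<open>The iterated map fixes both \<open>a\<close> and \<open>a + 1\<close> and moves every
  other value towards the nearer of the two, by at least one. So \<open>t\<close> steps suffice when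
  \<open>t\<close> bounds the distance.\<close>

lemma funpow_average:
  fixes a b t :: nat
  assumes "b \<le> a + t + 1" "a \<le> b + t"
  shows "((\<lambda>b. (b + a + 1) div 2) ^^ t) b = max a (min (a + 1) b)"
  using assms
proof (induction t arbitrary: b)
  case 0
  then show ?case by auto
next
  case (Suc t)
  have "((\<lambda>b. (b + a + 1) div 2) ^^ Suc t) b = ((\<lambda>b. (b + a + 1) div 2) ^^ t) ((b + a + 1) div 2)"
    by (simp add: funpow_Suc_right del: funpow.simps)
  also have "\<dots> = max a (min (a + 1) ((b + a + 1) div 2))"
    using Suc.prems by (intro Suc.IH) linarith+
  also have "\<dots> = max a (min (a + 1) b)"
    by linarith
  finally show ?case .
qed

lemma sortable_clip:
  assumes "sortable \<Gamma>" "F \<in> \<Gamma>" "G \<in> \<Gamma>" "\<And>H. H \<in> \<Gamma> \<Longrightarrow> finite H"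
  shows "\<exists>U\<in>\<Gamma>. \<forall>x. cnt U x = max (cnt G x) (min (cnt G x + 1) (cnt F x))"
proof -
  have "\<exists>U\<in>\<Gamma>. \<forall>x. cnt U x = ((\<lambda>b. (b + cnt G x + 1) div 2) ^^ t) (cnt F x)" for t
  proof (induction t)
    case 0
    then show ?case using assms by auto
  next
    case (Suc t)
    then obtain U where U: "U \<in> \<Gamma>" "\<forall>x. cnt U x = ((\<lambda>b. (b + cnt G x + 1) div 2) ^^ t) (cnt F x)"
      by blast
    from sortable_average[OF assms(1) U(1) assms(3,4)] show ?case
      by (auto simp: U(2))
  qed
  \<comment> \<open>Counting functions are bounded by the cardinalities, so one number of iterations
    suffices for all \<open>x\<close> at once.\<close>
  from this[of "card F + card G"] obtain U where U: "U \<in> \<Gamma>"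
    "\<forall>x. cnt U x = ((\<lambda>b. (b + cnt G x + 1) div 2) ^^ (card F + card G)) (cnt F x)"
    by blast
  have "cnt F x \<le> card F" "cnt G x \<le> card G" for x
    using assms by (auto simp: cnt_def intro!: card_mono)
  then have "cnt F x \<le> cnt G x + (card F + card G) + 1" "cnt G x \<le> cnt F x + (card F + card G)" for x
    by (metis add.commute add.left_commute trans_le_add1)+
  then have "cnt U x = max (cnt G x) (min (cnt G x + 1) (cnt F x))" for x
    using U(2) funpow_average by metis
  then show ?thesis using U by blast
qed

lemma cnt_inject:
  assumes "finite U" "finite N" "\<And>x. cnt U x = cnt N x"
  shows "U = N"
proof -
  have lt: "card (U \<inter> {..<i}) = card (N \<inter> {..<i})" for i
    using assms(3)[of "i - 1"] by (cases i) (simp_all add: cnt_def lessThan_Suc_atMost)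
  have "cnt V i = card (V \<inter> {..<i}) + card (V \<inter> {i})" if "finite V" for V i
  proof -
    have "V \<inter> {..i} = (V \<inter> {..<i}) \<union> (V \<inter> {i})" by auto
    then show ?thesis using that by (simp only: cnt_def) (subst card_Un_disjoint, auto)
  qed
  then have "card (U \<inter> {i}) = card (N \<inter> {i})" for i
    using assms lt by (metis add_left_cancel)
  moreover have "card (V \<inter> {i}) = (if i \<in> V then 1 else 0)" for V :: "nat set" and i
    by simp
  ultimately have "i \<in> U \<longleftrightarrow> i \<in> N" for i by (metis zero_neq_one)
  then show ?thesis by blast
qed

lemma cnt_Diff:
  assumes "finite N" "a \<in> N"
  shows "cnt (N - {a}) x = (if a \<le> x then cnt N x - 1 else cnt N x)"
proof -
  have "(N - {a}) \<inter> {..x} = (N \<inter> {..x}) - {a}" by auto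
  then show ?thesis using assms by (auto simp: cnt_def)
qed

text \<open>
  Averaging repeatedly with one fixed face clips the counting function of the other face.
  Clipping \<open>F\<close> against \<open>N\<close> without its maximum and then against \<open>N\<close> without its minimum
  produces exactly \<open>N\<close>.
\<close>

lemma minimal_nonface_interval:
  assumes \<Gamma>: "simplicial_complex n \<Gamma>" "sortable \<Gamma>"
    and N: "minimal_nonface n \<Gamma> N" and F: "F \<in> \<Gamma>" "F \<subseteq> {Min N..Max N}"
  shows "card F \<noteq> card N"
proof
  assume eq: "card F = card N"
  have finF: "finite H" if "H \<in> \<Gamma>" for H
    using \<Gamma> that by (auto simp: simplicial_complex_def intro: finite_subset)
  have fin: "finite N" and nf: "N \<notin> \<Gamma>" and sub: "\<And>G. G \<subset> N \<Longrightarrow> G \<in> \<Gamma>"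
    using N by (auto simp: minimal_nonface_def intro: finite_subset)
  have ne: "N \<noteq> {}" using nf \<Gamma> by (auto simp: simplicial_complex_def)
  have MM: "Min N \<in> N" "Max N \<in> N" using fin ne by auto
  have faces: "N - {Max N} \<in> \<Gamma>" "N - {Min N} \<in> \<Gamma>"
    using MM by (auto intro!: sub)
  obtain U where U: "U \<in> \<Gamma>"
    "\<And>x. cnt U x = max (cnt (N - {Max N}) x) (min (cnt (N - {Max N}) x + 1) (cnt F x))"
    using sortable_clip[OF \<Gamma>(2) F(1) faces(1) finF] by blast
  obtain W where W: "W \<in> \<Gamma>"
    "\<And>x. cnt W x = max (cnt (N - {Min N}) x) (min (cnt (N - {Min N}) x + 1) (cnt U x))"
    using sortable_clip[OF \<Gamma>(2) U(1) faces(2) finF] by blast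
  have low: "cnt F x = 0 \<and> cnt N x = 0" if "x < Min N" for x
  proof -
    have "F \<inter> {..x} = {}" using F(2) that by auto
    moreover have "N \<inter> {..x} = {}" using that fin ne by auto
    ultimately show ?thesis by (simp add: cnt_def)
  qed
  have high: "cnt F x = cnt N x" if "Max N \<le> x" for x
  proof -
    have "F \<inter> {..x} = F" using F(2) that by auto
    moreover have "N \<inter> {..x} = N" using that fin ne by auto
    ultimately show ?thesis using eq by (simp add: cnt_def)
  qed
  have pos: "cnt N x > 0" if "Min N \<le> x" for x
    using MM fin that by (auto simp: cnt_def card_gt_0_iff)
  have MinMax: "Min N \<le> Max N" using fin ne by simp
  have "cnt W x = cnt N x" for x
  proof (cases "x < Min N")
    case True
    then show ?thesis
      using low[OF True] U(2)[of x] W(2)[of x] MinMax cnt_Diff[OF fin MM(1), of x] cnt_Diff[OF fin MM(2), of x]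
      by simp
  next
    case False
    \<comment> \<open>Removing the maximum lowers the count of \<open>N\<close> only from
      \<open>Max N\<close> on, where \<open>F\<close> has its full count; so the first clipping
      keeps the count at least that of \<open>N\<close>. Removing the minimum lowers it by one from
      \<open>Min N\<close> on, so the upper limit of the second clipping is exactly the count of
      \<open>N\<close>.\<close>
    have "cnt N x \<le> cnt U x"
      using U(2)[of x] high[of x] pos[of x] False cnt_Diff[OF fin MM(2), of x]
      by (cases "Max N \<le> x") auto
    then show ?thesis
      using W(2)[of x] False pos[of x] cnt_Diff[OF fin MM(1), of x] by auto
  qed
  then have "W = N" by (intro cnt_inject finF W fin)
  then show False using W nf by simp
qed

section \<open>Complexes given by capacities of intervals\<close>

definition capacity_complex :: "nat set \<Rightarrow> (nat \<times> nat \<times> nat) set \<Rightarrow> nat set set" where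
  "capacity_complex V J = {F. F \<subseteq> V \<and> (\<forall>(l, r, c)\<in>J. card (F \<inter> {l..r}) \<le> c)}"

lemma capacity_complexD:
  "F \<in> capacity_complex V J \<Longrightarrow> (l, r, c) \<in> J \<Longrightarrow> card (F \<inter> {l..r}) \<le> c"
  by (auto simp: capacity_complex_def)

lemma capacity_complex_subset:
  assumes "finite V" "G \<in> capacity_complex V J" "H \<subseteq> G"
  shows "H \<in> capacity_complex V J"
proof -
  have "finite G" using assms by (auto simp: capacity_complex_def intro: finite_subset)
  then have "card (H \<inter> {l..r}) \<le> c" if "(l, r, c) \<in> J" for l r c
    using capacity_complexD[OF assms(2) that] assms(3)
      card_mono[of "G \<inter> {l..r}" "H \<inter> {l..r}"] by fastforce
  then show ?thesis using assms by (auto simp: capacity_complex_def)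
qed

lemma exists_minimal_nonface:
  assumes "F \<subseteq> {1..n}" "F \<notin> \<Gamma>"
  shows "\<exists>N\<subseteq>F. minimal_nonface n \<Gamma> N"
proof -
  have "finite F" using assms finite_subset by blast
  then show ?thesis using assms
  proof (induction F rule: finite_psubset_induct)
    case (psubset F)
    show ?case
    proof (cases "\<exists>G\<subset>F. G \<notin> \<Gamma>")
      case True
      then show ?thesis using psubset by (meson order_trans psubset_imp_subset)
    next
      case False
      then show ?thesis using psubset.prems by (auto simp: minimal_nonface_def)
    qed
  qed
qed

text \<open>A nonface contains a minimal nonface \<open>N\<close>, which violates the capacity of
  its own interval. Conversely, a face with \<open>d\<close> points in that interval would contain a
  face of size \<open>card N\<close> there, against \<open>minimal_nonface_interval\<close>.\<close>

lemma sortable_flag_eq_capacity_complex: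
  assumes \<Gamma>: "simplicial_complex n \<Gamma>" "sortable \<Gamma>" "flag_complex n d \<Gamma>"
  shows "\<exists>J. \<Gamma> = capacity_complex {1..n} J"
proof -
  define J where "J = {(Min N, Max N, d - 1) | N. minimal_nonface n \<Gamma> N}"
  have card: "card N = d" "finite N" "N \<noteq> {}" if "minimal_nonface n \<Gamma> N" for N
    using that \<Gamma> by (auto simp: flag_complex_def minimal_nonface_def simplicial_complex_def
      intro: finite_subset)
  have "\<Gamma> = capacity_complex {1..n} J"
  proof (intro equalityI subsetI)
    fix F assume F: "F \<in> \<Gamma>"
    have "card (F \<inter> {Min N..Max N}) \<le> d - 1" if N: "minimal_nonface n \<Gamma> N" for N
    proof (rule ccontr)
      assume "\<not> ?thesis"
      then have "d \<le> card (F \<inter> {Min N..Max N})" by simp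
      then obtain G where G: "G \<subseteq> F \<inter> {Min N..Max N}" "card G = d"
        by (meson obtain_subset_with_card_n)
      then have "G \<in> \<Gamma>" using F \<Gamma>(1) by (auto simp: simplicial_complex_def)
      then show False
        using minimal_nonface_interval[OF \<Gamma>(1,2) N, of G] G card(1)[OF N] by auto
    qed
    then show "F \<in> capacity_complex {1..n} J"
      using F \<Gamma>(1) by (auto simp: capacity_complex_def J_def simplicial_complex_def)
  next
    fix F assume F: "F \<in> capacity_complex {1..n} J"
    show "F \<in> \<Gamma>"
    proof (rule ccontr)
      assume "F \<notin> \<Gamma>"
      then obtain N where N: "N \<subseteq> F" "minimal_nonface n \<Gamma> N"
        using exists_minimal_nonface[of F n \<Gamma>] F by (auto simp: capacity_complex_def)
      have "N \<subseteq> F \<inter> {Min N..Max N}" using N card(2)[OF N(2)] by auto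
      moreover have "finite F" using F by (auto simp: capacity_complex_def intro: finite_subset)
      ultimately have "card N \<le> card (F \<inter> {Min N..Max N})" by (intro card_mono) auto
      moreover have "(Min N, Max N, d - 1) \<in> J" using N by (auto simp: J_def)
      then have "card (F \<inter> {Min N..Max N}) \<le> d - 1"
        using F by (auto simp: capacity_complex_def)
      \<comment> \<open>With \<open>d = 0\<close> the truncated \<open>d - 1\<close> would not be
        smaller than \<open>d\<close>.\<close>
      moreover have "card N > 0" using card(2,3)[OF N(2)] by (simp add: card_gt_0_iff)
      ultimately show False using card(1)[OF N(2)] by simp
    qed
  qed
  then show ?thesis by blast
qed

text \<open>Putting \<open>v\<close> into a face uses up one unit of the capacity of every interval
  through \<open>v\<close>.\<close>

lemma link_capacity_complex:
  assumes "finite V" "{v} \<in> capacity_complex V J"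
  shows "link (capacity_complex V J) v =
    capacity_complex (V - {v}) ((\<lambda>(l, r, c). (l, r, if v \<in> {l..r} then c - 1 else c)) ` J)"
    (is "?L = ?R")
proof -
  have v: "v \<in> V" using assms by (simp add: capacity_complex_def)
  \<comment> \<open>Since \<open>{v}\<close> is a face, no capacity around \<open>v\<close> is 0,
    and the truncated \<open>c - 1\<close> is the true difference.\<close>
  have c1: "c \<ge> 1" if "(l, r, c) \<in> J" "v \<in> {l..r}" for l r c
  proof -
    have "card ({v} \<inter> {l..r}) \<le> c" using assms(2) that by (auto simp: capacity_complex_def)
    moreover have "{v} \<inter> {l..r} = {v}" using that by auto
    ultimately show ?thesis by simp
  qed
  have eq: "card ((F \<union> {v}) \<inter> {l..r}) = card (F \<inter> {l..r}) + (if v \<in> {l..r} then 1 else 0)"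
    if "F \<subseteq> V - {v}" for F l r
  proof (cases "v \<in> {l..r}")
    case True
    then have "(F \<union> {v}) \<inter> {l..r} = insert v (F \<inter> {l..r})" by auto
    moreover have "v \<notin> F" using that by auto
    ultimately show ?thesis using True by simp
  next
    case False
    then have "(F \<union> {v}) \<inter> {l..r} = F \<inter> {l..r}" by auto
    then show ?thesis using False by auto
  qed
  have *: "F \<in> ?L \<longleftrightarrow> F \<in> ?R" for F
  proof (cases "F \<subseteq> V - {v}")
    case True
    have "F \<in> ?L \<longleftrightarrow> (\<forall>(l, r, c)\<in>J. card (F \<inter> {l..r}) \<le> c \<and> card ((F \<union> {v}) \<inter> {l..r}) \<le> c)"
      using True v by (auto simp: link_def capacity_complex_def)
    also have "\<dots> \<longleftrightarrow> (\<forall>(l, r, c)\<in>J. card (F \<inter> {l..r}) \<le> (if v \<in> {l..r} then c - 1 else c))"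
    proof (intro ball_cong refl, clarsimp simp del: atLeastAtMost_iff)
      fix l r c assume J: "(l, r, c) \<in> J"
      show "(card (F \<inter> {l..r}) \<le> c \<and> card (insert v F \<inter> {l..r}) \<le> c) =
         ((v \<in> {l..r} \<longrightarrow> card (F \<inter> {l..r}) \<le> c - Suc 0) \<and> (v \<notin> {l..r} \<longrightarrow> card (F \<inter> {l..r}) \<le> c))"
        using eq[OF True, of l r] c1[OF J] by (cases "v \<in> {l..r}") (auto simp del: atLeastAtMost_iff)
    qed
    also have "\<dots> \<longleftrightarrow> F \<in> ?R"
      using True by (auto simp: capacity_complex_def simp del: atLeastAtMost_iff)
    finally show ?thesis .
  next
    case False
    then show ?thesis by (auto simp: link_def capacity_complex_def)
  qed
  then show ?thesis by blast
qed

text \<open>Let \<open>v\<close> be the shedding vertex and suppose that a facet \<open>F\<close> of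
  the deletion could be extended by \<open>v\<close>. Capacity leaves some \<open>u < v\<close> of
  the interval of \<open>v\<close> outside \<open>F\<close>. As \<open>F\<close> is a facet of the
  deletion, \<open>F \<union> {u}\<close> violates some constraint. Its interval contains
  \<open>u\<close> but not \<open>v\<close>, for otherwise \<open>F \<union> {v}\<close> would
  violate it too. Thus it ends before \<open>v\<close>, against the choice of \<open>v\<close>.
  Points of \<open>V\<close> that are not vertices are removed beforehand, as only a vertex can be
  shed.\<close>

lemma vertex_decomposable_capacity_complex:
  assumes "finite V"
  shows "vertex_decomposable (capacity_complex V J)"
  using assms
proof (induction "card V" arbitrary: V J rule: less_induct)
  case less
  note fin = less.prems
  let ?\<Gamma> = "capacity_complex V J"
  define binding where "binding = (\<lambda>(l, r, c). (l, r, c) \<in> J \<and> c < card (V \<inter> {l..r}))"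
  consider (nonvertex) v where "v \<in> V" "{v} \<notin> ?\<Gamma>"
    | (free) "\<forall>v\<in>V. {v} \<in> ?\<Gamma>" "\<And>x. \<not> binding x"
    | (bind) x where "\<forall>v\<in>V. {v} \<in> ?\<Gamma>" "binding x" by blast
  then show ?case
  proof cases
    case nonvertex
    then obtain l r c where J: "(l, r, c) \<in> J" "c < card ({v} \<inter> {l..r})"
      by (auto simp: capacity_complex_def not_le)
    moreover have "card ({v} \<inter> {l..r}) = (if v \<in> {l..r} then 1 else 0)" by (simp add: Int_insert_left)
    ultimately have lrc: "(l, r, c) \<in> J" "v \<in> {l..r}" "c = 0"
      by (auto simp del: atLeastAtMost_iff split: if_splits)
    have "v \<notin> F" if "F \<in> ?\<Gamma>" for F
    proof
      assume "v \<in> F"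
      have "finite F" using that fin by (auto simp: capacity_complex_def intro: finite_subset)
      moreover have "card (F \<inter> {l..r}) \<le> 0" using capacity_complexD[OF that lrc(1)] lrc(3) by simp
      ultimately have "F \<inter> {l..r} = {}" by simp
      then show False using lrc \<open>v \<in> F\<close> by blast
    qed
    then have "?\<Gamma> = capacity_complex (V - {v}) J" by (auto simp: capacity_complex_def)
    moreover have "card (V - {v}) < card V" using nonvertex fin by (meson card_Diff1_less)
    ultimately show ?thesis using less.hyps[of "V - {v}" J] fin by auto
  next
    case free
    have "F \<in> ?\<Gamma>" if "F \<subseteq> V" for F
    proof -
      have "card (F \<inter> {l..r}) \<le> c" if "(l, r, c) \<in> J" for l r c
      proof -
        have "card (F \<inter> {l..r}) \<le> card (V \<inter> {l..r})"
          using \<open>F \<subseteq> V\<close> fin by (intro card_mono) auto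
        then show ?thesis using free(2)[of "(l, r, c)"] that by (auto simp: binding_def)
      qed
      then show ?thesis using that by (auto simp: capacity_complex_def)
    qed
    then have "Pow V \<subseteq> ?\<Gamma>" by blast
    moreover have "?\<Gamma> \<subseteq> Pow V" by (auto simp: capacity_complex_def)
    ultimately have "?\<Gamma> = Pow V" by blast
    then show ?thesis using fin by (simp add: vertex_decomposable.simplex)
  next
    case bind
    \<comment> \<open>Intervals are compared by their last point in \<open>V\<close> and not by
      \<open>r\<close>, which need not belong to \<open>V\<close>.\<close>
    define top where "top = (\<lambda>(l, r, c :: nat). Max (V \<inter> {l..r}))"
    obtain x where x: "binding x" "\<And>y. binding y \<Longrightarrow> top x \<le> top y"
      using ex_has_least_nat[of binding _ top] bind(2) by blast
    obtain l r c where lrc: "x = (l, r, c)" by (cases x)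
    let ?I = "V \<inter> {l..r}"
    define v where "v = Max ?I"
    have I: "(l, r, c) \<in> J" "c < card ?I" using x(1) by (auto simp: binding_def lrc)
    then have neI: "?I \<noteq> {}" by auto
    then have vI: "v \<in> ?I" unfolding v_def using fin by (intro Max_in) auto
    then have v: "v \<in> V" and vv: "{v} \<in> ?\<Gamma>" using bind(1) by auto
    have less1: "card (V - {v}) < card V" using v fin by (meson card_Diff1_less)
    have del: "deletion ?\<Gamma> v = capacity_complex (V - {v}) J"
      by (auto simp: deletion_def capacity_complex_def)
    show ?thesis
    proof (rule vertex_decomposable.shed[OF vv])
      show "vertex_decomposable (deletion ?\<Gamma> v)"
        unfolding del using less.hyps[OF less1] fin by simp
      show "vertex_decomposable (link ?\<Gamma> v)"
        unfolding link_capacity_complex[OF fin vv] using less.hyps[OF less1] fin by simp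
      fix F assume F: "facet (deletion ?\<Gamma> v) F"
      then have F1: "F \<in> ?\<Gamma>" "v \<notin> F" by (auto simp: facet_def deletion_def)
      have finF: "finite F" using F1 fin by (auto simp: capacity_complex_def intro: finite_subset)
      have notv: "F \<union> {v} \<notin> ?\<Gamma>"
      proof
        assume Fv: "F \<union> {v} \<in> ?\<Gamma>"
        have "card ((F \<union> {v}) \<inter> {l..r}) \<le> c" using Fv I by (auto simp: capacity_complex_def)
        moreover have "(F \<union> {v}) \<inter> {l..r} = insert v (F \<inter> {l..r})" using vI by auto
        ultimately have "card ((F \<union> {v}) \<inter> {l..r}) < card ?I" using I by simp
        moreover have "finite ((F \<union> {v}) \<inter> {l..r})" using finF by simp
        ultimately have "\<not> ?I \<subseteq> (F \<union> {v}) \<inter> {l..r}" by (meson card_mono linorder_not_le)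
        then have "\<exists>u\<in>?I. u \<notin> (F \<union> {v}) \<inter> {l..r}" by (simp only: subset_iff) (erule contrapos_np, simp)
        then obtain u where u0: "u \<in> ?I" "u \<notin> (F \<union> {v}) \<inter> {l..r}" by (elim bexE)
        have u: "u \<in> ?I" "u \<notin> F" "u \<noteq> v" using u0 by simp_all
        have uv: "u < v" using u fin by (auto simp: v_def intro!: le_neq_implies_less)
        have "F \<union> {u} \<notin> ?\<Gamma>"
        proof
          assume "F \<union> {u} \<in> ?\<Gamma>"
          then have "F \<union> {u} \<in> deletion ?\<Gamma> v" using F1 u by (auto simp: deletion_def)
          then show False using F u by (auto simp: facet_def)
        qed
        then obtain l' r' c' where J': "(l', r', c') \<in> J" "c' < card ((F \<union> {u}) \<inter> {l'..r'})"
          using F1 u by (auto simp: capacity_complex_def not_le)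
        have ule: "card (F \<inter> {l'..r'}) \<le> c'" "card ((F \<union> {v}) \<inter> {l'..r'}) \<le> c'"
          using F1 Fv J' by (auto simp: capacity_complex_def)
        have ui: "u \<in> {l'..r'}"
        proof (rule ccontr)
          assume "u \<notin> {l'..r'}"
          then have "(F \<union> {u}) \<inter> {l'..r'} = F \<inter> {l'..r'}" by auto
          then show False using J' ule by simp
        qed
        then have "(F \<union> {u}) \<inter> {l'..r'} = insert u (F \<inter> {l'..r'})" by auto
        then have cu: "card ((F \<union> {u}) \<inter> {l'..r'}) = card (F \<inter> {l'..r'}) + 1" using u finF by simp
        have vi: "v \<notin> {l'..r'}"
        proof
          assume "v \<in> {l'..r'}"
          then have "(F \<union> {v}) \<inter> {l'..r'} = insert v (F \<inter> {l'..r'})" by auto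
          then show False using F1 finF ule cu J' by simp
        qed
        have "(F \<union> {u}) \<inter> {l'..r'} \<subseteq> V \<inter> {l'..r'}"
          using F1 u by (auto simp: capacity_complex_def)
        then have "card ((F \<union> {u}) \<inter> {l'..r'}) \<le> card (V \<inter> {l'..r'})" using fin by (intro card_mono) auto
        then have "binding (l', r', c')" using J' by (simp add: binding_def)
        then have "v \<le> Max (V \<inter> {l'..r'})" using x(2) by (auto simp: top_def lrc v_def)
        moreover have "Max (V \<inter> {l'..r'}) \<in> V \<inter> {l'..r'}"
          using u ui fin by (intro Max_in) auto
        ultimately have "v \<le> r'" by auto
        then show False using ui vi uv by auto
      qed
      have "G = F" if G: "G \<in> ?\<Gamma>" "F \<subseteq> G" for G
      proof (cases "v \<in> G")
        case True
        then have "F \<union> {v} \<subseteq> G" using G by auto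
        then show ?thesis using notv capacity_complex_subset[OF fin G(1)] by blast
      next
        case False
        then show ?thesis using F G by (auto simp: facet_def deletion_def)
      qed
      then show "facet ?\<Gamma> F" using F1 by (auto simp: facet_def)
    qed
  qed
qed

section \<open>Ideals in commutative rings\<close>

text \<open>A commutative ring is a module over itself: ideals are the submodules
  \<open>idl.subspace\<close>, and generated ideals are the spans \<open>idl.span\<close>.\<close>

global_interpretation idl: Modules.module "(*) :: 'a::comm_ring_1 \<Rightarrow> 'a \<Rightarrow> 'a"
  by unfold_locales (simp_all add: algebra_simps)

declare idl.scale_scale [simp del]

definition prime_idl :: "'a::comm_ring_1 set \<Rightarrow> bool" where
  "prime_idl Q \<longleftrightarrow> idl.subspace Q \<and> 1 \<notin> Q \<and> (\<forall>a b. a * b \<in> Q \<longrightarrow> a \<in> Q \<or> b \<in> Q)"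

definition colon :: "'a::comm_ring_1 set \<Rightarrow> 'a \<Rightarrow> 'a set" where
  "colon I z = {a. a * z \<in> I}"

text \<open>Regularity on R/I in terms of representatives. Properness is left out, so that exact
  sequences need not carry it along; it follows later from a maximal ideal that contains
  everything.\<close>

definition weakly_regular :: "'a::comm_ring_1 set \<Rightarrow> 'a list \<Rightarrow> bool" where
  "weakly_regular I fs \<longleftrightarrow> (\<forall>k<length fs. \<forall>a. fs ! k * a \<in> idl.span (I \<union> set (take k fs)) \<longrightarrow>
     a \<in> idl.span (I \<union> set (take k fs)))"

text \<open>This says that R/I is noetherian. It is relative to \<open>I\<close> because the
  polynomial ring used below has infinitely many variables.\<close>

definition noetherian_above :: "'a::comm_ring_1 set \<Rightarrow> bool" where
  "noetherian_above I \<longleftrightarrow> (\<forall>J. idl.subspace J \<and> I \<subseteq> J \<longrightarrow> (\<exists>B. finite B \<and> J = idl.span (I \<union> B)))"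

lemma idl_mult_left: "idl.subspace I \<Longrightarrow> a \<in> I \<Longrightarrow> r * a \<in> I"
  by (rule idl.subspace_scale)

lemma idl_mult_right: "idl.subspace I \<Longrightarrow> a \<in> I \<Longrightarrow> a * r \<in> I"
  using idl.subspace_scale[of I a r] by (simp add: mult.commute)

lemma idl_diff_cancel: "idl.subspace I \<Longrightarrow> a - b \<in> I \<Longrightarrow> b \<in> I \<Longrightarrow> a \<in> I"
  using idl.subspace_add[of I "a - b" b] by simp

lemma idl_diff_cancel': "idl.subspace I \<Longrightarrow> a - b \<in> I \<Longrightarrow> a \<in> I \<Longrightarrow> b \<in> I"
  using idl.subspace_diff[of I a "a - b"] by simp

lemma idl_span_self: "idl.subspace I \<Longrightarrow> idl.span I = I"
  using idl.span_eq_iff by blast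

lemma subspace_colon: "idl.subspace I \<Longrightarrow> idl.subspace (colon I z)"
  by (intro idl.subspaceI)
    (simp_all add: colon_def distrib_right mult.assoc idl.subspace_0 idl.subspace_add idl_mult_left)

lemma subset_colon: "idl.subspace I \<Longrightarrow> I \<subseteq> colon I z"
  by (auto simp: colon_def idl_mult_right)

lemma prime_idlD:
  assumes "prime_idl Q"
  shows "idl.subspace Q" "1 \<notin> Q" "a * b \<in> Q \<Longrightarrow> a \<in> Q \<or> b \<in> Q"
  using assms by (auto simp: prime_idl_def)

lemma prime_idl_power: "prime_idl Q \<Longrightarrow> a ^ n \<in> Q \<Longrightarrow> a \<in> Q"
  by (induction n) (auto simp: prime_idl_def)

lemma prime_idl_prod: "prime_idl Q \<Longrightarrow> (\<Prod>i\<in>A. f i) \<in> Q \<Longrightarrow> \<exists>i\<in>A. f i \<in> Q"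
  by (induction A rule: infinite_finite_induct) (auto simp: prime_idl_def)

lemma span_mult_mem:
  assumes "x \<in> idl.span A" "idl.subspace T" "\<And>a. a \<in> A \<Longrightarrow> c * a \<in> T"
  shows "c * x \<in> T"
proof -
  have "idl.subspace {y. c * y \<in> T}"
    using assms(2)
    by (intro idl.subspaceI)
      (simp_all add: distrib_left mult.left_commute[of c] idl.subspace_0 idl.subspace_add idl_mult_left)
  then have "idl.span A \<subseteq> {y. c * y \<in> T}"
    using assms(3) by (intro idl.span_minimal) auto
  then show ?thesis using assms(1) by auto
qed

lemma subspace_Union_chain:
  assumes "C \<noteq> {}" "\<And>J. J \<in> C \<Longrightarrow> idl.subspace J" "\<And>J K. J \<in> C \<Longrightarrow> K \<in> C \<Longrightarrow> J \<subseteq> K \<or> K \<subseteq> J"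
  shows "idl.subspace (\<Union>C)"
proof (rule idl.subspaceI)
  show "0 \<in> \<Union>C" using assms(1,2) idl.subspace_0 by blast
  show "x + y \<in> \<Union>C" if xy: "x \<in> \<Union>C" "y \<in> \<Union>C" for x y
  proof -
    obtain J K where JK: "J \<in> C" "x \<in> J" "K \<in> C" "y \<in> K" using xy by blast
    then consider "x \<in> K" | "y \<in> J" using assms(3) by blast
    then show ?thesis using JK assms(2) idl.subspace_add by cases blast+
  qed
  show "c * x \<in> \<Union>C" if "x \<in> \<Union>C" for c x
    using that assms(2) idl.subspace_scale by blast
qed

section \<open>Primes below a regular sequence\<close>

lemma exists_prime_disjoint:
  assumes I: "idl.subspace I" and M: "1 \<in> M" "\<And>a b. a \<in> M \<Longrightarrow> b \<in> M \<Longrightarrow> a * b \<in> M" "M \<inter> I = {}"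
  shows "\<exists>Q. prime_idl Q \<and> I \<subseteq> Q \<and> M \<inter> Q = {}"
proof -
  let ?A = "{J. idl.subspace J \<and> I \<subseteq> J \<and> M \<inter> J = {}}"
  have "\<exists>Q\<in>?A. \<forall>J\<in>?A. Q \<subseteq> J \<longrightarrow> J = Q"
  proof (rule subset_Zorn_nonempty)
    show "?A \<noteq> {}" using I M by blast
    fix C assume C: "C \<noteq> {}" "subset.chain ?A C"
    then have "idl.subspace (\<Union>C)"
      by (intro subspace_Union_chain) (auto simp: subset_chain_def)
    then show "\<Union>C \<in> ?A" using C by (auto simp: subset_chain_def)
  qed
  then obtain Q where Q: "idl.subspace Q" "I \<subseteq> Q" "M \<inter> Q = {}"
    and max: "\<forall>J\<in>?A. Q \<subseteq> J \<longrightarrow> J = Q" by auto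
  have max: "J = Q" if "idl.subspace J" "I \<subseteq> J" "M \<inter> J = {}" "Q \<subseteq> J" for J
    using max that by blast
  have meets: "\<exists>m r. m \<in> M \<and> m - r * a \<in> Q" if "a \<notin> Q" for a
  proof -
    have "idl.span (insert a Q) \<noteq> Q" using idl.span_base[of a "insert a Q"] that by auto
    moreover have "Q \<subseteq> idl.span (insert a Q)" using idl.span_superset by blast
    ultimately obtain m where "m \<in> M" "m \<in> idl.span (insert a Q)" using max[of "idl.span (insert a Q)"] Q by blast
    then show ?thesis using Q by (metis idl.span_breakdown_eq idl.span_eq_iff)
  qed
  have "a \<in> Q \<or> b \<in> Q" if ab: "a * b \<in> Q" for a b
  proof (rule ccontr)
    assume "\<not> ?thesis"
    then obtain m r m' r' where m: "m \<in> M" "m - r * a \<in> Q" "m' \<in> M" "m' - r' * b \<in> Q" using meets by metis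
    have "m * m' = m' * (m - r * a) + (r * a) * (m' - r' * b) + (r * r') * (a * b)" by (simp add: algebra_simps)
    also have "\<dots> \<in> Q"
      using idl_mult_left[OF Q(1) m(2)] idl_mult_left[OF Q(1) m(4)] idl_mult_left[OF Q(1) ab]
      by (intro idl.subspace_add[OF Q(1)])
    finally show False using M m Q by blast
  qed
  moreover have "1 \<notin> Q" using M Q by auto
  ultimately show ?thesis using Q by (auto simp: prime_idl_def)
qed

text \<open>The products \<open>x ^ k * s\<close> with \<open>s \<notin> Q\<close> avoid
  \<open>I\<close>, as \<open>x\<close> can be cancelled modulo \<open>I\<close>. A prime that
  avoids them all lies in \<open>Q\<close> and misses \<open>x\<close>.\<close>

lemma prime_below_nonzerodivisor:
  assumes I: "idl.subspace I" and Q: "prime_idl Q" "I \<subseteq> Q" "x \<in> Q"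
    and x: "\<And>a. x * a \<in> I \<Longrightarrow> a \<in> I"
  shows "\<exists>Q'. prime_idl Q' \<and> I \<subseteq> Q' \<and> Q' \<subset> Q"
proof -
  let ?M = "{x ^ k * s | k s. s \<notin> Q}"
  have pow: "s \<in> I" if "x ^ k * s \<in> I" for k s
    using that by (induction k) (auto simp: mult.assoc dest: x)
  have "\<exists>Q'. prime_idl Q' \<and> I \<subseteq> Q' \<and> ?M \<inter> Q' = {}"
  proof (rule exists_prime_disjoint[OF I])
    have "1 = x ^ 0 * 1 \<and> 1 \<notin> Q" using prime_idlD(2)[OF Q(1)] by simp
    then show "1 \<in> ?M" by blast
    show "?M \<inter> I = {}" using pow Q(2) by auto
    fix a b assume "a \<in> ?M" "b \<in> ?M"
    then obtain k s l t where "a = x ^ k * s" "s \<notin> Q" "b = x ^ l * t" "t \<notin> Q" by blast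
    then have "a * b = x ^ (k + l) * (s * t) \<and> s * t \<notin> Q"
      using prime_idlD(3)[OF Q(1)] by (auto simp: power_add algebra_simps)
    then show "a * b \<in> ?M" by blast
  qed
  then obtain Q' where Q': "prime_idl Q'" "I \<subseteq> Q'" "?M \<inter> Q' = {}" by blast
  have "s \<notin> Q'" if "s \<notin> Q" for s using Q'(3) that by (force intro: exI[of _ 0])
  moreover have "x ^ 1 * 1 \<in> ?M" using prime_idlD(2)[OF Q(1)] by blast
  then have "x \<notin> Q'" using Q'(3) by auto
  ultimately show ?thesis using Q' Q by blast
qed

text \<open>The chain grows downwards from \<open>P\<close>. Going through \<open>xs\<close> from
  the last entry to the first, each entry is a nonzerodivisor modulo its predecessors and makes room
  for one more prime, which need only contain the ideal of those. This yields that depth is at most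
  height.\<close>

theorem weakly_regular_imp_prime_chain:
  assumes xs: "weakly_regular I xs" and P: "prime_idl P" "I \<subseteq> P" "set xs \<subseteq> P"
  shows "\<exists>Qs. length Qs = length xs \<and> sorted_wrt (\<subset>) (Qs @ [P]) \<and> (\<forall>Q\<in>set Qs. prime_idl Q \<and> I \<subseteq> Q)"
proof -
  let ?I = "\<lambda>k. idl.span (I \<union> set (take k xs))"
  have "\<exists>Qs. length Qs = j \<and> sorted_wrt (\<subset>) (Qs @ [P]) \<and>
      (\<forall>Q\<in>set (Qs @ [P]). prime_idl Q \<and> ?I (length xs - j) \<subseteq> Q)" if "j \<le> length xs" for j
    using that
  proof (induction j)
    case 0
    have "?I (length xs) \<subseteq> P"
      using P prime_idlD(1)[OF P(1)] by (intro idl.span_minimal) auto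
    then show ?case using P by (auto intro!: exI[of _ "[]"])
  next
    case (Suc j)
    define k where "k = length xs - Suc j"
    have k: "k < length xs" "length xs - j = Suc k" using Suc.prems by (auto simp: k_def)
    obtain Qs where Qs: "length Qs = j" "sorted_wrt (\<subset>) (Qs @ [P])"
      "\<And>Q. Q \<in> set (Qs @ [P]) \<Longrightarrow> prime_idl Q \<and> ?I (Suc k) \<subseteq> Q" using Suc k by auto
    obtain Q Rs where Q: "Qs @ [P] = Q # Rs" by (cases "Qs @ [P]") auto
    have sub: "?I k \<subseteq> ?I (Suc k)" using k by (intro idl.span_mono) (auto simp: take_Suc_conv_app_nth)
    have xk: "xs ! k \<in> ?I (Suc k)" using k by (intro idl.span_base) (auto simp: take_Suc_conv_app_nth)
    have QQ: "prime_idl Q" "?I (Suc k) \<subseteq> Q" using Qs(3)[of Q] Q by auto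
    have "\<exists>Q'. prime_idl Q' \<and> ?I k \<subseteq> Q' \<and> Q' \<subset> Q"
      by (rule prime_below_nonzerodivisor[where x = "xs ! k"])
        (use QQ xk sub xs k in \<open>auto simp: weakly_regular_def\<close>)
    then obtain Q' where Q': "prime_idl Q'" "?I k \<subseteq> Q'" "Q' \<subset> Q" by blast
    have "Q' \<subset> R" if "R \<in> set (Qs @ [P])" for R
      using that Q'(3) Qs(2) unfolding Q by auto
    then have "sorted_wrt (\<subset>) ((Q' # Qs) @ [P])" using Qs(2) by simp
    moreover have "prime_idl R \<and> ?I k \<subseteq> R" if "R \<in> set ((Q' # Qs) @ [P])" for R
      using that Q' Qs(3)[of R] sub by auto
    ultimately show ?case using Qs(1) by (intro exI[of _ "Q' # Qs"]) (auto simp: k_def)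
  qed
  from this[of "length xs"] show ?thesis using idl.span_superset[of I] by fastforce
qed

section \<open>Noetherian quotients and associated primes\<close>

lemma noetherian_above_mono:
  assumes "noetherian_above I" "I \<subseteq> J"
  shows "noetherian_above J"
  unfolding noetherian_above_def
proof safe
  fix L assume L: "idl.subspace L" "J \<subseteq> L"
  then obtain B where B: "finite B" "L = idl.span (I \<union> B)"
    using assms by (force simp: noetherian_above_def)
  have "idl.span (J \<union> B) \<subseteq> L"
    using B L idl.span_superset[of "I \<union> B"] by (intro idl.span_minimal) auto
  moreover have "L \<subseteq> idl.span (J \<union> B)" unfolding B(2) using assms(2) by (intro idl.span_mono) auto
  ultimately show "\<exists>B. finite B \<and> L = idl.span (J \<union> B)" using B by blast
qed

text \<open>The union of the increasing ideals is finitely generated, so one of them contains all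
  later terms. In this form the ascending chain condition stops two infinite constructions: a strict
  chain of ideals, and the repeated divisions in \<open>colon_mod_nonzerodivisor\<close>.\<close>

lemma noetherian_above_sequence:
  assumes "noetherian_above I"
  shows "\<exists>g. z (Suc g) \<in> idl.span (I \<union> z ` {..g})"
proof -
  let ?J = "\<lambda>g. idl.span (I \<union> z ` {..g})"
  have mono: "?J g \<subseteq> ?J h" if "g \<le> h" for g h
    using that by (intro idl.span_mono) auto
  have "idl.subspace (\<Union>(range ?J))"
  proof (rule subspace_Union_chain)
    fix K L assume "K \<in> range ?J" "L \<in> range ?J"
    then obtain g h where "K = ?J g" "L = ?J h" by blast
    then show "K \<subseteq> L \<or> L \<subseteq> K" using mono[of g h] mono[of h g] nat_le_linear[of g h] by blast
  qed auto
  moreover have "I \<subseteq> ?J 0" using idl.span_superset by blast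
  then have "I \<subseteq> \<Union>(range ?J)" by blast
  ultimately obtain B where B: "finite B" "\<Union>(range ?J) = idl.span (I \<union> B)"
    using assms unfolding noetherian_above_def by meson
  have "\<exists>g. A \<subseteq> ?J g" if "finite A" "A \<subseteq> \<Union>(range ?J)" for A
    using that
  proof (induction A)
    case (insert a A)
    then obtain g h where "A \<subseteq> ?J g" "a \<in> ?J h" by auto
    then have "insert a A \<subseteq> ?J (max g h)" using mono[of g "max g h"] mono[of h "max g h"] by auto
    then show ?case by blast
  qed auto
  moreover have "B \<subseteq> \<Union>(range ?J)" unfolding B(2) using idl.span_superset by blast
  ultimately obtain g where g: "B \<subseteq> ?J g" using B(1) by blast
  have "idl.span (I \<union> B) \<subseteq> ?J g"
    using g idl.span_superset[of "I \<union> z ` {..g}"] by (intro idl.span_minimal) auto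
  moreover have "z (Suc g) \<in> ?J (Suc g)" by (intro idl.span_base) auto
  ultimately show ?thesis using B(2) by blast
qed

lemma noetherian_above_maximal:
  assumes noeth: "noetherian_above I" and A: "A \<noteq> {}" "\<And>J. J \<in> A \<Longrightarrow> idl.subspace J \<and> I \<subseteq> J"
  shows "\<exists>J\<in>A. \<forall>J'\<in>A. J \<subseteq> J' \<longrightarrow> J' = J"
proof (rule ccontr)
  assume "\<not> ?thesis"
  then have step: "\<exists>J'. J' \<in> A \<and> J \<subset> J'" if "J \<in> A" for J using that by blast
  have "\<exists>J. \<forall>n. J n \<in> A \<and> J n \<subset> J (Suc n)"
    using A(1) step by (intro dependent_nat_choice) auto
  then obtain J where J: "\<And>n. J n \<in> A" "\<And>n. J n \<subset> J (Suc n)" by blast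
  have "\<exists>z. z \<in> J (Suc n) - J n" for n using J(2)[of n] by blast
  then obtain z where z: "\<And>n. z n \<in> J (Suc n) - J n" by metis
  have mono: "J m \<subseteq> J n" if "m \<le> n" for m n
    by (rule lift_Suc_mono_le[of J]) (use J(2) that in auto)
  obtain g where g: "z (Suc g) \<in> idl.span (I \<union> z ` {..g})" using noetherian_above_sequence[OF noeth] by blast
  have "z i \<in> J (Suc g)" if "i \<le> g" for i
    using z[of i] mono[of "Suc i" "Suc g"] that by auto
  then have "idl.span (I \<union> z ` {..g}) \<subseteq> J (Suc g)"
    using A(2)[OF J(1)] by (intro idl.span_minimal) auto
  then show False using g z[of "Suc g"] by auto
qed

text \<open>A colon ideal that is maximal among the admissible ones inside \<open>m\<close> is
  prime. The usual argument passes from \<open>w\<close> to \<open>b * w\<close>, whose colon ideal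
  may leave \<open>m\<close>. In that case some \<open>s \<notin> m\<close> annihilates
  \<open>b * w\<close> modulo \<open>I\<close>, and \<open>s * w\<close>, whose colon ideal stays
  inside \<open>m\<close>, takes its place. Such \<open>s\<close> are the denominators of a
  localization at \<open>m\<close>.\<close>

lemma exists_prime_colon:
  assumes I: "idl.subspace I" "noetherian_above I" and m: "prime_idl m"
    and z: "colon I z \<subseteq> m" "J \<subseteq> colon I z"
  shows "\<exists>w. prime_idl (colon I w) \<and> colon I w \<subseteq> m \<and> J \<subseteq> colon I w"
proof -
  let ?A = "{colon I w | w. colon I w \<subseteq> m \<and> J \<subseteq> colon I w}"
  have "\<exists>K\<in>?A. \<forall>K'\<in>?A. K \<subseteq> K' \<longrightarrow> K' = K"
  proof (rule noetherian_above_maximal[OF I(2)])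
    show "?A \<noteq> {}" using z by blast
    show "idl.subspace K \<and> I \<subseteq> K" if "K \<in> ?A" for K
      using that subspace_colon[OF I(1)] subset_colon[OF I(1)] by auto
  qed
  then obtain w where w: "colon I w \<subseteq> m" "J \<subseteq> colon I w"
    and max: "\<forall>K\<in>?A. colon I w \<subseteq> K \<longrightarrow> K = colon I w"
    by auto
  have max: "colon I v = colon I w"
    if "colon I v \<subseteq> m" "J \<subseteq> colon I v" "colon I w \<subseteq> colon I v" for v
    using max that by blast
  have sub: "colon I w \<subseteq> colon I (b * w)" for b
    using idl_mult_left[OF I(1), of _ b] by (auto simp: colon_def mult.left_commute[of _ b])
  have "a \<in> colon I w \<or> b \<in> colon I w" if ab: "a * b \<in> colon I w" for a b
  proof (cases "colon I (b * w) \<subseteq> m")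
    case True
    then have "colon I (b * w) = colon I w" using max[of "b * w"] sub[of b] w by blast
    then show ?thesis using ab by (auto simp: colon_def mult.assoc)
  next
    case False
    then obtain s where s: "s \<notin> m" "s * (b * w) \<in> I" by (auto simp: colon_def)
    have "colon I (s * w) \<subseteq> m"
    proof
      fix t assume "t \<in> colon I (s * w)"
      then have "t * s \<in> colon I w" by (simp add: colon_def mult.assoc)
      then show "t \<in> m" using w(1) s(1) prime_idlD(3)[OF m] by blast
    qed
    then have "colon I (s * w) = colon I w" using max[of "s * w"] sub[of s] w by blast
    then show ?thesis using s by (auto simp: colon_def mult.left_commute)
  qed
  moreover have "1 \<notin> colon I w" using w(1) prime_idlD(2)[OF m] by blast
  ultimately show ?thesis using w subspace_colon[OF I(1)] by (auto simp: prime_idl_def)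
qed

text \<open>
  If the claim fails, then up to factors outside \<open>m\<close> every element annihilated by
  \<open>colon I z\<close> is divisible by \<open>x\<close> within the annihilated elements. Iterating from \<open>z\<close> and
  stopping by noetherianity yields an element of \<open>colon I z\<close> outside \<open>m\<close>: a version
  of Krull's intersection theorem.
\<close>

lemma colon_mod_nonzerodivisor:
  assumes I: "idl.subspace I" "noetherian_above I" and m: "prime_idl m" "x \<in> m"
    and x: "\<And>a. x * a \<in> I \<Longrightarrow> a \<in> I" and z: "colon I z \<subseteq> m"
  shows "\<exists>w. insert x (colon I z) \<subseteq> colon (idl.span (insert x I)) w \<and> colon (idl.span (insert x I)) w \<subseteq> m"
proof (rule ccontr)
  assume contr: "\<not> ?thesis"
  let ?U = "{y. \<forall>p\<in>colon I z. p * y \<in> I}"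
  let ?K = "idl.span (insert x I)"
  have step: "\<exists>s y'. s \<notin> m \<and> y' \<in> ?U \<and> s * y - x * y' \<in> I" if y: "y \<in> ?U" for y
  proof -
    have "insert x (colon I z) \<subseteq> colon ?K y"
      using y idl.span_base[of _ "insert x I"] idl_mult_right[of ?K x y] by (auto simp: colon_def)
    then obtain s where s: "s \<notin> m" "s * y \<in> ?K" using contr by (auto simp: colon_def)
    then obtain y' where y': "s * y - y' * x \<in> I" using I(1) by (metis idl.span_breakdown_eq idl.span_eq_iff)
    have "p * y' \<in> I" if p: "p \<in> colon I z" for p
    proof -
      have "p * y \<in> I" using y p by auto
      then have "s * (p * y) - p * (s * y - y' * x) \<in> I"
        using idl.subspace_diff[OF I(1) idl_mult_left[OF I(1)] idl_mult_left[OF I(1) y']] by blast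
      then have "x * (p * y') \<in> I" by (simp add: algebra_simps)
      then show ?thesis by (rule x)
    qed
    moreover have "s * y - x * y' \<in> I" using y' by (simp add: mult.commute)
    ultimately show ?thesis using s by blast
  qed
  define R where "R = (\<lambda>y y'. \<exists>s. s \<notin> m \<and> s * y - x * y' \<in> I)"
  have "\<exists>f. f 0 = z \<and> (\<forall>i. f i \<in> ?U \<and> R (f i) (f (Suc i)))"
  proof -
    have "z \<in> ?U" by (auto simp: colon_def)
    moreover have "\<exists>y'. y' \<in> ?U \<and> R y y'" if "y \<in> ?U" for y using step[OF that] by (auto simp: R_def)
    ultimately have "\<exists>f. \<forall>i. (f i \<in> ?U \<and> (i = 0 \<longrightarrow> f i = z)) \<and> R (f i) (f (Suc i))"
      by (intro dependent_nat_choice) auto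
    then show ?thesis by blast
  qed
  then obtain f where f: "f 0 = z" "\<And>i. f i \<in> ?U" "\<And>i. R (f i) (f (Suc i))" by blast
  then obtain s where s: "\<And>i. s i \<notin> m" "\<And>i. s i * f i - x * f (Suc i) \<in> I"
    unfolding R_def by metis
  define S where "S = (\<lambda>j. \<Prod>i<j. s i)"
  have S: "S j * z - x ^ j * f j \<in> I" for j
  proof (induction j)
    case 0
    then show ?case using I(1) f(1) by (simp add: S_def idl.subspace_0)
  next
    case (Suc j)
    have "s j * (S j * z - x ^ j * f j) + x ^ j * (s j * f j - x * f (Suc j)) \<in> I"
      using I(1) Suc s(2) by (intro idl.subspace_add idl_mult_left)
    then show ?case by (simp add: S_def algebra_simps)
  qed
  obtain g where g: "f (Suc g) \<in> idl.span (I \<union> f ` {..g})" using noetherian_above_sequence[OF I(2)] by blast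
  \<comment> \<open>Modulo \<open>I\<close> every \<open>x ^ j * f j\<close> is a multiple of
    \<open>z\<close>. Since \<open>f (Suc g)\<close> is, modulo \<open>I\<close>, a combination of
    the \<open>f j\<close> with \<open>j \<le> g\<close>, multiplying by \<open>x ^ Suc g\<close>
    leaves a spare factor \<open>x\<close> in each term.\<close>
  have "x ^ Suc g * f (Suc g) \<in> {y. \<exists>b. y - x * b * z \<in> I}"
  proof (rule span_mult_mem[OF g])
    show "idl.subspace {y. \<exists>b. y - x * b * z \<in> I}"
    proof (rule idl.subspaceI)
      show "0 \<in> {y. \<exists>b. y - x * b * z \<in> I}" using I(1) by (auto intro!: exI[of _ 0] simp: idl.subspace_0)
      fix y assume "y \<in> {y. \<exists>b. y - x * b * z \<in> I}"
      then obtain b where b: "y - x * b * z \<in> I" by blast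
      show "c * y \<in> {y. \<exists>b. y - x * b * z \<in> I}" for c
      proof -
        have "c * y - x * (c * b) * z = c * (y - x * b * z)" by (simp add: algebra_simps)
        then have "c * y - x * (c * b) * z \<in> I" using idl_mult_left[OF I(1) b] by simp
        then show ?thesis by blast
      qed
      fix y' assume "y' \<in> {y. \<exists>b. y - x * b * z \<in> I}"
      then obtain b' where "y' - x * b' * z \<in> I" by blast
      then have "(y - x * b * z) + (y' - x * b' * z) \<in> I" using b I(1) idl.subspace_add by blast
      then show "y + y' \<in> {y. \<exists>b. y - x * b * z \<in> I}"
        by (auto intro!: exI[of _ "b + b'"] simp: algebra_simps)
    qed
    fix a assume "a \<in> I \<union> f ` {..g}"
    then consider "a \<in> I" | j where "j \<le> g" "a = f j" by auto
    then show "x ^ Suc g * a \<in> {y. \<exists>b. y - x * b * z \<in> I}"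
    proof cases
      case 1
      then show ?thesis using I(1) by (auto intro!: exI[of _ 0] idl_mult_left)
    next
      case 2
      have "- (x ^ (Suc g - j)) * (S j * z - x ^ j * f j) \<in> I" using S I(1) idl_mult_left by blast
      moreover have "- (x ^ (Suc g - j)) * (S j * z - x ^ j * f j) =
          x * (x ^ (g - j) * x ^ j) * f j - x * (x ^ (g - j) * S j) * z"
        using 2(1) by (simp add: algebra_simps Suc_diff_le)
      moreover have "x ^ (g - j) * x ^ j = x ^ g" using 2(1) by (simp flip: power_add)
      ultimately show ?thesis using 2(2) by auto
    qed
  qed
  then obtain b where b: "x ^ Suc g * f (Suc g) - x * b * z \<in> I" by blast
  have "(S (Suc g) * z - x ^ Suc g * f (Suc g)) + (x ^ Suc g * f (Suc g) - x * b * z) \<in> I"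
    using S b I(1) idl.subspace_add by blast
  \<comment> \<open>With \<open>x \<in> m\<close> this puts \<open>S (Suc g)\<close>, a product of
    elements outside the prime \<open>m\<close>, into \<open>m\<close>.\<close>
  then have "S (Suc g) - x * b \<in> colon I z" by (simp add: colon_def algebra_simps)
  then have "S (Suc g) - x * b \<in> m" using z by blast
  moreover have "x * b \<in> m" using m prime_idlD(1) idl_mult_right by blast
  ultimately have "S (Suc g) \<in> m" using prime_idlD(1)[OF m(1)] idl_diff_cancel by blast
  then show False using prime_idl_prod[OF m(1)] s(1) unfolding S_def by blast
qed

text \<open>Each \<open>Q k\<close> is a prime colon ideal of \<open>I\<close> enlarged by the first
  \<open>k\<close> entries. The next entry is a nonzerodivisor modulo that ideal and hence outside
  \<open>Q k\<close>, while \<open>colon_mod_nonzerodivisor\<close> and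
  \<open>exists_prime_colon\<close> give a prime colon ideal of the next ideal that contains both.
  Any bound on chains above \<open>colon I z\<close> thus bounds the depth.\<close>

theorem weakly_regular_prime_chain_above:
  assumes I: "idl.subspace I" "noetherian_above I" and xs: "weakly_regular I xs"
    and m: "prime_idl m" "I \<subseteq> m" "set xs \<subseteq> m" and z: "prime_idl (colon I z)" "colon I z \<subseteq> m"
  shows "\<exists>Q. Q 0 = colon I z \<and> (\<forall>i\<le>length xs. prime_idl (Q i)) \<and> (\<forall>i<length xs. Q i \<subset> Q (Suc i))"
proof -
  let ?I = "\<lambda>k. idl.span (I \<union> set (take k xs))"
  have "\<exists>Q. Q 0 = colon I z \<and> (\<forall>i\<le>k. prime_idl (Q i)) \<and> (\<forall>i<k. Q i \<subset> Q (Suc i)) \<and>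
      (\<exists>w. Q k = colon (?I k) w) \<and> Q k \<subseteq> m" if "k \<le> length xs" for k
    using that
  proof (induction k)
    case 0
    have "?I 0 = I" using idl_span_self[OF I(1)] by simp
    then have "colon I z = colon (?I 0) z" by (simp only:)
    then show ?case using z by (intro exI[of _ "\<lambda>_. colon I z"]) blast
  next
    case (Suc k)
    then obtain Q w where Q: "Q 0 = colon I z" "\<And>i. i \<le> k \<Longrightarrow> prime_idl (Q i)"
      "\<And>i. i < k \<Longrightarrow> Q i \<subset> Q (Suc i)" "Q k = colon (?I k) w" "Q k \<subseteq> m" by auto
    let ?x = "xs ! k"
    have k: "k < length xs" using Suc.prems by simp
    have nzd: "a \<in> ?I k" if "?x * a \<in> ?I k" for a using xs k that by (auto simp: weakly_regular_def)
    have IS: "idl.span (insert ?x (?I k)) = ?I (Suc k)"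
    proof (intro equalityI idl.span_minimal)
      have "?I k \<subseteq> ?I (Suc k)" "?x \<in> ?I (Suc k)" using k
        by (auto simp: take_Suc_conv_app_nth intro!: idl.span_mono idl.span_base)
      then show "insert ?x (?I k) \<subseteq> ?I (Suc k)" by blast
      show "I \<union> set (take (Suc k) xs) \<subseteq> idl.span (insert ?x (?I k))"
        using k by (auto simp: take_Suc_conv_app_nth intro!: idl.span_base)
    qed auto
    have noeth: "noetherian_above (?I j)" for j
      by (rule noetherian_above_mono[OF I(2)]) (auto intro: idl.span_base)
    have xm: "?x \<in> m" using m(3) k by auto
    obtain v where v: "insert ?x (Q k) \<subseteq> colon (?I (Suc k)) v" "colon (?I (Suc k)) v \<subseteq> m"
      using colon_mod_nonzerodivisor[OF _ noeth m(1) xm nzd, of w] Q(4,5) by (auto simp: IS)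
    obtain u where u: "prime_idl (colon (?I (Suc k)) u)" "colon (?I (Suc k)) u \<subseteq> m"
      "insert ?x (Q k) \<subseteq> colon (?I (Suc k)) u"
      using exists_prime_colon[OF _ noeth m(1) v(2,1)] by auto
    have "?x \<notin> Q k"
    proof
      assume "?x \<in> Q k"
      then have "w \<in> ?I k" using nzd by (simp add: Q(4) colon_def)
      then have "1 \<in> Q k" by (simp add: Q(4) colon_def)
      then show False using prime_idlD(2)[OF Q(2)[of k]] by simp
    qed
    then have "Q k \<subset> colon (?I (Suc k)) u" using u(3) by blast
    then show ?case using Q u
      by (intro exI[of _ "Q(Suc k := colon (?I (Suc k)) u)"]) (auto simp: less_Suc_eq le_Suc_eq)
  qed
  from this[of "length xs"] show ?thesis by auto
qed

text \<open>The snake lemma for \<open>0 \<rightarrow> R/(I : x) \<rightarrow> R/I \<rightarrow> R/(I + x) \<rightarrow> 0\<close>, in elements.\<close>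

theorem weakly_regular_exact:
  assumes I: "idl.subspace I" and sub: "weakly_regular (colon I x) fs"
    and quot: "weakly_regular (idl.span (insert x I)) fs"
  shows "weakly_regular I fs"
proof -
  let ?F = "\<lambda>k. set (take k fs)"
  let ?I = "\<lambda>k. idl.span (I \<union> ?F k)"
  let ?C = "\<lambda>k. idl.span (colon I x \<union> ?F k)"
  let ?Q = "\<lambda>k. idl.span (idl.span (insert x I) \<union> ?F k)"
  have Q: "idl.span (insert x (?I k)) = ?Q k" for k
  proof (intro equalityI idl.span_minimal)
    show "insert x (?I k) \<subseteq> ?Q k"
    proof -
      have "I \<union> ?F k \<subseteq> ?Q k" "x \<in> ?Q k"
        by (auto intro!: idl.span_base)
      then show ?thesis using idl.span_minimal[of "I \<union> ?F k" "?Q k"] by auto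
    qed
    have "insert x I \<subseteq> idl.span (insert x (?I k))" by (auto intro!: idl.span_base)
    then have "idl.span (insert x I) \<subseteq> idl.span (insert x (?I k))" by (intro idl.span_minimal) auto
    then show "idl.span (insert x I) \<union> ?F k \<subseteq> idl.span (insert x (?I k))"
      by (auto intro!: idl.span_base)
  qed auto
  have memQ: "\<exists>r. c - r * x \<in> ?I k" if "c \<in> ?Q k" for c k
    using that unfolding Q[symmetric] by (metis idl.span_breakdown_eq idl.span_span)
  have Suc_I: "?I (Suc k) = idl.span (insert (fs ! k) (I \<union> ?F k))" if "k < length fs" for k
    using that by (simp add: take_Suc_conv_app_nth)
  have Suc_C: "?C (Suc k) = idl.span (insert (fs ! k) (colon I x \<union> ?F k))" if "k < length fs" for k
    using that by (simp add: take_Suc_conv_app_nth)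
  have IQ: "?I k \<subseteq> ?Q k" for k
    using idl.span_superset[of "insert x (?I k)"] by (auto simp: Q[symmetric])
  \<comment> \<open>Multiplication by \<open>x\<close> is injective from R/(I : x) to R/I. It stays
    injective modulo the first \<open>j\<close> entries because these are regular on the cokernel
    R/(I + x): the connecting map vanishes.\<close>
  have inj: "b \<in> ?C j" if "j \<le> length fs" "x * b \<in> ?I j" for b j
    using that
  proof (induction j arbitrary: b)
    case 0
    then have "b \<in> colon I x" using idl_span_self[OF I] by (simp add: colon_def mult.commute)
    then show ?case by (simp add: idl.span_base)
  next
    case (Suc j)
    then have j: "j < length fs" by simp
    then obtain c where c: "x * b - c * fs ! j \<in> ?I j"
      using Suc.prems(2) by (auto simp: Suc_I idl.span_breakdown_eq)
    have "x * b \<in> ?Q j" using idl.span_base[of x "insert x (?I j)"] by (simp add: Q idl_mult_right)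
    then have "fs ! j * c \<in> ?Q j"
      using idl_diff_cancel'[of "?Q j" "x * b" "c * fs ! j"] c IQ by (auto simp: mult.commute)
    then have "c \<in> ?Q j" using quot j by (auto simp: weakly_regular_def)
    then obtain r where r: "c - r * x \<in> ?I j" using memQ by blast
    have "(x * b - c * fs ! j) + fs ! j * (c - r * x) \<in> ?I j"
      using c r by (intro idl.span_add idl.span_scale)
    then have "x * (b - r * fs ! j) \<in> ?I j" by (simp add: algebra_simps)
    then have "b - r * fs ! j \<in> ?C j" using Suc.IH j by simp
    then show ?case using j by (auto simp: Suc_C idl.span_breakdown_eq)
  qed
  \<comment> \<open>Regularity on the cokernel writes \<open>a\<close> as \<open>b * x\<close>
    modulo \<open>?I k\<close>; then \<open>inj\<close> and regularity on the submodule apply to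
    \<open>b\<close>.\<close>
  have "a \<in> ?I k" if k: "k < length fs" and a: "fs ! k * a \<in> ?I k" for k a
  proof -
    have "a \<in> ?Q k" using a IQ quot k by (auto simp: weakly_regular_def)
    then obtain b where b: "a - b * x \<in> ?I k" using memQ by blast
    have "fs ! k * a - fs ! k * (a - b * x) \<in> ?I k" using idl.span_diff[OF a idl.span_scale[OF b]] .
    then have "x * (fs ! k * b) \<in> ?I k" by (simp add: algebra_simps)
    then have "fs ! k * b \<in> ?C k" using inj k by simp
    then have "b \<in> ?C k" using sub k by (auto simp: weakly_regular_def)
    moreover have "x * y \<in> ?I k" if "y \<in> ?C k" for y
    proof (rule span_mult_mem[OF that])
      fix c assume "c \<in> colon I x \<union> ?F k"
      then show "x * c \<in> ?I k"
        by (auto simp: colon_def mult.commute[of x] intro: idl.span_base idl_mult_right)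
    qed auto
    ultimately have "b * x \<in> ?I k" by (simp add: mult.commute)
    then show ?thesis using b idl_diff_cancel[of "?I k"] by auto
  qed
  then show ?thesis by (auto simp: weakly_regular_def)
qed

section \<open>Polynomials and monomial ideals\<close>

type_synonym 'k mpoly = "mon \<Rightarrow>\<^sub>0 'k"

abbreviation "keys \<equiv> Poly_Mapping.keys"
abbreviation "lookup \<equiv> Poly_Mapping.lookup"
abbreviation "single \<equiv> Poly_Mapping.single"

definition X :: "nat \<Rightarrow> 'k::field mpoly" where
  "X i = single {#i#} 1"

text \<open>For a complex on [n] this contains every variable outside [n].
  \<open>nonface_ideal (Pow F)\<close> is the prime generated by the variables outside
  \<open>F\<close>.\<close>

definition nonface_ideal :: "nat set set \<Rightarrow> 'k::field mpoly set" where
  "nonface_ideal \<Gamma> = {p. \<forall>u\<in>keys p. set_mset u \<notin> \<Gamma>}"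

text \<open>Substitutes 0 for the variables outside \<open>F\<close>. This is a retraction with
  kernel \<open>nonface_ideal (Pow F)\<close>, so classes modulo that ideal have canonical
  representatives.\<close>

definition restrict_vars :: "nat set \<Rightarrow> 'k::field mpoly \<Rightarrow> 'k mpoly" where
  "restrict_vars F p = Poly_Mapping.mapp (\<lambda>u c. c when set_mset u \<subseteq> F) p"

lemma lookup_restrict_vars:
  "lookup (restrict_vars F p) u = (if set_mset u \<subseteq> F then lookup p u else 0)"
  by (auto simp: restrict_vars_def lookup_mapp when_def in_keys_iff)

lemma keys_restrict_vars: "keys (restrict_vars F p) = {u \<in> keys p. set_mset u \<subseteq> F}"
  by (auto simp: in_keys_iff lookup_restrict_vars split: if_splits)

lemma mpoly_eqI: "(\<And>u. lookup p u = lookup q u) \<Longrightarrow> p = q"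
  by (rule poly_mapping_eqI)

lemma keys_empty_iff: "keys p = {} \<longleftrightarrow> p = 0"
  by (metis all_not_in_conv in_keys_iff keys_zero lookup_zero mpoly_eqI)

lemma mpoly_sum_monomials: "p = (\<Sum>u\<in>keys p. single u (lookup p u))"
proof (rule mpoly_eqI)
  fix v
  have "lookup (\<Sum>u\<in>keys p. single u (lookup p u)) v
      = (\<Sum>u\<in>keys p. if u = v then lookup p u else 0)"
    by (simp add: lookup_sum lookup_single when_def)
  then show "lookup p v = lookup (\<Sum>u\<in>keys p. single u (lookup p u)) v"
    by (auto simp: in_keys_iff)
qed

lemma keys_diff_subset: "keys (p - q) \<subseteq> keys p \<union> keys (q :: 'k::field mpoly)"
  by (auto simp: in_keys_iff lookup_minus)

lemma keys_mult_mem: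
  "w \<in> keys (p * q) \<Longrightarrow> \<exists>u\<in>keys p. \<exists>v\<in>keys q. w = u + v"
  using keys_mult[of p q] by blast

lemma lookup_mult_unique:
  fixes p q :: "'k::field mpoly"
  assumes "\<And>u' v'. u' \<in> keys p \<Longrightarrow> v' \<in> keys q \<Longrightarrow> u' + v' = u + v \<Longrightarrow> u' = u \<and> v' = v"
  shows "lookup (p * q) (u + v) = lookup p u * lookup q v"
proof -
  have "p * q = (\<Sum>a\<in>keys p. \<Sum>b\<in>keys q. single (a + b) (lookup p a * lookup q b))"
    by (subst mpoly_sum_monomials[of p], subst mpoly_sum_monomials[of q])
      (simp add: sum_product mult_single)
  then have "lookup (p * q) (u + v) =
      (\<Sum>a\<in>keys p. \<Sum>b\<in>keys q. if a + b = u + v then lookup p a * lookup q b else 0)"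
    by (simp add: lookup_sum lookup_single when_def)
  also have "\<dots> = (\<Sum>a\<in>keys p. \<Sum>b\<in>keys q. if b = v then (if a = u then lookup p a * lookup q b else 0) else 0)"
    using assms by (intro sum.cong refl) auto
  also have "\<dots> = (\<Sum>a\<in>keys p. if a = u then lookup p u * lookup q v else 0)"
    by (intro sum.cong refl) (auto simp: in_keys_iff)
  also have "\<dots> = lookup p u * lookup q v"
    by (auto simp: in_keys_iff)
  finally show ?thesis .
qed

lemma lookup_monomial_mult: "lookup (single t c * q) (t + v) = c * lookup (q :: 'k::field mpoly) v"
  by (subst lookup_mult_unique) (auto split: if_splits)

lemma lookup_const_mult: "lookup (single 0 c * q) v = c * lookup (q :: 'k::field mpoly) v"
  using lookup_monomial_mult[of 0 c q v] by simp

lemma keys_monomial_mult: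
  "keys (single t c * (q :: 'k::field mpoly)) \<subseteq> (\<lambda>v. t + v) ` keys q"
  using keys_mult[of "single t c" q] by (auto split: if_splits)

lemma keys_monic_monomial_mult:
  "keys (single t 1 * (q :: 'k::field mpoly)) = (\<lambda>v. t + v) ` keys q"
proof
  show "(\<lambda>v. t + v) ` keys q \<subseteq> keys (single t 1 * q)"
    by (auto simp only: in_keys_iff lookup_monomial_mult) simp
qed (rule keys_monomial_mult)

lemma restrict_vars_add: "restrict_vars F (p + q) = restrict_vars F p + restrict_vars F q"
  by (rule mpoly_eqI) (simp add: lookup_restrict_vars lookup_add)

lemma restrict_vars_diff: "restrict_vars F (p - q) = restrict_vars F p - restrict_vars F q"
  by (rule mpoly_eqI) (simp add: lookup_restrict_vars lookup_minus)

lemma restrict_vars_id: "(\<And>u. u \<in> keys p \<Longrightarrow> set_mset u \<subseteq> F) \<Longrightarrow> restrict_vars F p = p"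
  by (rule mpoly_eqI) (auto simp: lookup_restrict_vars in_keys_iff)

lemma restrict_vars_eq_0_iff: "restrict_vars F p = 0 \<longleftrightarrow> p \<in> nonface_ideal (Pow F)"
  by (auto simp: nonface_ideal_def keys_restrict_vars simp flip: keys_empty_iff)

lemma restrict_vars_1 [simp]: "restrict_vars F 1 = 1"
  by (rule restrict_vars_id) simp

lemma restrict_vars_0 [simp]: "restrict_vars F 0 = 0"
  by (rule restrict_vars_id) simp

lemma restrict_vars_restrict_vars [simp]: "restrict_vars F (restrict_vars F p) = restrict_vars F p"
  by (rule restrict_vars_id) (simp add: keys_restrict_vars)

lemma restrict_vars_mult: "restrict_vars F (p * q) = restrict_vars F p * restrict_vars F q"
proof -
  let ?p = "restrict_vars F p" and ?q = "restrict_vars F q"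
  have zero: "restrict_vars F (a * b) = 0" if "restrict_vars F a = 0" for a b :: "'a mpoly"
    using that by (force simp: restrict_vars_eq_0_iff nonface_ideal_def dest!: keys_mult_mem)
  have "restrict_vars F (?p * ?q) = ?p * ?q"
    by (rule restrict_vars_id) (force simp: keys_restrict_vars dest!: keys_mult_mem)
  moreover have "p * q = ?p * ?q + (p - ?p) * q + (q - ?q) * ?p"
    by (simp add: algebra_simps)
  moreover have "restrict_vars F ((p - ?p) * q) = 0" "restrict_vars F ((q - ?q) * ?p) = 0"
    by (rule zero, simp add: restrict_vars_diff)+
  ultimately show ?thesis by (simp add: restrict_vars_add)
qed

lemma X_nonface: "X i \<in> nonface_ideal \<Gamma> \<longleftrightarrow> {i} \<notin> \<Gamma>"
  by (simp add: X_def nonface_ideal_def)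

lemma subspace_nonface_ideal:
  assumes "\<And>F G. F \<in> \<Gamma> \<Longrightarrow> G \<subseteq> F \<Longrightarrow> G \<in> \<Gamma>"
  shows "idl.subspace (nonface_ideal \<Gamma>)"
proof (rule idl.subspaceI)
  show "p + q \<in> nonface_ideal \<Gamma>" if "p \<in> nonface_ideal \<Gamma>" "q \<in> nonface_ideal \<Gamma>" for p q
    using that keys_add[of p q] by (auto simp: nonface_ideal_def)
  show "c * p \<in> nonface_ideal \<Gamma>" if "p \<in> nonface_ideal \<Gamma>" for c p
    unfolding nonface_ideal_def
  proof safe
    fix w assume "w \<in> keys (c * p)" and w: "set_mset w \<in> \<Gamma>"
    then obtain u v where "v \<in> keys p" "w = u + v" using keys_mult_mem by blast
    then show False using that w assms[of "set_mset w" "set_mset v"] by (auto simp: nonface_ideal_def)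
  qed
qed (simp add: nonface_ideal_def)

lemma subspace_nonface_Pow: "idl.subspace (nonface_ideal (Pow F))"
  by (rule subspace_nonface_ideal) auto

text \<open>The ideal is the kernel of the ring homomorphism \<open>restrict_vars F\<close> into an
  integral domain.\<close>

lemma prime_nonface_Pow: "prime_idl (nonface_ideal (Pow F) :: 'k::field mpoly set)"
  unfolding prime_idl_def
  by (auto simp: subspace_nonface_Pow restrict_vars_mult simp flip: restrict_vars_eq_0_iff)

lemma nonface_ideal_mono: "\<Gamma> \<subseteq> \<Delta> \<Longrightarrow> nonface_ideal \<Delta> \<subseteq> nonface_ideal \<Gamma>"
  by (auto simp: nonface_ideal_def)

lemma mpoly_mem_subspaceI:
  assumes "idl.subspace J" "\<And>u. u \<in> keys p \<Longrightarrow> single u (lookup p u) \<in> J"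
  shows "p \<in> J"
  using assms by (subst mpoly_sum_monomials) (auto intro!: idl.subspace_sum)

subsection \<open>Noetherianity\<close>

lemma dickson_subsequence:
  fixes f :: "nat \<Rightarrow> nat multiset"
  assumes "finite V"
  shows "\<exists>r :: nat \<Rightarrow> nat. strict_mono r \<and> (\<forall>a\<in>V. \<forall>i j. i \<le> j \<longrightarrow> count (f (r i)) a \<le> count (f (r j)) a)"
  using assms
proof (induction V)
  case empty
  have "strict_mono (id :: nat \<Rightarrow> nat)" by (rule strict_mono_id)
  then show ?case by blast
next
  case (insert a V)
  then obtain r :: "nat \<Rightarrow> nat" where r0: "strict_mono r"
    "\<forall>b\<in>V. \<forall>i j. i \<le> j \<longrightarrow> count (f (r i)) b \<le> count (f (r j)) b"
    by (elim exE conjE)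
  have r: "strict_mono r" "\<And>b i j. b \<in> V \<Longrightarrow> i \<le> j \<Longrightarrow> count (f (r i)) b \<le> count (f (r j)) b"
    using r0 by auto
  define s where "s = (\<lambda>n. count (f (r n)) a)"
  obtain g where g: "strict_mono g" "monoseq (\<lambda>n. s (g n))" using seq_monosub[of s] by (elim exE conjE)
  have "\<exists>h :: nat \<Rightarrow> nat. strict_mono h \<and> (\<forall>i j. i \<le> j \<longrightarrow> s (h i) \<le> s (h j))"
  proof (cases "\<forall>m. \<forall>n\<ge>m. s (g m) \<le> s (g n)")
    case True
    then show ?thesis using g(1) by (intro exI[of _ g]) simp
  next
    case False
    then have dec: "\<forall>m. \<forall>n\<ge>m. s (g n) \<le> s (g m)" using g(2) by (auto simp: monoseq_def)
    \<comment> \<open>A nonincreasing sequence of natural numbers is constant from an index where it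
      attains its minimum, hence nondecreasing from there on.\<close>
    obtain N where N: "\<And>n. s (g N) \<le> s (g n)"
      using ex_has_least_nat[of "\<lambda>_. True" 0 "\<lambda>n. s (g n)"] by auto
    have "s (g (N + i)) = s (g N)" for i using dec N by (meson le_add1 le_antisym)
    moreover have "strict_mono (\<lambda>i. g (N + i))" using g(1) by (simp add: strict_mono_def)
    ultimately show ?thesis by (intro exI[of _ "\<lambda>i. g (N + i)"]) simp
  qed
  then obtain h :: "nat \<Rightarrow> nat" where h: "strict_mono h" "\<And>i j. i \<le> j \<Longrightarrow> s (h i) \<le> s (h j)" by blast
  have "count (f (r (h i))) b \<le> count (f (r (h j))) b" if "b \<in> insert a V" "i \<le> j" for b i j
    using that h r strict_mono_leD[OF h(1)] by (auto simp: s_def)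
  moreover have "strict_mono (\<lambda>i. r (h i))" using r(1) h(1) by (simp add: strict_mono_def)
  ultimately show ?case by (intro exI[of _ "\<lambda>i. r (h i)"]) auto
qed

lemma dickson_sequence:
  fixes f :: "nat \<Rightarrow> nat multiset"
  assumes "finite V" "\<And>i. set_mset (f i) \<subseteq> V"
  shows "\<exists>i j. i < j \<and> f i \<subseteq># f j"
proof -
  obtain r :: "nat \<Rightarrow> nat" where r: "strict_mono r" "\<forall>a\<in>V. \<forall>i j. i \<le> j \<longrightarrow> count (f (r i)) a \<le> count (f (r j)) a"
    using dickson_subsequence[OF assms(1)] by blast
  have "count (f (r 0)) a \<le> count (f (r 1)) a" for a
  proof (cases "a \<in> V")
    case False
    then have "a \<notin># f (r 0)" using assms(2) by blast
    then show ?thesis by (simp add: not_in_iff)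
  qed (use r(2) in simp)
  then have "f (r 0) \<subseteq># f (r 1)" by (rule mset_subset_eqI)
  moreover have "r 0 < r 1" using r(1) by (simp add: strict_mono_def)
  ultimately show ?thesis by blast
qed

lemma dickson:
  fixes L :: "nat multiset set"
  assumes "finite V" "\<And>u. u \<in> L \<Longrightarrow> set_mset u \<subseteq> V"
  shows "\<exists>D\<subseteq>L. finite D \<and> (\<forall>u\<in>L. \<exists>d\<in>D. d \<subseteq># u)"
proof -
  define D where "D = {d \<in> L. \<forall>u\<in>L. u \<subseteq># d \<longrightarrow> u = d}"
  have "finite D"
  proof (rule ccontr)
    assume "infinite D"
    then obtain f :: "nat \<Rightarrow> nat multiset" where f: "inj f" "range f \<subseteq> D"
      using infinite_countable_subset by blast
    then obtain i j where ij: "i < j" "f i \<subseteq># f j"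
      using dickson_sequence[OF assms(1), of f] assms(2) by (auto simp: D_def image_subset_iff)
    then have "f i = f j" using f(2) by (auto simp: D_def image_subset_iff)
    then show False using f(1) ij by (auto dest: injD)
  qed
  moreover have "\<exists>d\<in>D. d \<subseteq># u" if "u \<in> L" for u
    using that
  proof (induction u rule: measure_induct_rule[of size])
    case (less u)
    show ?case
    proof (cases "u \<in> D")
      case True
      then show ?thesis by blast
    next
      case False
      then obtain v where v: "v \<in> L" "v \<subseteq># u" "v \<noteq> u" using less.prems by (auto simp: D_def)
      then have "size v < size u" by (simp add: mset_subset_size subset_mset.less_le)
      then show ?thesis using less.IH v by (meson subset_mset.order_trans)
    qed
  qed
  ultimately show ?thesis by (intro exI[of _ D]) (auto simp: D_def)
qed

text \<open>Monomials are compared by the multiset order, a well-founded linear order compatible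
  with multiplication; it is lexicographic, with larger indices dominating.\<close>

definition lm :: "'k::field mpoly \<Rightarrow> mon" where
  "lm p = Max (keys p)"

lemma lm_in_keys: "p \<noteq> 0 \<Longrightarrow> lm p \<in> keys p"
  unfolding lm_def by (rule Max_in) (simp_all add: keys_empty_iff)

lemma lm_ge: "u \<in> keys p \<Longrightarrow> u \<le> lm p"
  unfolding lm_def by (rule Max_ge) simp_all

lemma lm_cancel:
  assumes "p \<noteq> 0" "q \<noteq> 0" "lm p = t + lm q"
    and r: "r = p - single t (lookup p (lm p) / lookup q (lm q)) * q"
  shows "r = 0 \<or> lm r < lm p"
proof -
  have "u \<noteq> lm p \<and> u \<le> lm p" if u: "u \<in> keys r" for u
  proof
    have "lookup r (lm p) = 0"
      using assms(1,2) lm_in_keys[of q] by (simp add: r lookup_minus assms(3) lookup_monomial_mult in_keys_iff)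
    then show "u \<noteq> lm p" using u by (auto simp: in_keys_iff)
    have "u \<in> keys p \<or> u \<in> (\<lambda>v. t + v) ` keys q"
      using u unfolding r using keys_diff_subset keys_monomial_mult by blast
    then show "u \<le> lm p"
    proof
      assume "u \<in> (\<lambda>v. t + v) ` keys q"
      then obtain v where "u = t + v" "v \<in> keys q" by blast
      then show ?thesis using lm_ge[of v q] assms(3) by (simp add: add_left_mono)
    qed (rule lm_ge)
  qed
  then show ?thesis using lm_in_keys[of r] by (metis order_le_neq_trans)
qed

text \<open>Hilbert's basis theorem by division. Leading monomials with support in \<Gamma> involve
  only the finitely many variables in \<open>V\<close>, so by Dickson's lemma finitely many of them
  divide all the others. A leading monomial with any other support is cancelled by an element of
  \<open>nonface_ideal \<Gamma>\<close>.\<close>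

theorem noetherian_above_nonface_ideal:
  assumes V: "finite V" "\<Gamma> \<subseteq> Pow V" and \<Gamma>: "\<And>F G. F \<in> \<Gamma> \<Longrightarrow> G \<subseteq> F \<Longrightarrow> G \<in> \<Gamma>"
  shows "noetherian_above (nonface_ideal \<Gamma> :: 'k::field mpoly set)"
  unfolding noetherian_above_def
proof safe
  fix J :: "'k mpoly set" assume J: "idl.subspace J" "nonface_ideal \<Gamma> \<subseteq> J"
  define L where "L = {lm p | p. p \<in> J \<and> p \<noteq> 0 \<and> set_mset (lm p) \<in> \<Gamma>}"
  obtain D where D: "D \<subseteq> L" "finite D" "\<And>u. u \<in> L \<Longrightarrow> \<exists>d\<in>D. d \<subseteq># u"
    using dickson[OF V(1), of L] V(2) by (auto simp: L_def)
  have "\<forall>d\<in>D. \<exists>p. lm p = d \<and> p \<in> J \<and> p \<noteq> 0" using D(1) by (auto simp: L_def)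
  then obtain g where g: "\<And>d. d \<in> D \<Longrightarrow> lm (g d) = d \<and> g d \<in> J \<and> g d \<noteq> 0" by metis
  let ?S = "idl.span (nonface_ideal \<Gamma> \<union> g ` D)"
  have "?S \<subseteq> J" using J g by (intro idl.span_minimal) auto
  moreover have "p \<in> ?S" if "p \<in> J" for p
    using that
  proof (induction "lm p" arbitrary: p rule: less_induct)
    case less
    show ?case
    proof (cases "p = 0")
      case True
      then show ?thesis by (simp add: idl.span_zero)
    next
      case p: False
      have "\<exists>q t. q \<in> ?S \<and> q \<in> J \<and> q \<noteq> 0 \<and> lm p = t + lm q"
      proof (cases "set_mset (lm p) \<in> \<Gamma>")
        case True
        then have "lm p \<in> L" using less.prems p by (auto simp: L_def)
        then obtain d where d: "d \<in> D" "d \<subseteq># lm p" using D(3) by blast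
        then have "lm p = (lm p - d) + lm (g d)" using g by simp
        moreover have "g d \<in> ?S" using d by (auto intro!: idl.span_base)
        ultimately show ?thesis using g[OF d(1)] by blast
      next
        case False
        let ?q = "single (lm p) 1 :: 'k mpoly"
        have q: "?q \<in> nonface_ideal \<Gamma>" using False by (simp add: nonface_ideal_def)
        then have "?q \<in> ?S" "?q \<in> J" using J by (auto intro: idl.span_base)
        moreover have "?q \<noteq> 0" by (simp flip: keys_empty_iff)
        moreover have "lm p = 0 + lm ?q" by (simp add: lm_def)
        ultimately show ?thesis by blast
      qed
      then obtain q t where q: "q \<in> ?S" "q \<in> J" "q \<noteq> 0" "lm p = t + lm q" by blast
      define c where "c = single t (lookup p (lm p) / lookup q (lm q))"
      have "p - c * q \<in> J" using J(1) less.prems q by (intro idl.subspace_diff idl_mult_left)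
      moreover have "p - c * q = 0 \<or> lm (p - c * q) < lm p"
        by (rule lm_cancel[OF p q(3,4)]) (simp add: c_def)
      ultimately have "p - c * q \<in> ?S" using less.hyps idl.span_zero by metis
      moreover have "c * q \<in> ?S" using q(1) by (rule idl.span_scale)
      ultimately show ?thesis using idl.span_add[of "p - c * q" _ "c * q"] by simp
    qed
  qed
  ultimately show "\<exists>B. finite B \<and> J = idl.span (nonface_ideal \<Gamma> \<union> B)" using D(2) by blast
qed

section \<open>Bounding the length of chains of primes\<close>

fun power_product :: "'a::comm_ring_1 list \<Rightarrow> nat list \<Rightarrow> 'a" where
  "power_product (a # as) (k # m) = a ^ k * power_product as m"
| "power_product _ _ = 1"

text \<open>
  Coquand and Lombardi: take the lexicographically smallest exponent \<open>m\<close> of an algebraic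
  relation, cancel \<open>as ! 0 ^ (m ! 0)\<close> modulo \<open>Q 0\<close>, reduce modulo \<open>as ! 0 \<in> Q 1\<close>, and repeat.
\<close>

lemma no_relation_along_prime_chain:
  fixes Q :: "nat \<Rightarrow> 'a::comm_ring_1 set"
  assumes "\<And>i. i \<le> length as \<Longrightarrow> prime_idl (Q i)" "\<And>i. i < length as \<Longrightarrow> Q i \<subseteq> Q (Suc i)"
    and "\<And>i. i < length as \<Longrightarrow> as ! i \<in> Q (Suc i) - Q i"
    and "finite M" "M \<noteq> {}" "\<And>m. m \<in> M \<Longrightarrow> length m = length as"
    and "\<And>m. m \<in> M \<Longrightarrow> c m dvd 1"
  shows "(\<Sum>m\<in>M. c m * power_product as m) \<notin> Q 0"
  using assms
proof (induction as arbitrary: Q M c)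
  case Nil
  then have "M = {[]}" by auto
  have "c [] \<notin> Q 0"
  proof
    assume "c [] \<in> Q 0"
    moreover obtain d where d: "1 = c [] * d" using Nil \<open>M = {[]}\<close> by (auto elim: dvdE)
    ultimately have "1 \<in> Q 0" using idl_mult_right[OF prime_idlD(1)[OF Nil.prems(1)[of 0]], of "c []" d] by simp
    then show False using prime_idlD(2)[OF Nil.prems(1)[of 0]] by simp
  qed
  then show ?case using \<open>M = {[]}\<close> by simp
next
  case (Cons a as)
  have Q0: "prime_idl (Q 0)" and Q1: "prime_idl (Q 1)"
    using Cons.prems(1)[of 0] Cons.prems(1)[of 1] by simp_all
  have Q01: "Q 0 \<subseteq> Q 1" using Cons.prems(2)[of 0] by simp
  have a: "a \<in> Q 1" "a \<notin> Q 0" using Cons.prems(3)[of 0] by simp_all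
  have shape: "m = hd m # tl m" "length (tl m) = length as" if "m \<in> M" for m
    using Cons.prems(6)[OF that] by (cases m; simp)+
  define k where "k = Min (hd ` M)"
  have k: "k \<le> hd m" if "m \<in> M" for m unfolding k_def using that Cons.prems(4) by simp
  define M0 where "M0 = {m \<in> M. hd m = k}"
  have "k \<in> hd ` M" unfolding k_def using Cons.prems(4,5) by (intro Min_in) auto
  then have M0: "M0 \<noteq> {}" "finite M0" "M0 \<subseteq> M" using Cons.prems(4) by (auto simp: M0_def)
  define S where "S = (\<Sum>m\<in>M0. c m * power_product as (tl m))"
  define R where "R = (\<Sum>m\<in>M - M0. c m * (a ^ (hd m - Suc k) * power_product as (tl m)))"
  have pp: "power_product (a # as) m = a ^ hd m * power_product as (tl m)" if "m \<in> M" for m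
    using shape(1)[OF that] by (metis power_product.simps(1))
  have "(\<Sum>m\<in>M. c m * power_product (a # as) m)
      = (\<Sum>m\<in>M0. c m * power_product (a # as) m) + (\<Sum>m\<in>M - M0. c m * power_product (a # as) m)"
    using M0(3) Cons.prems(4) by (simp add: sum.subset_diff add.commute)
  also have "(\<Sum>m\<in>M0. c m * power_product (a # as) m) = a ^ k * S"
    unfolding S_def sum_distrib_left using M0(3)
    by (intro sum.cong refl) (auto simp: pp M0_def mult.left_commute)
  also have "(\<Sum>m\<in>M - M0. c m * power_product (a # as) m) = a ^ k * (a * R)"
    unfolding R_def sum_distrib_left
  proof (intro sum.cong refl)
    fix m assume m: "m \<in> M - M0"
    then have "k < hd m" using k[of m] by (auto simp: M0_def)
    then have "hd m = k + Suc (hd m - Suc k)" by simp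
    then have "a ^ hd m = a ^ k * (a * a ^ (hd m - Suc k))" by (metis power_add power_Suc)
    then show "c m * power_product (a # as) m
        = a ^ k * (a * (c m * (a ^ (hd m - Suc k) * power_product as (tl m))))"
      using m by (simp add: pp algebra_simps)
  qed
  finally have eq: "(\<Sum>m\<in>M. c m * power_product (a # as) m) = a ^ k * (S + a * R)"
    by (simp add: distrib_left)
  have "S = (\<Sum>m\<in>tl ` M0. c (k # m) * power_product as m)"
  proof -
    have "inj_on tl M0" by (rule inj_onI) (metis (mono_tags, lifting) M0_def mem_Collect_eq shape(1))
    then have "(\<Sum>m\<in>tl ` M0. c (k # m) * power_product as m)
        = (\<Sum>m\<in>M0. c (k # tl m) * power_product as (tl m))" by (simp add: sum.reindex)
    also have "\<dots> = S" unfolding S_def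
      by (intro sum.cong refl) (metis (mono_tags, lifting) M0_def mem_Collect_eq shape(1))
    finally show ?thesis by simp
  qed
  moreover have "(\<Sum>m\<in>tl ` M0. c (k # m) * power_product as m) \<notin> Q (Suc 0)"
  proof (rule Cons.IH[of "\<lambda>i. Q (Suc i)" "tl ` M0" "\<lambda>m. c (k # m)"])
    show "c (k # m) dvd 1" if "m \<in> tl ` M0" for m
      using that shape(1) Cons.prems(7) by (force simp: M0_def)
    show "as ! i \<in> Q (Suc (Suc i)) - Q (Suc i)" if "i < length as" for i
      using Cons.prems(3)[of "Suc i"] that by simp
  qed (use Cons.prems(1,2) M0 shape in \<open>auto\<close>)
  ultimately have S: "S \<notin> Q 1" by simp
  show ?case
  proof
    assume "(\<Sum>m\<in>M. c m * power_product (a # as) m) \<in> Q 0"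
    then have "S + a * R \<in> Q 0"
      using eq prime_idlD(3)[OF Q0] prime_idl_power[OF Q0] a(2) by metis
    then have "S + a * R \<in> Q 1" using Q01 by blast
    moreover have "a * R \<in> Q 1" using a(1) prime_idlD(1)[OF Q1] idl_mult_right by blast
    ultimately have "S \<in> Q 1" using idl.subspace_diff[OF prime_idlD(1)[OF Q1], of "S + a * R" "a * R"] by simp
    then show False using S by simp
  qed
qed

text \<open>Constants act as scalars; this structure serves the dimension count in
  \<open>algebraic_dependence\<close>.\<close>

global_interpretation kvec: Vector_Spaces.vector_space "\<lambda>(c :: 'k::field) (p :: 'k mpoly). single 0 c * p"
  by unfold_locales (simp_all add: algebra_simps single_add mult_single)

declare kvec.scale_scale [simp del]

lemma count_power_bound:
  assumes "\<And>u. u \<in> keys p \<Longrightarrow> count u x \<le> D" "u \<in> keys (p ^ n)"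
  shows "count u x \<le> n * D"
  using assms(2)
proof (induction n arbitrary: u)
  case (Suc n)
  then obtain v w where "v \<in> keys p" "w \<in> keys (p ^ n)" "u = v + w"
    using keys_mult_mem[of u p "p ^ n"] by auto
  then show ?case using Suc.IH assms(1) by (auto intro: add_mono)
qed simp

lemma count_power_product_bound:
  assumes "\<And>p u. p \<in> set as \<Longrightarrow> u \<in> keys p \<Longrightarrow> count u x \<le> D" "\<And>k. k \<in> set m \<Longrightarrow> k \<le> N"
    and "u \<in> keys (power_product as m)"
  shows "count u x \<le> length as * (N * D)"
  using assms
proof (induction as m arbitrary: u rule: power_product.induct)
  case (1 a as k m)
  then obtain v w where vw: "v \<in> keys (a ^ k)" "w \<in> keys (power_product as m)" "u = v + w"
    using keys_mult_mem[of u "a ^ k" "power_product as m"] by auto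
  have "count v x \<le> k * D" using 1 vw by (intro count_power_bound[of a]) auto
  also have "\<dots> \<le> N * D" using 1 by simp
  finally show ?case using 1 vw by (auto intro: add_mono)
qed auto

lemma inj_on_restrict_count: "inj_on (\<lambda>u. restrict (count u) F) {u. set_mset u \<subseteq> F}"
proof (rule inj_onI)
  fix u v assume uv: "u \<in> {u. set_mset u \<subseteq> F}" "v \<in> {u. set_mset u \<subseteq> F}"
    and eq: "restrict (count u) F = restrict (count v) F"
  have "count u x = count v x" for x
  proof (cases "x \<in> F")
    case True
    then show ?thesis using fun_cong[OF eq, of x] by simp
  next
    case False
    then have "x \<notin># u" "x \<notin># v" using uv by auto
    then show ?thesis by (simp add: not_in_iff)
  qed
  then show "u = v" by (rule multiset_eqI)
qed

text \<open>There are \<open>(N + 1) ^ length as\<close> exponents bounded by \<open>N\<close>,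
  while the restrictions of their power products to \<open>F\<close> lie in the span of at most
  \<open>(E + 1) ^ card F\<close> monomials, with \<open>E\<close> linear in \<open>N\<close>. For
  large \<open>N\<close> the first number exceeds the second.\<close>

lemma algebraic_dependence:
  fixes as :: "'k::field mpoly list"
  assumes F: "finite F" "card F < length as"
  shows "\<exists>M c. finite M \<and> M \<noteq> {} \<and> (\<forall>m\<in>M. length m = length as \<and> c m \<noteq> 0) \<and>
    (\<Sum>m\<in>M. single 0 (c m) * power_product as m) \<in> nonface_ideal (Pow F)"
proof -
  have "finite {count u x | u x. u \<in> (\<Union>p\<in>set as. keys p) \<and> x \<in> set_mset u}"
  proof (rule finite_subset)
    show "{count u x | u x. u \<in> (\<Union>p\<in>set as. keys p) \<and> x \<in> set_mset u}
      \<subseteq> (\<Union>u\<in>(\<Union>p\<in>set as. keys p). count u ` set_mset u)" by auto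
  qed simp
  then obtain D where "\<forall>d\<in>{count u x | u x. u \<in> (\<Union>p\<in>set as. keys p) \<and> x \<in> set_mset u}. d \<le> D"
    using finite_nat_set_iff_bounded_le by meson
  then have D: "count u x \<le> D" if "p \<in> set as" "u \<in> keys p" for p u x
    using that by (cases "x \<in># u") (auto simp: not_in_iff)
  \<comment> \<open>Chosen so that \<open>E + 1 \<le> D' * (N + 1)\<close>; then
    \<open>N = D' ^ k\<close> gives \<open>(E + 1) ^ k < (N + 1) ^ Suc k\<close>.\<close>
  define D' where "D' = length as * D + 1"
  define k where "k = card F"
  define N where "N = D' ^ k"
  define E where "E = length as * (N * D)"
  define LL where "LL = {m. set m \<subseteq> {..N} \<and> length m = length as}"
  define b where "b = (\<lambda>m. restrict_vars F (power_product as m))"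
  define U where "U = {u :: nat multiset. set_mset u \<subseteq> F \<and> (\<forall>x. count u x \<le> E)}"
  have LL: "finite LL" "card LL = (N + 1) ^ length as"
    unfolding LL_def by (simp_all add: finite_lists_length_eq card_lists_length_eq)
  have inj: "inj_on (\<lambda>u. restrict (count u) F) U"
    by (rule inj_on_subset[OF inj_on_restrict_count]) (auto simp: U_def)
  have im: "(\<lambda>u. restrict (count u) F) ` U \<subseteq> PiE F (\<lambda>_. {..E})"
    by (auto simp: U_def)
  have finP: "finite (PiE F (\<lambda>_. {..E}))" using F by (intro finite_PiE) auto
  have U: "finite U" "card U \<le> (E + 1) ^ k"
    using inj_on_finite[OF inj im finP] card_inj_on_le[OF inj im finP] F
    by (simp_all add: card_PiE k_def)
  have "E + 1 \<le> D' * (N + 1)"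
    by (simp add: E_def D'_def algebra_simps)
  then have "(E + 1) ^ k \<le> D' ^ k * (N + 1) ^ k"
    by (metis power_mono power_mult_distrib zero_le)
  also have "\<dots> < (N + 1) * (N + 1) ^ k" by (simp add: N_def)
  also have "\<dots> = (N + 1) ^ Suc k" by simp
  also have "\<dots> \<le> (N + 1) ^ length as" using F by (intro power_increasing) (auto simp: k_def)
  finally have lt: "card U < card LL" using U(2) LL(2) by simp
  let ?T = "(\<lambda>u. single u (1 :: 'k)) ` U"
  have bT: "b m \<in> kvec.span ?T" if m: "m \<in> LL" for m
  proof -
    have "u \<in> U" if u: "u \<in> keys (b m)" for u
    proof -
      have "u \<in> keys (power_product as m)" "set_mset u \<subseteq> F"
        using u by (auto simp: b_def keys_restrict_vars)
      moreover have "count u x \<le> E" for x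
        unfolding E_def using calculation D m
        by (intro count_power_product_bound[of as x D m N u]) (auto simp: LL_def)
      ultimately show ?thesis by (simp add: U_def)
    qed
    then have "(\<Sum>u\<in>keys (b m). single 0 (lookup (b m) u) * single u 1) \<in> kvec.span ?T"
      by (intro kvec.span_sum kvec.span_scale kvec.span_base) auto
    then show ?thesis
      using mpoly_sum_monomials[of "b m"] by (simp add: mult_single)
  qed
  have mem: "(\<Sum>m\<in>M. single 0 (c m) * power_product as m) \<in> nonface_ideal (Pow F)"
    if "(\<Sum>m\<in>M. single 0 (c m) * b m) = 0" "finite M" for M c
  proof -
    have "restrict_vars F (\<Sum>m\<in>M. single 0 (c m) * power_product as m)
        = (\<Sum>m\<in>M. single 0 (c m) * b m)"
      using that(2)
    proof (induction M)
      case (insert m M)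
      moreover have "restrict_vars F (single 0 (c m)) = single 0 (c m)"
        by (rule restrict_vars_id) (simp split: if_splits)
      ultimately show ?case by (simp add: restrict_vars_add restrict_vars_mult b_def)
    qed simp
    then show ?thesis using that by (simp flip: restrict_vars_eq_0_iff)
  qed
  show ?thesis
  \<comment> \<open>Linear dependence concerns sets of vectors, so two exponents with the same
    restricted product are treated as a relation of their own, with coefficients 1 and -1.\<close>
  proof (cases "inj_on b LL")
    case False
    then obtain m m' where m: "m \<in> LL" "m' \<in> LL" "m \<noteq> m'" "b m = b m'" by (auto simp: inj_on_def)
    define c where "c = (\<lambda>x. if x = m then 1 else - 1 :: 'k)"
    have "(\<Sum>m\<in>{m, m'}. single 0 (c m) * b m) = 0"
      using m by (simp add: c_def single_uminus)
    then have "(\<Sum>m\<in>{m, m'}. single 0 (c m) * power_product as m) \<in> nonface_ideal (Pow F)"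
      by (rule mem) simp
    moreover have "\<forall>x\<in>{m, m'}. length x = length as \<and> c x \<noteq> 0"
      using m by (auto simp: LL_def c_def)
    ultimately show ?thesis by (intro exI[of _ "{m, m'}"] exI[of _ c]) simp
  next
    case True
    have "kvec.dependent (b ` LL)"
    proof (rule ccontr)
      assume "kvec.independent (b ` LL)"
      moreover have "finite ?T" "b ` LL \<subseteq> kvec.span ?T" using U bT by auto
      ultimately have "card (b ` LL) \<le> card ?T" using kvec.independent_span_bound by blast
      also have "\<dots> \<le> card U" using U by (intro card_image_le)
      finally show False using lt card_image[OF True] by simp
    qed
    then obtain t h where t: "finite t" "t \<subseteq> b ` LL" "(\<Sum>v\<in>t. single 0 (h v) * v) = 0"
      "\<exists>v\<in>t. h v \<noteq> 0" by (auto simp: kvec.dependent_explicit)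
    define M where "M = {m \<in> LL. b m \<in> t \<and> h (b m) \<noteq> 0}"
    have "(\<Sum>m\<in>M. single 0 (h (b m)) * b m)
        = (\<Sum>v\<in>b ` M. single 0 (h v) * v)"
      using True by (subst sum.reindex) (auto simp: M_def inj_on_def)
    also have "\<dots> = (\<Sum>v\<in>t. single 0 (h v) * v)"
    proof (rule sum.mono_neutral_left[OF t(1)])
      show "\<forall>v\<in>t - b ` M. single 0 (h v) * v = 0"
      proof
        fix v assume v: "v \<in> t - b ` M"
        then obtain m where "m \<in> LL" "v = b m" using t(2) by auto
        then have "h v = 0" using v by (auto simp: M_def)
        then show "single 0 (h v) * v = 0" by simp
      qed
    qed (auto simp: M_def)
    finally have "(\<Sum>m\<in>M. single 0 (h (b m)) * power_product as m) \<in> nonface_ideal (Pow F)"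
      using LL t(3) by (intro mem) (auto simp: M_def)
    moreover have "M \<noteq> {}" using t(2,4) by (force simp: M_def)
    moreover have "finite M" using LL(1) by (simp add: M_def)
    moreover have "\<forall>m\<in>M. length m = length as \<and> h (b m) \<noteq> 0" by (auto simp: M_def LL_def)
    ultimately show ?thesis by (intro exI[of _ M] exI[of _ "\<lambda>m. h (b m)"]) simp
  qed
qed

text \<open>Elements chosen from the successive differences of a longer chain would satisfy an
  algebraic relation modulo \<open>nonface_ideal (Pow F)\<close>, hence modulo \<open>Q 0\<close>.
  Nonzero constants are units, so \<open>no_relation_along_prime_chain\<close> forbids this.\<close>

theorem prime_chain_length_le_card:
  fixes Q :: "nat \<Rightarrow> 'k::field mpoly set"
  assumes F: "finite F" "nonface_ideal (Pow F) \<subseteq> Q 0"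
    and Q: "\<And>i. i \<le> r \<Longrightarrow> prime_idl (Q i)" "\<And>i. i < r \<Longrightarrow> Q i \<subset> Q (Suc i)"
  shows "r \<le> card F"
proof (rule ccontr)
  assume "\<not> r \<le> card F"
  then have r: "card F < r" by simp
  have "\<exists>a. a \<in> Q (Suc i) - Q i" if "i < r" for i using Q(2)[OF that] by blast
  then obtain a where a: "\<And>i. i < r \<Longrightarrow> a i \<in> Q (Suc i) - Q i" by metis
  let ?as = "map a [0..<r]"
  obtain M c where M: "finite M" "M \<noteq> {}" "\<And>m. m \<in> M \<Longrightarrow> length m = length ?as \<and> c m \<noteq> 0"
    "(\<Sum>m\<in>M. single 0 (c m) * power_product ?as m) \<in> nonface_ideal (Pow F)"
    using algebraic_dependence[of F ?as] F(1) r by auto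
  have "single 0 (c m) dvd (1 :: 'k mpoly)" if "m \<in> M" for m
    using M(3)[OF that] by (intro dvdI[of _ _ "single 0 (inverse (c m))"]) (simp add: mult_single)
  then have "(\<Sum>m\<in>M. single 0 (c m) * power_product ?as m) \<notin> Q 0"
    using Q a M by (intro no_relation_along_prime_chain) auto
  then show False using M(4) F(2) by blast
qed

section \<open>Primes over a monomial ideal\<close>

lemma prod_X_eq: "finite N \<Longrightarrow> (\<Prod>j\<in>N. X j) = single (mset_set N) (1 :: 'k::field)"
  by (induction N rule: finite_induct) (simp_all add: X_def mult_single)

lemma nonface_Pow_subset:
  assumes "idl.subspace Q" "\<And>j. j \<notin> F \<Longrightarrow> X j \<in> Q"
  shows "nonface_ideal (Pow F) \<subseteq> (Q :: 'k::field mpoly set)"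
proof
  fix p :: "'k mpoly" assume p: "p \<in> nonface_ideal (Pow F)"
  show "p \<in> Q"
  proof (rule mpoly_mem_subspaceI[OF assms(1)])
    fix u assume "u \<in> keys p"
    then obtain j where j: "j \<in># u" "j \<notin> F" using p by (auto simp: nonface_ideal_def)
    then have "single u (lookup p u) = single (u - {#j#}) (lookup p u) * X j"
      by (simp add: X_def mult_single)
    then show "single u (lookup p u) \<in> Q" using assms j by (simp add: idl_mult_left)
  qed
qed

text \<open>Otherwise each face \<open>F\<close> misses an index \<open>j F\<close> with
  \<open>X (j F) \<notin> Q\<close>. The set of all \<open>j F\<close> is not a face, since as a
  face it would miss one of its own elements. So its monomial lies in \<open>Q\<close>, and with it
  one of the variables.\<close>

lemma prime_contains_face_prime:
  assumes "finite \<Gamma>" and Q: "prime_idl Q" "nonface_ideal \<Gamma> \<subseteq> (Q :: 'k::field mpoly set)"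
  shows "\<exists>F\<in>\<Gamma>. nonface_ideal (Pow F) \<subseteq> Q"
proof (rule ccontr)
  assume contr: "\<not> ?thesis"
  have "\<exists>j. j \<notin> F \<and> X j \<notin> Q" if "F \<in> \<Gamma>" for F
    using contr that nonface_Pow_subset[OF prime_idlD(1)[OF Q(1)], of F] by blast
  then obtain j where j: "\<And>F. F \<in> \<Gamma> \<Longrightarrow> j F \<notin> F \<and> X (j F) \<notin> Q" by metis
  let ?N = "j ` \<Gamma>"
  have "?N \<notin> \<Gamma>" using j by blast
  then have "(\<Prod>i\<in>?N. X i) \<in> Q"
    using Q(2) assms(1) by (subst prod_X_eq) (auto simp: nonface_ideal_def)
  then show False using prime_idl_prod[OF Q(1)] j by blast
qed

section \<open>Zariski's lemma\<close>

lemma keys_add_subset: "keys p \<subseteq> U \<Longrightarrow> keys q \<subseteq> U \<Longrightarrow> keys (p + q) \<subseteq> U"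
  using keys_add[of p q] by blast

lemma keys_mult_subset:
  "keys p \<subseteq> U \<Longrightarrow> keys q \<subseteq> W \<Longrightarrow> (\<And>u w. u \<in> U \<Longrightarrow> w \<in> W \<Longrightarrow> u + w \<in> Z) \<Longrightarrow> keys (p * q) \<subseteq> Z"
  using keys_mult[of p q] by blast

lemma keys_sum_subset: "(\<And>i. i \<in> I \<Longrightarrow> keys (f i) \<subseteq> U) \<Longrightarrow> keys (sum f I) \<subseteq> U"
  by (induction I rule: infinite_finite_induct) (simp_all add: keys_add_subset)

lemma X_nonzero [simp]: "X i \<noteq> 0"
  by (simp add: X_def flip: keys_empty_iff)

lemma X_power: "X i ^ k = single (replicate_mset k i) (1 :: 'k::field)"
  by (induction k) (simp_all add: X_def mult_single single_one)

lemma finite_bounded_multisets: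
  assumes "finite F"
  shows "finite {u :: nat multiset. set_mset u \<subseteq> F \<and> (\<forall>x\<in>F. count u x \<le> e x)}" (is "finite ?U")
proof (rule inj_on_finite)
  show "inj_on (\<lambda>u. restrict (count u) F) ?U"
    by (rule inj_on_subset[OF inj_on_restrict_count]) auto
  show "(\<lambda>u. restrict (count u) F) ` ?U \<subseteq> PiE F (\<lambda>x. {..e x})" by auto
  show "finite (PiE F (\<lambda>x. {..e x}))" using assms by (intro finite_PiE) auto
qed

section \<open>Finite modules over a subring\<close>

definition subring_set :: "'a::comm_ring_1 set \<Rightarrow> bool" where
  "subring_set A \<longleftrightarrow> 0 \<in> A \<and> 1 \<in> A \<and> (\<forall>x\<in>A. \<forall>y\<in>A. x + y \<in> A \<and> x - y \<in> A \<and> x * y \<in> A)"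

definition combinations :: "'a::comm_ring_1 set \<Rightarrow> 'a set \<Rightarrow> 'a set" where
  "combinations A B = {\<Sum>e\<in>B. f e * e | f. \<forall>e\<in>B. f e \<in> A}"

lemma combinations_insert:
  assumes "finite B" "e \<notin> B"
  shows "combinations A (insert e B) = {a * e + w | a w. a \<in> A \<and> w \<in> combinations A B}"
proof (intro equalityI subsetI)
  fix x assume "x \<in> combinations A (insert e B)"
  then obtain f where "\<forall>e\<in>insert e B. f e \<in> A" "x = (\<Sum>e\<in>insert e B. f e * e)"
    by (auto simp: combinations_def)
  then show "x \<in> {a * e + w | a w. a \<in> A \<and> w \<in> combinations A B}"
    using assms by (auto simp: combinations_def)
next
  fix x assume "x \<in> {a * e + w | a w. a \<in> A \<and> w \<in> combinations A B}"
  then obtain a f where f: "a \<in> A" "\<forall>e\<in>B. f e \<in> A" "x = a * e + (\<Sum>e\<in>B. f e * e)"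
    by (auto simp: combinations_def)
  have "(\<Sum>e'\<in>B. f e' * e') = (\<Sum>e'\<in>B. (f(e := a)) e' * e')"
    using assms by (intro sum.cong) auto
  then have "x = (\<Sum>e'\<in>insert e B. (f(e := a)) e' * e')" using assms f by simp
  then show "x \<in> combinations A (insert e B)"
    unfolding combinations_def using f(1,2) by (intro CollectI exI[of _ "f(e := a)"]) auto
qed

lemma combinations_add:
  assumes "subring_set A" "x \<in> combinations A B" "y \<in> combinations A B"
  shows "x + y \<in> combinations A B"
proof -
  obtain f g where "\<forall>e\<in>B. f e \<in> A" "x = (\<Sum>e\<in>B. f e * e)" "\<forall>e\<in>B. g e \<in> A" "y = (\<Sum>e\<in>B. g e * e)"
    using assms by (auto simp: combinations_def)
  then have "x + y = (\<Sum>e\<in>B. (f e + g e) * e)" "\<forall>e\<in>B. f e + g e \<in> A"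
    using assms(1) by (auto simp: sum.distrib distrib_right subring_set_def)
  then show ?thesis unfolding combinations_def by (intro CollectI exI[of _ "\<lambda>e. f e + g e"]) auto
qed

lemma combinations_mult:
  assumes "subring_set A" "a \<in> A" "x \<in> combinations A B"
  shows "a * x \<in> combinations A B"
proof -
  obtain f where "\<forall>e\<in>B. f e \<in> A" "x = (\<Sum>e\<in>B. f e * e)"
    using assms by (auto simp: combinations_def)
  then have "a * x = (\<Sum>e\<in>B. (a * f e) * e)" "\<forall>e\<in>B. a * f e \<in> A"
    using assms(1,2) by (auto simp: sum_distrib_left mult.assoc subring_set_def)
  then show ?thesis unfolding combinations_def by (intro CollectI exI[of _ "\<lambda>e. a * f e"]) auto
qed

lemma combinations_base:
  assumes "subring_set A" "finite B" "e \<in> B"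
  shows "e \<in> combinations A B"
proof -
  have "(\<Sum>e'\<in>B. (if e' = e then 1 else 0) * e') = e"
    using assms(2,3) by (simp add: if_distrib[of "\<lambda>x. x * _"] cong: if_cong)
  then show ?thesis unfolding combinations_def using assms(1)
    by (intro CollectI exI[of _ "\<lambda>e'. if e' = e then 1 else 0"]) (auto simp: subring_set_def)
qed

lemma combinations_zero: "subring_set A \<Longrightarrow> 0 \<in> combinations A B"
  unfolding combinations_def by (intro CollectI exI[of _ "\<lambda>_. 0"]) (auto simp: subring_set_def)

text \<open>
  Nakayama's lemma for the module spanned by \<open>B\<close>, localised at the powers of \<open>c\<close>:
  the generators are eliminated one at a time instead of taking a determinant.
\<close>

lemma nakayama_elimination:
  fixes A P :: "'a::comm_ring_1 set"
  assumes A: "subring_set A" "b \<in> A" "c \<in> A" and P: "idl.subspace P" and "finite B"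
    and "t \<in> A" "t = c ^ i + b * s" "s \<in> A"
    and "\<And>z. z \<in> insert 1 B \<Longrightarrow> \<exists>w\<in>combinations A B. t * z - b * w \<in> P"
  shows "\<exists>i. \<exists>s\<in>A. c ^ i + b * s \<in> P"
  using assms(5-)
proof (induction B arbitrary: t i s)
  case empty
  then obtain w where "w \<in> combinations A {}" "t * 1 - b * w \<in> P" by blast
  then have "t \<in> P" by (simp add: combinations_def)
  then show ?case using empty.prems by blast
next
  case (insert e B)
  have comb: "\<exists>a w. a \<in> A \<and> w \<in> combinations A B \<and> t * z - b * (a * e + w) \<in> P" if "z \<in> insert 1 (insert e B)" for z
    using insert.prems(4)[OF that] combinations_insert[OF insert.hyps(1,2), of A] by auto
  obtain a w where aw: "a \<in> A" "w \<in> combinations A B" "t * e - b * (a * e + w) \<in> P"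
    using comb[of e] by auto
  \<comment> \<open>Moving \<open>b * (a * e)\<close> to the left turns \<open>t' * e\<close> into
    \<open>b\<close> times a combination of the remaining generators. Every relation multiplied by
    \<open>t'\<close> then gets rid of \<open>e\<close>.\<close>
  define t' where "t' = t - b * a"
  have "t' * e - b * w = t * e - b * (a * e + w)" by (simp add: t'_def algebra_simps)
  then have t'e: "t' * e - b * w \<in> P" using aw(3) by simp
  have t'A: "t' \<in> A" using A insert.prems(1) aw(1) by (simp add: t'_def subring_set_def)
  \<comment> \<open>Both \<open>t'\<close> and \<open>t\<close> are congruent to
    \<open>c ^ i\<close> modulo \<open>b\<close>; \<open>s'\<close> is the cofactor of
    \<open>b\<close> in their product after splitting off \<open>c ^ (i + i)\<close>.\<close>
  define s' where "s' = s * c ^ i + (c ^ i + b * s) * (s - a)"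
  have ci: "c ^ i \<in> A" using A by (induction i) (auto simp: subring_set_def)
  show ?case
  proof (rule insert.IH)
    show "t' * t \<in> A" using t'A insert.prems(1) A(1) by (simp add: subring_set_def)
    show "t' * t = c ^ (i + i) + b * s'"
      by (simp add: t'_def s'_def insert.prems(2) algebra_simps power_add)
    show "s' \<in> A" using A aw(1) insert.prems(3) ci by (simp add: s'_def subring_set_def)
    fix z assume z: "z \<in> insert 1 B"
    then obtain a' w' where aw': "a' \<in> A" "w' \<in> combinations A B" "t * z - b * (a' * e + w') \<in> P"
      using comb[of z] by auto
    have "t' * t * z - b * ((a' * b) * w + t' * w') = t' * (t * z - b * (a' * e + w')) + (b * a') * (t' * e - b * w)"
      by (simp add: algebra_simps)
    also have "\<dots> \<in> P" using aw'(3) t'e by (intro idl.subspace_add[OF P] idl.subspace_scale[OF P])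
    finally have "t' * t * z - b * ((a' * b) * w + t' * w') \<in> P" .
    moreover have "(a' * b) * w + t' * w' \<in> combinations A B"
      using A aw(2) aw'(1,2) t'A
      by (intro combinations_add combinations_mult) (auto simp: subring_set_def)
    ultimately show "\<exists>w\<in>combinations A B. t' * t * z - b * w \<in> P" by blast
  qed
qed

lemma lm_mult:
  assumes "p \<noteq> 0" "q \<noteq> (0 :: 'k::field mpoly)"
  shows "lm p + lm q \<in> keys (p * q)"
proof -
  have "lookup (p * q) (lm p + lm q) = lookup p (lm p) * lookup q (lm q)"
  proof (rule lookup_mult_unique)
    fix u v assume uv: "u \<in> keys p" "v \<in> keys q" "u + v = lm p + lm q"
    then have "u \<le> lm p" "v \<le> lm q" by (auto intro: lm_ge)
    then show "u = lm p \<and> v = lm q" using uv(3)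
      by (metis add_le_less_mono add_left_cancel add_right_cancel add_less_le_mono order_le_less order_less_irrefl)
  qed
  then show ?thesis using lm_in_keys assms by (metis in_keys_iff mult_eq_0_iff)
qed

lemma unit_imp_const:
  assumes "b * s = (1 :: 'k::field mpoly)" "w \<in> keys b"
  shows "w = {#}"
proof -
  have "b \<noteq> 0" "s \<noteq> 0" using assms(1) by auto
  then have "lm b + lm s \<in> keys (1 :: 'k mpoly)" using lm_mult assms(1) by metis
  then have "lm b = {#}" by simp
  then show ?thesis using lm_ge[OF assms(2)] by (metis bot_multiset_def bot.extremum_unique)
qed

lemma leading_coefficient:
  fixes p :: "'k::field mpoly"
  assumes p: "p \<noteq> 0" "\<And>u. u \<in> keys p \<Longrightarrow> set_mset u \<subseteq> insert j T" "j \<notin> T"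
  shows "\<exists>c e r. p = c * X j ^ e + r \<and> c \<noteq> 0 \<and> keys c \<subseteq> {u. set_mset u \<subseteq> T} \<and>
    keys r \<subseteq> {u. set_mset u \<subseteq> insert j T \<and> count u j < e}"
proof -
  define e where "e = Max ((\<lambda>u. count u j) ` keys p)"
  have fin: "finite ((\<lambda>u. count u j) ` keys p)" "(\<lambda>u. count u j) ` keys p \<noteq> {}"
    using p(1) by (auto simp: keys_empty_iff)
  have le: "count u j \<le> e" if "u \<in> keys p" for u
    unfolding e_def using fin that by (intro Max_ge) auto
  have "e \<in> (\<lambda>u. count u j) ` keys p" unfolding e_def by (rule Max_in[OF fin])
  then obtain u0 where u0: "u0 \<in> keys p" "count u0 j = e" by auto
  define K where "K = {u \<in> keys p. count u j = e}"
  have K: "finite K" "K \<subseteq> keys p" "u0 \<in> K" using u0 by (auto simp: K_def)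
  define c where "c = (\<Sum>u\<in>K. single (u - replicate_mset e j) (lookup p u))"
  define r where "r = (\<Sum>u\<in>keys p - K. single u (lookup p u))"
  have top: "c * X j ^ e = (\<Sum>u\<in>K. single u (lookup p u))"
    unfolding c_def sum_distrib_right X_power mult_single
  proof (intro sum.cong refl)
    fix u assume "u \<in> K"
    then have "replicate_mset e j \<subseteq># u" by (auto simp: K_def simp flip: count_le_replicate_mset_subset_eq)
    then show "single (u - replicate_mset e j + replicate_mset e j) (lookup p u * 1)
        = single u (lookup p u)" by simp
  qed
  have "p = c * X j ^ e + r"
    unfolding top r_def using K mpoly_sum_monomials[of p] by (simp add: sum.subset_diff add.commute)
  moreover have "c \<noteq> 0"
  proof
    assume "c = 0"
    then have "lookup (\<Sum>u\<in>K. single u (lookup p u)) u0 = 0" by (simp flip: top)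
    moreover have "lookup (\<Sum>u\<in>K. single u (lookup p u)) u0 = lookup p u0"
      using K by (simp add: lookup_sum lookup_single when_def)
    ultimately show False using u0 by (simp add: in_keys_iff)
  qed
  moreover have "keys c \<subseteq> {u. set_mset u \<subseteq> T}"
    unfolding c_def
  proof (rule keys_sum_subset)
    fix u assume u: "u \<in> K"
    have "set_mset (u - replicate_mset e j) \<subseteq> T"
    proof
      fix x assume x: "x \<in># u - replicate_mset e j"
      then have "x \<in> insert j T" using p(2)[of u] u by (auto simp: K_def dest: in_diffD)
      moreover have "x \<noteq> j" using x u by (auto simp: K_def in_diff_count)
      ultimately show "x \<in> T" by simp
    qed
    then show "keys (single (u - replicate_mset e j) (lookup p u)) \<subseteq> {u. set_mset u \<subseteq> T}" by simp
  qed
  moreover have "keys r \<subseteq> {u. set_mset u \<subseteq> insert j T \<and> count u j < e}"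
    unfolding r_def
  proof (rule keys_sum_subset)
    fix u assume u: "u \<in> keys p - K"
    then have "count u j < e" using le[of u] by (auto simp: K_def)
    then show "keys (single u (lookup p u)) \<subseteq> {u. set_mset u \<subseteq> insert j T \<and> count u j < e}"
      using u p(2)[of u] by simp
  qed
  ultimately show ?thesis by blast
qed

text \<open>The residue ring is a field, expressed by inverses modulo \<open>P\<close>.\<close>

definition maximal_idl :: "'a::comm_ring_1 set \<Rightarrow> bool" where
  "maximal_idl P \<longleftrightarrow> prime_idl P \<and> (\<forall>a. a \<notin> P \<longrightarrow> (\<exists>b. a * b - 1 \<in> P))"

text \<open>\<open>T\<close> is a transcendence basis of the residue field, taken from the
  variables, and \<open>A\<close> is K[T], which meets \<open>P\<close> only in 0. Each further
  variable has an equation over \<open>A\<close> with leading coefficient \<open>c j\<close>; once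
  the product \<open>C\<close> of these is inverted, the residue field is a finite module. If
  \<open>t \<in> T\<close>, then \<open>1 + X t * C\<close> is invertible in the field. By
  Nakayama's lemma it divides a power of \<open>C\<close> in \<open>A\<close>, hence a power of
  \<open>X t * C\<close>, which is congruent to a power of -1 modulo it. So it is a unit of the
  polynomial ring without being constant.\<close>

lemma maximal_idl_imp_algebraic:
  fixes P :: "'k::field mpoly set"
  assumes V: "finite V" "\<And>j. j \<notin> V \<Longrightarrow> X j \<in> P" and max: "maximal_idl P"
    and T: "T \<subseteq> V" "\<And>p. p \<in> P \<Longrightarrow> keys p \<subseteq> {u. set_mset u \<subseteq> T} \<Longrightarrow> p = 0"
    and dep: "\<And>j. j \<in> V - T \<Longrightarrow> \<exists>p\<in>P. p \<noteq> 0 \<and> keys p \<subseteq> {u. set_mset u \<subseteq> insert j T}"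
  shows "T = {}"
proof (rule ccontr)
  assume "T \<noteq> {}"
  then obtain t where t: "t \<in> T" by blast
  have P: "prime_idl P" "idl.subspace P" and inv: "\<And>a. a \<notin> P \<Longrightarrow> \<exists>b. a * b - 1 \<in> P"
    using max by (auto simp: maximal_idl_def prime_idl_def)
  define A where "A = {p :: 'k mpoly. keys p \<subseteq> {u. set_mset u \<subseteq> T}}"
  have A: "subring_set A"
    unfolding subring_set_def
  proof (intro conjI ballI)
    fix x y assume xy: "x \<in> A" "y \<in> A"
    show "x + y \<in> A" using xy by (simp add: A_def keys_add_subset)
    show "x - y \<in> A" using xy keys_diff_subset[of x y] by (auto simp: A_def)
    have "keys (x * y) \<subseteq> {u. set_mset u \<subseteq> T}"
      using xy by (intro keys_mult_subset[of x "{u. set_mset u \<subseteq> T}" y "{u. set_mset u \<subseteq> T}"]) (auto simp: A_def)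
    then show "x * y \<in> A" by (simp add: A_def)
  qed (simp_all add: A_def)
  have AP: "p = 0" if "p \<in> A" "p \<in> P" for p using T(2) that by (simp add: A_def)
  define lead where "lead = (\<lambda>j c e r. c * X j ^ e + r \<in> P \<and> c \<noteq> 0 \<and> c \<in> A \<and>
      keys r \<subseteq> {u. set_mset u \<subseteq> insert j T \<and> count u j < e})"
  have "\<exists>c e r. lead j c e r" if j: "j \<in> V - T" for j
  proof -
    obtain p where p: "p \<in> P" "p \<noteq> 0" "keys p \<subseteq> {u. set_mset u \<subseteq> insert j T}" using dep[OF j] by blast
    have "\<exists>c e r. p = c * X j ^ e + r \<and> c \<noteq> 0 \<and> keys c \<subseteq> {u. set_mset u \<subseteq> T} \<and>
        keys r \<subseteq> {u. set_mset u \<subseteq> insert j T \<and> count u j < e}"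
      using p j by (intro leading_coefficient) auto
    then show ?thesis using p(1) by (auto simp: A_def lead_def)
  qed
  then obtain c e r where "\<And>j. j \<in> V - T \<Longrightarrow> lead j (c j) (e j) (r j)" by metis
  then have cer: "c j * X j ^ e j + r j \<in> P \<and> c j \<noteq> 0 \<and> c j \<in> A \<and>
      keys (r j) \<subseteq> {u. set_mset u \<subseteq> insert j T \<and> count u j < e j}" if "j \<in> V - T" for j
    using that by (simp add: lead_def)
  \<comment> \<open>An equation of degree 0 would reduce to its leading coefficient, a nonzero
    element of \<open>A\<close> in \<open>P\<close>.\<close>
  have epos: "e j > 0" if j: "j \<in> V - T" for j
  proof (rule ccontr)
    assume "\<not> e j > 0"
    then have "keys (r j) = {}" "e j = 0" using cer[OF j] by auto
    then have "c j \<in> P" using cer[OF j] by (simp add: keys_empty_iff)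
    then show False using AP cer[OF j] by blast
  qed
  define C where "C = (\<Prod>j\<in>V - T. c j)"
  have prodA: "(\<Prod>j\<in>J. c j) \<in> A" if "J \<subseteq> V - T" for J
    using that by (induction J rule: infinite_finite_induct) (use A cer in \<open>auto simp: subring_set_def\<close>)
  have CA: "C \<in> A" using prodA by (simp add: C_def)
  have C0: "C \<noteq> 0" using V(1) cer by (auto simp: C_def)
  define UE where "UE = {u. set_mset u \<subseteq> V \<and> (\<forall>j\<in>V - T. count u j < e j)}"
  define E where "E = {p :: 'k mpoly. keys p \<subseteq> UE}"
  \<comment> \<open>The classes modulo \<open>P\<close> of polynomials whose degree in each
    \<open>X j\<close> with \<open>j \<in> V - T\<close> is below \<open>e j\<close>. The next steps
    show that a power of \<open>C\<close> moves any polynomial there.\<close>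
  define EP where "EP = {q + p | q p. q \<in> E \<and> p \<in> P}"
  have EPI: "x \<in> EP" if "q \<in> E" "x - q \<in> P" for x q
  proof -
    have "x = q + (x - q)" by simp
    then show ?thesis using that unfolding EP_def by blast
  qed
  have EPE: "\<exists>q\<in>E. x - q \<in> P" if x: "x \<in> EP" for x
  proof -
    obtain q p where "x = q + p" "q \<in> E" "p \<in> P" using x by (auto simp: EP_def)
    then show ?thesis by (intro bexI[of _ q]) simp_all
  qed
  have E_add: "x + y \<in> E" if "x \<in> E" "y \<in> E" for x y using that by (simp add: E_def keys_add_subset)
  have AE: "a * q \<in> E" if "a \<in> A" "q \<in> E" for a q
  proof -
    have "u + w \<in> UE" if "set_mset u \<subseteq> T" "w \<in> UE" for u w
    proof -
      have "count u j = 0" if "j \<in> V - T" for j using that \<open>set_mset u \<subseteq> T\<close> by (auto simp: count_eq_zero_iff)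
      then show ?thesis using that T(1) by (auto simp: UE_def)
    qed
    then show ?thesis using that keys_mult_subset[of a "{u. set_mset u \<subseteq> T}" q UE UE]
      by (simp add: A_def E_def)
  qed
  have EP_add: "x + y \<in> EP" if xy: "x \<in> EP" "y \<in> EP" for x y
  proof -
    obtain q q' where q: "q \<in> E" "x - q \<in> P" "q' \<in> E" "y - q' \<in> P"
      using EPE[OF xy(1)] EPE[OF xy(2)] by blast
    then have "(x + y) - (q + q') \<in> P" using idl.subspace_add[OF P(2) q(2,4)] by (simp add: algebra_simps)
    then show ?thesis using EPI E_add q by blast
  qed
  have EP_mult: "a * x \<in> EP" if ax: "a \<in> A" "x \<in> EP" for a x
  proof -
    obtain q where q: "q \<in> E" "x - q \<in> P" using EPE[OF ax(2)] by blast
    then have "a * x - a * q \<in> P" using idl_mult_left[OF P(2) q(2), of a] by (simp add: algebra_simps)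
    then show ?thesis using EPI AE q ax by blast
  qed
  have Cpow: "C ^ N \<in> A" for N using A CA by (induction N) (auto simp: subring_set_def)
  \<comment> \<open>Multiplication by \<open>X i\<close> leaves the range only for monomials that
    reach \<open>X i ^ e i\<close>; the equation of \<open>X i\<close> rewrites this power at the
    cost of \<open>c i\<close>, a factor of \<open>C\<close>.\<close>
  have CXE: "C * (X i * q) \<in> EP" if i: "i \<in> V" and q: "q \<in> E" for i q
  proof -
    have mono: "C * (X i * single u a) \<in> EP" if u: "u \<in> UE" for u a
    proof (cases "add_mset i u \<in> UE")
      case True
      then have "X i * single u a \<in> E" by (simp add: X_def mult_single E_def)
      then have "C * (X i * single u a) \<in> E" using AE CA by blast
      then show ?thesis using EPI idl.subspace_0[OF P(2)] by simp
    next
      case False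
      then have iT: "i \<in> V - T" and nlt: "\<not> Suc (count u i) < e i"
        using u i by (auto simp: UE_def split: if_splits)
      have "count u i < e i" using u iT by (simp add: UE_def)
      then have ei: "Suc (count u i) = e i" using nlt by simp
      define u' where "u' = u - replicate_mset (count u i) i"
      have uu': "add_mset i u = u' + replicate_mset (e i) i"
      proof -
        have "replicate_mset (count u i) i \<subseteq># u" by (simp flip: count_le_replicate_mset_subset_eq)
        then have "u = u' + replicate_mset (count u i) i" by (simp add: u'_def)
        then show ?thesis by (simp flip: ei)
      qed
      have cu': "count u' j = (if j = i then 0 else count u j)" for j by (simp add: u'_def)
      have su': "set_mset u' \<subseteq> V" using u by (auto simp: u'_def UE_def dest: in_diffD)
      let ?m = "single u' a"
      have "X i * single u a = single (add_mset i u) a"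
        by (simp add: X_def mult_single)
      also have "\<dots> = ?m * X i ^ e i"
        unfolding uu' X_power mult_single by simp
      finally have "X i * single u a = ?m * X i ^ e i" .
      then have "c i * (X i * single u a) - (- (?m * r i)) = ?m * (c i * X i ^ e i + r i)"
        by (simp add: algebra_simps)
      also have "\<dots> \<in> P" using cer[OF iT] idl_mult_left[OF P(2)] by blast
      finally have "c i * (X i * single u a) - (- (?m * r i)) \<in> P" .
      moreover have "- (?m * r i) \<in> E"
      proof -
        have "u' + w \<in> UE" if w: "set_mset w \<subseteq> insert i T" "count w i < e i" for w
        proof -
          have "count w j = 0" if "j \<in> V - T" "j \<noteq> i" for j
            using that w(1) by (auto simp: count_eq_zero_iff)
          then have "count (u' + w) j < e j" if "j \<in> V - T" for j
            using that w(2) u by (cases "j = i") (auto simp: cu' UE_def)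
          then show ?thesis using su' w(1) iT T(1) by (auto simp: UE_def)
        qed
        then have "keys (?m * r i) \<subseteq> UE"
          using cer[OF iT] by (intro keys_mult_subset[of _ "{u'}" _ "{w. set_mset w \<subseteq> insert i T \<and> count w i < e i}"]) auto
        moreover have "keys (- (?m * r i)) = keys (?m * r i)" by (simp add: in_keys_iff set_eq_iff)
        ultimately show ?thesis by (simp add: E_def)
      qed
      ultimately have "c i * (X i * single u a) \<in> EP" using EPI by blast
      then have "(\<Prod>j\<in>V - T - {i}. c j) * (c i * (X i * single u a)) \<in> EP"
        by (rule EP_mult[OF prodA, rotated]) blast
      moreover have "C = (\<Prod>j\<in>V - T - {i}. c j) * c i"
      proof -
        have "(\<Prod>j\<in>V - T. c j) = c i * (\<Prod>j\<in>V - T - {i}. c j)"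
          by (rule prod.remove) (use V(1) iT in auto)
        then show ?thesis unfolding C_def by (metis mult.commute)
      qed
      ultimately show ?thesis by (simp add: mult.assoc)
    qed
    have "(\<Sum>u\<in>K. C * (X i * single u (lookup q u))) \<in> EP" if "finite K" "K \<subseteq> UE" for K
      using that
    proof (induction K)
      case empty
      then show ?case using EPI[of 0 0] idl.subspace_0[OF P(2)] by (simp add: E_def)
    qed (use mono EP_add in auto)
    then have "(\<Sum>u\<in>keys q. C * (X i * single u (lookup q u))) \<in> EP" using q by (simp add: E_def)
    then show ?thesis
      by (subst mpoly_sum_monomials[of q]) (simp add: sum_distrib_left)
  qed
  have XG: "\<exists>N. C ^ N * (X i * g) \<in> EP" if g: "C ^ N * g \<in> EP" for i g N
  proof (cases "i \<in> V")
    case True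
    obtain q where q: "q \<in> E" "C ^ N * g - q \<in> P" using EPE g by blast
    have "C ^ Suc N * (X i * g) = C * (X i * q) + (C * X i) * (C ^ N * g - q)" by (simp add: algebra_simps)
    moreover have "(C * X i) * (C ^ N * g - q) \<in> EP"
      using idl_mult_left[OF P(2) q(2)] EPI[of 0] by (simp add: E_def)
    ultimately have "C ^ Suc N * (X i * g) \<in> EP" using EP_add CXE[OF True q(1)] by simp
    then show ?thesis by blast
  next
    case False
    then have "C ^ N * (X i * g) \<in> P" using V(2) P(2) by (simp add: idl_mult_left idl_mult_right)
    then show ?thesis using EPI[of 0] by (auto simp: E_def)
  qed
  have monG: "\<exists>N. C ^ N * single u a \<in> EP" for u a
  proof (induction u)
    case empty
    have "C ^ 0 * single {#} a \<in> EP"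
      using EPI[of "single {#} a"] idl.subspace_0[OF P(2)] epos
      by (auto simp: E_def UE_def)
    then show ?case by blast
  next
    case (add x u)
    then obtain N where "C ^ N * single u a \<in> EP" by blast
    then obtain N where "C ^ N * (X x * single u a) \<in> EP" using XG by blast
    then show ?case by (auto simp: X_def mult_single)
  qed
  have lift: "C ^ M * g \<in> EP" if "C ^ N * g \<in> EP" "N \<le> M" for M N g
  proof -
    have "C ^ M = C ^ (M - N) * C ^ N" using that(2) by (simp flip: power_add)
    then have "C ^ M * g = C ^ (M - N) * (C ^ N * g)" by (simp only: mult.assoc)
    then show ?thesis using EP_mult[OF Cpow that(1)] by (simp only:)
  qed
  have allG: "\<exists>N. C ^ N * g \<in> EP" for g
  proof -
    have "\<exists>N. C ^ N * (\<Sum>u\<in>K. single u (lookup g u)) \<in> EP" if "finite K" for K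
      using that
    proof (induction K)
      case empty
      then show ?case using EPI[of 0 0] idl.subspace_0[OF P(2)] by (simp add: E_def)
    next
      case (insert u K)
      obtain N N' where "C ^ N * (\<Sum>u\<in>K. single u (lookup g u)) \<in> EP"
        "C ^ N' * single u (lookup g u) \<in> EP" using insert.IH monG by blast
      then have "C ^ max N N' * (single u (lookup g u)) + C ^ max N N' * (\<Sum>u\<in>K. single u (lookup g u)) \<in> EP"
        by (intro EP_add) (auto intro: lift)
      then show ?case using insert.hyps by (auto simp: distrib_left intro!: exI[of _ "max N N'"])
    qed
    from this[of "keys g"] show ?thesis by (simp flip: mpoly_sum_monomials)
  qed
  define B where "B = (\<lambda>u. single u (1 :: 'k)) ` {u. set_mset u \<subseteq> V - T \<and> (\<forall>j\<in>V - T. count u j \<le> e j - 1)}"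
  have finB: "finite B" unfolding B_def using V(1) finite_bounded_multisets[of "V - T" "\<lambda>j. e j - 1"] by simp
  have EB: "q \<in> combinations A B" if q: "q \<in> E" for q
  proof -
    have mono: "single u a \<in> combinations A B" if u: "u \<in> UE" for u a
    proof -
      let ?u = "filter_mset (\<lambda>x. x \<in> T) u" and ?v = "filter_mset (\<lambda>x. x \<notin> T) u"
      have "single ?v (1 :: 'k) \<in> B"
        unfolding B_def
      proof (intro imageI CollectI conjI ballI)
        show "set_mset ?v \<subseteq> V - T" using u by (auto simp: UE_def)
        fix j assume j: "j \<in> V - T"
        then have "count u j < e j" using u by (simp add: UE_def)
        then show "count ?v j \<le> e j - 1" using j by simp
      qed
      moreover have "single ?u a \<in> A" by (auto simp: A_def)
      moreover have "single u a = single ?u a * single ?v 1"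
        by (simp add: mult_single flip: multiset_partition)
      ultimately show ?thesis using combinations_mult[OF A] combinations_base[OF A finB] by simp
    qed
    have "(\<Sum>u\<in>K. single u (lookup q u)) \<in> combinations A B" if "finite K" "K \<subseteq> UE" for K
      using that by (induction K) (use mono combinations_zero[OF A] combinations_add[OF A] in auto)
    from this[of "keys q"] show ?thesis using q by (simp add: E_def flip: mpoly_sum_monomials)
  qed
  \<comment> \<open>The factor \<open>C\<close> makes \<open>b\<close> congruent to 1 modulo
    \<open>C\<close>, and the factor \<open>X t\<close> keeps \<open>b\<close> from being
    constant.\<close>
  define b where "b = 1 + X t * C"
  have Xt: "X t \<in> A" using t by (simp add: A_def X_def)
  have bA: "b \<in> A" using A CA Xt by (simp add: b_def subring_set_def)
  have "X t * C \<noteq> 0" using C0 by simp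
  then obtain w where w: "w \<in> keys (X t * C)" using keys_empty_iff[of "X t * C"] by blast
  have w0: "w \<noteq> {#}" using keys_mult_mem[OF w] by (auto simp: X_def)
  have wb: "w \<in> keys b" using w w0 by (simp add: b_def in_keys_iff lookup_add lookup_one when_def)
  then have "b \<noteq> 0" by auto
  then obtain y where y: "b * y - 1 \<in> P" using inv AP bA by blast
  have "\<exists>N. \<forall>z\<in>Z. C ^ N * (y * z) \<in> EP" if "finite Z" for Z
    using that
  proof (induction Z)
    case (insert z Z)
    obtain N N' where N: "\<forall>z\<in>Z. C ^ N * (y * z) \<in> EP" "C ^ N' * (y * z) \<in> EP" using insert.IH allG by blast
    have "\<forall>z\<in>insert z Z. C ^ max N N' * (y * z) \<in> EP"
      using N lift[of N _ "max N N'"] lift[of N' _ "max N N'"] by auto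
    then show ?case by blast
  qed auto
  then obtain N where N: "\<And>z. z \<in> insert 1 B \<Longrightarrow> C ^ N * (y * z) \<in> EP" using finB by (metis finite_insert)
  have "\<exists>i. \<exists>s\<in>A. C ^ i + b * s \<in> P"
  proof (rule nakayama_elimination[OF A bA CA P(2) finB Cpow])
    show "C ^ N = C ^ N + b * 0" by simp
    show "0 \<in> A" using A by (simp add: subring_set_def)
    fix z assume "z \<in> insert 1 B"
    then obtain q where q: "q \<in> E" "C ^ N * (y * z) - q \<in> P" using EPE N by blast
    have "C ^ N * z - b * q = b * (C ^ N * (y * z) - q) - (C ^ N * z) * (b * y - 1)" by (simp add: algebra_simps)
    also have "\<dots> \<in> P" by (rule idl.subspace_diff[OF P(2) idl_mult_left[OF P(2) q(2)] idl_mult_left[OF P(2) y]])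
    finally show "\<exists>w\<in>combinations A B. C ^ N * z - b * w \<in> P" using EB q(1) by blast
  qed
  then obtain i s where s: "s \<in> A" "C ^ i + b * s \<in> P" by blast
  moreover have "C ^ i + b * s \<in> A" using A Cpow bA s(1) by (simp add: subring_set_def)
  ultimately have "C ^ i + b * s = 0" using AP by blast
  then have "C ^ i = b * (- s)" by (simp add: eq_neg_iff_add_eq_0)
  then have "b dvd C ^ i" by simp
  then have "b dvd (b - 1) ^ i" by (simp add: b_def power_mult_distrib)
  moreover have "b dvd (b - 1) ^ i - (- 1) ^ i"
    using power_diff_sumr2[of "b - 1" i "- 1"] by simp
  ultimately have "b dvd (- 1) ^ i" using dvd_diff[of b "(b - 1) ^ i" "(b - 1) ^ i - (- 1) ^ i"] by simp
  then have "b dvd (- 1) ^ i * (- 1) ^ i" by (rule dvd_mult2)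
  moreover have "(- 1) ^ i * (- 1) ^ i = (1 :: 'k mpoly)" by (simp flip: power_mult_distrib)
  ultimately have "b dvd 1" by (simp only:)
  then obtain s' where "b * s' = 1" by (metis dvdE)
  then show False using unit_imp_const wb w0 by blast
qed

text \<open>\<open>P\<close> contains no nonzero constant, so the empty set of variables is
  independent modulo \<open>P\<close> and a maximal independent \<open>T\<close> exists. As
  \<open>maximal_idl_imp_algebraic\<close> leaves only \<open>T = {}\<close>, each single variable
  is dependent over K.\<close>

theorem maximal_idl_algebraic:
  fixes P :: "'k::field mpoly set"
  assumes V: "finite V" "\<And>j. j \<notin> V \<Longrightarrow> X j \<in> P" and max: "maximal_idl P"
  shows "\<exists>p\<in>P. p \<noteq> 0 \<and> keys p \<subseteq> {u. set_mset u \<subseteq> {i}}"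
proof (cases "i \<in> V")
  case False
  then have "X i \<in> P" using V by blast
  moreover have "keys (X i) \<subseteq> {u. set_mset u \<subseteq> {i}}" by (simp add: X_def)
  ultimately show ?thesis using X_nonzero by blast
next
  case True
  define indep where "indep = (\<lambda>T. \<forall>p\<in>P. keys p \<subseteq> {u. set_mset u \<subseteq> T} \<longrightarrow> p = 0)"
  have P: "prime_idl P" using max by (simp add: maximal_idl_def)
  have "indep {}"
    unfolding indep_def
  proof safe
    fix p assume p: "p \<in> P" "keys p \<subseteq> {u. set_mset u \<subseteq> {}}"
    then have pc: "p = single 0 (lookup p 0)"
      by (intro mpoly_eqI) (auto simp: lookup_single when_def in_keys_iff)
    show "p = 0"
    proof (rule ccontr)
      assume "p \<noteq> 0"
      then have "lookup p 0 \<noteq> 0" using pc by (metis single_zero)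
      then have "single 0 (inverse (lookup p 0)) * p = 1"
        by (subst pc) (simp add: mult_single)
      then show False using idl_mult_left[OF prime_idlD(1)[OF P] p(1)] prime_idlD(2)[OF P] by metis
    qed
  qed
  then obtain T where T: "T \<subseteq> V" "indep T" and Tmax: "\<And>T'. T' \<subseteq> V \<Longrightarrow> indep T' \<Longrightarrow> T \<subseteq> T' \<Longrightarrow> T = T'"
  proof -
    have "{T. T \<subseteq> V \<and> indep T} \<noteq> {}" using \<open>indep {}\<close> by blast
    moreover have "finite {T. T \<subseteq> V \<and> indep T}" using V(1) by simp
    ultimately show ?thesis
      using finite_has_maximal[of "{T. T \<subseteq> V \<and> indep T}"] that by auto
  qed
  have dep: "\<exists>p\<in>P. p \<noteq> 0 \<and> keys p \<subseteq> {u. set_mset u \<subseteq> insert j T}" if "j \<in> V - T" for j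
  proof -
    have "\<not> indep (insert j T)" using Tmax[of "insert j T"] that T(1) by blast
    then show ?thesis by (auto simp: indep_def)
  qed
  have "T = {}"
    using maximal_idl_imp_algebraic[OF V max T(1) _ dep] T(2) by (simp add: indep_def)
  then show ?thesis using dep[of i] True by simp
qed

section \<open>Regular sequences with pure powers as leading terms\<close>

definition weight :: "(nat \<Rightarrow> nat) \<Rightarrow> mon \<Rightarrow> nat" where
  "weight w u = (\<Sum>i\<in>#u. w i)"

lemma weight_add [simp]: "weight w (u + v) = weight w u + weight w v"
  by (simp add: weight_def)

lemma weight_replicate [simp]: "weight w (replicate_mset k i) = k * w i"
  by (simp add: weight_def)

text \<open>Weights do not separate monomials; the strict inequality rules out a tie at the
  top.\<close>

definition leads :: "(nat \<Rightarrow> nat) \<Rightarrow> 'k::field mpoly \<Rightarrow> mon \<Rightarrow> bool" where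
  "leads w p u \<longleftrightarrow> keys (p - single u 1) \<subseteq> {v. weight w v < weight w u}"

lemma leads_keys:
  assumes "leads w p u"
  shows "keys p \<subseteq> {v. weight w v \<le> weight w u}"
proof -
  have "keys ((p - single u 1) + single u 1) \<subseteq> {v. weight w v \<le> weight w u}"
    using assms by (intro keys_add_subset) (auto simp: leads_def)
  then show ?thesis by simp
qed

lemma leads_mult:
  assumes "leads w p u" "leads w q v"
  shows "leads w (p * q) (u + v)"
proof -
  let ?u = "single u 1" and ?v = "single v 1"
  have "p * q - single (u + v) 1 = (p - ?u) * q + ?u * (q - ?v)"
    by (simp add: algebra_simps mult_single)
  moreover have "keys ((p - ?u) * q) \<subseteq> {x. weight w x < weight w (u + v)}"
    using assms(1) leads_keys[OF assms(2)]
    by (intro keys_mult_subset[of _ "{x. weight w x < weight w u}" _ "{x. weight w x \<le> weight w v}"])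
      (auto simp: leads_def)
  moreover have "keys (?u * (q - ?v)) \<subseteq> {x. weight w x < weight w (u + v)}"
    using assms(2)
    by (intro keys_mult_subset[of _ "{u}" _ "{x. weight w x < weight w v}"]) (auto simp: leads_def)
  ultimately show ?thesis unfolding leads_def by (simp add: keys_add_subset)
qed

lemma leads_one: "leads w 1 {#}"
  by (simp add: leads_def single_one flip: zero_multiset_def)

lemma leads_power: "leads w p u \<Longrightarrow> leads w (p ^ k) (repeat_mset k u)"
  by (induction k) (simp_all add: leads_one leads_mult)

lemma leads_prod:
  "finite S \<Longrightarrow> (\<And>i. i \<in> S \<Longrightarrow> leads w (p i) (u i)) \<Longrightarrow> leads w (\<Prod>i\<in>S. p i) (\<Sum>i\<in>S. u i)"
  by (induction S rule: finite_induct) (auto simp: leads_one intro!: leads_mult)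

lemma sum_replicate_count:
  assumes "finite S" "set_mset u \<subseteq> S"
  shows "(\<Sum>i\<in>S. replicate_mset (count u i) i) = u"
proof (rule multiset_eqI)
  fix x
  have "count (\<Sum>i\<in>S. replicate_mset (count u i) i) x = (\<Sum>i\<in>S. if i = x then count u x else 0)"
    by (simp add: count_sum) (intro sum.cong refl, auto)
  also have "\<dots> = count u x"
    using assms by (auto simp: not_in_iff subset_iff)
  finally show "count (\<Sum>i\<in>S. replicate_mset (count u i) i) x = count u x" .
qed

text \<open>
  Since \<open>f i\<close> has leading term \<open>X i ^ N i\<close>, the linear map replacing every full block
  \<open>X i ^ N i\<close> of a monomial by \<open>f i\<close> is unitriangular, hence bijective; it turns
  multiplication by \<open>X i ^ N i\<close> into multiplication by \<open>f i\<close>.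
\<close>

locale power_leading_terms =
  fixes w N :: "nat \<Rightarrow> nat" and f :: "nat \<Rightarrow> 'k::field mpoly"
  assumes N_pos: "N i > 0"
    and lead: "leads w (f i) (replicate_mset (N i) i)"
begin

definition block :: "mon \<Rightarrow> nat \<Rightarrow> 'k mpoly" where
  "block u i = X i ^ (count u i mod N i) * f i ^ (count u i div N i)"

definition psi_mon :: "mon \<Rightarrow> 'k mpoly" where
  "psi_mon u = (\<Prod>i\<in>set_mset u. block u i)"

definition psi :: "'k mpoly \<Rightarrow> 'k mpoly" where
  "psi p = (\<Sum>u\<in>keys p. single 0 (lookup p u) * psi_mon u)"

lemma psi_mon_superset: "finite S \<Longrightarrow> set_mset u \<subseteq> S \<Longrightarrow> psi_mon u = (\<Prod>i\<in>S. block u i)"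
  unfolding psi_mon_def by (rule prod.mono_neutral_left) (auto simp: block_def not_in_iff)

lemma leads_psi_mon: "leads w (psi_mon u) u"
proof -
  have "leads w (block u i) (replicate_mset (count u i) i)" for i
  proof -
    have "leads w (X i) {#i#}" by (simp add: leads_def X_def)
    then have "leads w (block u i) (repeat_mset (count u i mod N i) {#i#} + repeat_mset (count u i div N i) (replicate_mset (N i) i))"
      unfolding block_def by (intro leads_mult leads_power lead)
    also have "repeat_mset (count u i mod N i) {#i#} + repeat_mset (count u i div N i) (replicate_mset (N i) i)
        = replicate_mset (count u i) i"
      by (rule multiset_eqI) simp
    finally show ?thesis .
  qed
  then have "leads w (psi_mon u) (\<Sum>i\<in>set_mset u. replicate_mset (count u i) i)"
    unfolding psi_mon_def by (intro leads_prod) auto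
  then show ?thesis by (simp add: sum_replicate_count)
qed

lemma psi_mon_shift: "psi_mon (replicate_mset (N l) l + u) = f l * psi_mon u"
proof -
  let ?S = "insert l (set_mset u)"
  have "psi_mon (replicate_mset (N l) l + u) = (\<Prod>i\<in>?S. block (replicate_mset (N l) l + u) i)"
    by (rule psi_mon_superset) (auto split: if_splits)
  also have "\<dots> = (\<Prod>i\<in>?S. (if i = l then f l else 1) * block u i)"
    using N_pos by (intro prod.cong refl) (auto simp: block_def algebra_simps)
  also have "\<dots> = f l * (\<Prod>i\<in>?S. block u i)"
    by (simp add: prod.distrib del: prod.insert)
  also have "(\<Prod>i\<in>?S. block u i) = psi_mon u"
    by (rule psi_mon_superset[symmetric]) auto
  finally show ?thesis .
qed

lemma psi_add: "psi (p + q) = psi p + psi q"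
  unfolding psi_def
  by (rule setsum_keys_plus_distrib) (simp_all add: single_add distrib_right)

lemma psi_single: "psi (single u c) = single 0 c * psi_mon u"
  by (simp add: psi_def)

lemma psi_0 [simp]: "psi 0 = 0"
  by (simp add: psi_def)

lemma psi_sum: "psi (\<Sum>i\<in>I. g i) = (\<Sum>i\<in>I. psi (g i))"
  by (induction I rule: infinite_finite_induct) (simp_all add: psi_add)

lemma psi_diff: "psi (p - q) = psi p - psi q"
  using psi_add[of "p - q" q] by simp

lemma psi_shift: "psi (X l ^ N l * p) = f l * psi p"
proof -
  have "X l ^ N l * p = (\<Sum>u\<in>keys p. single (replicate_mset (N l) l + u) (lookup p u))"
    by (subst mpoly_sum_monomials[of p]) (simp add: sum_distrib_left X_power mult_single)
  then have "psi (X l ^ N l * p) = (\<Sum>u\<in>keys p. f l * (single 0 (lookup p u) * psi_mon u))"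
    by (simp add: psi_sum psi_single psi_mon_shift mult.left_commute)
  also have "\<dots> = f l * psi p" by (simp add: psi_def sum_distrib_left)
  finally show ?thesis .
qed

text \<open>On the monomials of greatest weight in \<open>p\<close> nothing changes: what
  \<open>psi\<close> adds to any monomial of \<open>p\<close> has smaller weight.\<close>

lemma psi_eq_0D:
  assumes "psi p = 0"
  shows "p = 0"
proof (rule ccontr)
  assume "p \<noteq> 0"
  then have fin: "finite (weight w ` keys p)" "weight w ` keys p \<noteq> {}" by (simp_all add: keys_empty_iff)
  obtain u where "u \<in> keys p" "weight w u = Max (weight w ` keys p)" using Max_in[OF fin] by auto
  then have u: "u \<in> keys p" "\<And>v. v \<in> keys p \<Longrightarrow> weight w v \<le> weight w u" using Max_ge[OF fin(1)] by auto
  have "lookup (psi_mon v) u = (if v = u then 1 else 0)" if v: "v \<in> keys p" for v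
  proof -
    have "\<not> weight w u < weight w v" using u(2)[OF v] by simp
    then have "u \<notin> keys (psi_mon v - single v 1)"
      using leads_psi_mon[of v] by (auto simp: leads_def)
    then have "lookup (psi_mon v - single v 1) u = 0" by (simp add: in_keys_iff)
    then show ?thesis by (simp add: lookup_minus lookup_single when_def)
  qed
  note mon = this
  have "lookup (psi p) u = (\<Sum>v\<in>keys p. lookup p v * lookup (psi_mon v) u)"
    unfolding psi_def lookup_sum lookup_const_mult ..
  also have "\<dots> = (\<Sum>v\<in>keys p. if v = u then lookup p v else 0)"
    by (intro sum.cong refl) (use mon in auto)
  finally have "lookup (psi p) u = (\<Sum>v\<in>keys p. if v = u then lookup p v else 0)" .
  then have "lookup (psi p) u = lookup p u" using u(1) by simp
  then show False using assms u(1) by (simp add: in_keys_iff)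
qed

lemma psi_surj: "\<exists>p. psi p = q"
proof -
  have sums: "\<exists>p. psi p = r" if "\<And>u c. u \<in> keys r \<Longrightarrow> \<exists>p. psi p = single u c" for r
  proof -
    have "\<exists>g. \<forall>u\<in>keys r. psi (g u) = single u (lookup r u)"
      using that by (intro bchoice) blast
    then obtain g where "\<And>u. u \<in> keys r \<Longrightarrow> psi (g u) = single u (lookup r u)" by blast
    then have "psi (\<Sum>u\<in>keys r. g u) = r"
      by (subst (2) mpoly_sum_monomials) (simp add: psi_sum)
    then show ?thesis by blast
  qed
  \<comment> \<open>\<open>psi_mon u\<close> differs from \<open>u\<close> by monomials of smaller
    weight, which lie in the range by induction.\<close>
  have "\<exists>p. psi p = single u c" for u c
  proof (induction "weight w u" arbitrary: u c rule: less_induct)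
    case less
    let ?r = "psi_mon u - single u 1"
    have "keys (single 0 c * ?r) \<subseteq> {v. weight w v < weight w u}"
      using leads_psi_mon[of u] keys_monomial_mult[of 0 c ?r] by (auto simp: leads_def)
    then obtain p where p: "psi p = single 0 c * ?r"
      using sums[of "single 0 c * ?r"] less.hyps by blast
    have "psi (single u c - p) = single u c"
      by (simp add: psi_diff psi_single p right_diff_distrib mult_single)
    then show ?case by blast
  qed
  then show ?thesis using sums by blast
qed

text \<open>The ideal of the powers \<open>X l ^ N l\<close> with \<open>l \<in> L\<close>, which
  \<open>psi\<close> carries onto the ideal of the \<open>f l\<close>.\<close>

definition block_ideal :: "nat set \<Rightarrow> 'k mpoly set" where
  "block_ideal L = {p. \<forall>u\<in>keys p. \<exists>l\<in>L. N l \<le> count u l}"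

lemma span_subset_psi:
  assumes "x \<in> idl.span (f ` L)"
  shows "\<exists>p\<in>block_ideal L. psi p = x"
  using assms
proof (induction rule: idl.span_induct_alt)
  case base
  then show ?case by (intro bexI[of _ 0]) (simp_all add: block_ideal_def)
next
  case (step c x y)
  then obtain l p where l: "l \<in> L" "x = f l" and p: "p \<in> block_ideal L" "psi p = y" by blast
  obtain d where d: "psi d = c" using psi_surj by blast
  have "psi (X l ^ N l * d + p) = c * x + y"
    unfolding psi_add psi_shift d l p by (simp add: mult.commute)
  moreover have "keys (X l ^ N l * d + p) \<subseteq> {u. \<exists>l\<in>L. N l \<le> count u l}"
  proof (rule keys_add_subset)
    show "keys (X l ^ N l * d) \<subseteq> {u. \<exists>l\<in>L. N l \<le> count u l}"
    proof
      fix u assume "u \<in> keys (X l ^ N l * d)"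
      then obtain v where "u = replicate_mset (N l) l + v"
        using keys_monomial_mult[of "replicate_mset (N l) l" 1 d] by (auto simp: X_power)
      then have "N l \<le> count u l" by simp
      then show "u \<in> {u. \<exists>l\<in>L. N l \<le> count u l}" using l(1) by blast
    qed
  qed (use p in \<open>auto simp: block_ideal_def\<close>)
  ultimately show ?case by (intro bexI[of _ "X l ^ N l * d + p"]) (auto simp: block_ideal_def)
qed

lemma psi_block_ideal:
  assumes "p \<in> block_ideal L"
  shows "psi p \<in> idl.span (f ` L)"
proof -
  have "single 0 (lookup p u) * psi_mon u \<in> idl.span (f ` L)" if u: "u \<in> keys p" for u
  proof -
    obtain l where l: "l \<in> L" "N l \<le> count u l" using assms u by (auto simp: block_ideal_def)
    then have "replicate_mset (N l) l \<subseteq># u" by (simp flip: count_le_replicate_mset_subset_eq)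
    then have "u = replicate_mset (N l) l + (u - replicate_mset (N l) l)" by simp
    then have "psi_mon u = f l * psi_mon (u - replicate_mset (N l) l)" by (metis psi_mon_shift)
    moreover have "f l \<in> idl.span (f ` L)" using l(1) by (intro idl.span_base) auto
    ultimately show ?thesis by (simp add: idl_mult_left idl_mult_right)
  qed
  then show ?thesis unfolding psi_def by (intro idl.span_sum) auto
qed

text \<open>Carried back by \<open>psi\<close>, the claim is that \<open>X k ^ N k\<close> is a
  nonzerodivisor modulo powers of other variables.\<close>

theorem nonzerodivisor_mod_span:
  assumes "k \<notin> L" "f k * a \<in> idl.span (f ` L)"
  shows "a \<in> idl.span (f ` L)"
proof -
  obtain m where m: "m \<in> block_ideal L" "psi m = f k * a" using span_subset_psi[OF assms(2)] by blast
  obtain b where b: "psi b = a" using psi_surj by blast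
  have "psi (m - X k ^ N k * b) = 0" by (simp add: psi_diff psi_shift m b)
  then have meq: "m = X k ^ N k * b" using psi_eq_0D by fastforce
  have "b \<in> block_ideal L"
    unfolding block_ideal_def
  proof safe
    fix u assume "u \<in> keys b"
    then have "replicate_mset (N k) k + u \<in> keys m"
      by (simp add: meq X_power in_keys_iff lookup_monomial_mult)
    then obtain l where "l \<in> L" "N l \<le> count (replicate_mset (N k) k + u) l"
      using m(1) by (auto simp: block_ideal_def)
    then show "\<exists>l\<in>L. N l \<le> count u l" using assms(1) by (intro bexI[of _ l]) (auto split: if_splits)
  qed
  then show ?thesis using psi_block_ideal b by blast
qed

end

section \<open>Systems of parameters of pure vertex decomposable complexes\<close>

definition monic_in :: "nat \<Rightarrow> nat \<Rightarrow> 'k::field mpoly \<Rightarrow> bool" where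
  "monic_in i D y \<longleftrightarrow> keys (y - X i ^ D) \<subseteq> (\<lambda>k. replicate_mset k i) ` {..<D}"

lemma monic_in_keys:
  assumes "monic_in i D y"
  shows "keys y \<subseteq> (\<lambda>k. replicate_mset k i) ` {..D}"
proof -
  have "keys ((y - X i ^ D) + X i ^ D) \<subseteq> (\<lambda>k. replicate_mset k i) ` {..D}"
    using assms by (intro keys_add_subset) (auto simp: monic_in_def X_power)
  then show ?thesis by simp
qed

lemma monic_in_mult:
  assumes "monic_in i D y" "monic_in i E z"
  shows "monic_in i (D + E) (y * z)"
proof -
  let ?R = "\<lambda>A. (\<lambda>k. replicate_mset k i) ` A"
  have sum: "u + v \<in> ?R {..<D + E}"
    if uv: "u \<in> ?R {..<D} \<and> v \<in> ?R {..E} \<or> u \<in> ?R {..D} \<and> v \<in> ?R {..<E}" for u v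
  proof -
    obtain k l where kl: "u = replicate_mset k i" "v = replicate_mset l i" "k + l < D + E"
      using uv by fastforce
    then have "u + v = replicate_mset (k + l) i" by (intro multiset_eqI) simp
    then show ?thesis using kl(3) by blast
  qed
  have "y * z - X i ^ (D + E) = (y - X i ^ D) * z + X i ^ D * (z - X i ^ E)"
    by (simp add: algebra_simps power_add)
  moreover have "keys ((y - X i ^ D) * z) \<subseteq> ?R {..<D + E}"
    by (rule keys_mult_subset[OF assms(1)[unfolded monic_in_def] monic_in_keys[OF assms(2)]])
      (use sum in blast)
  moreover have "keys (X i ^ D) \<subseteq> ?R {..D}" by (simp add: X_power)
  then have "keys (X i ^ D * (z - X i ^ E)) \<subseteq> ?R {..<D + E}"
    by (rule keys_mult_subset[OF _ assms(2)[unfolded monic_in_def]]) (use sum in blast)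
  ultimately show ?thesis unfolding monic_in_def by (simp add: keys_add_subset)
qed

lemma monic_in_power: "monic_in i D y \<Longrightarrow> monic_in i (k * D) (y ^ k)"
proof (induction k)
  case 0
  then show ?case by (simp add: monic_in_def)
next
  case (Suc k)
  then show ?case using monic_in_mult[of i D y "k * D" "y ^ k"] by simp
qed

lemma replicate_mset_of_set_mset: "set_mset u \<subseteq> {i} \<Longrightarrow> u = replicate_mset (count u i) i"
  by (rule multiset_eqI) (auto simp: not_in_iff subset_iff)

lemma exists_monic_in:
  fixes P :: "'k::field mpoly set"
  assumes P: "prime_idl P" and p: "p \<in> P" "p \<noteq> 0" "keys p \<subseteq> {u. set_mset u \<subseteq> {i}}"
  shows "\<exists>D>0. \<exists>y\<in>P. monic_in i D y"
proof -
  define D where "D = Max ((\<lambda>u. count u i) ` keys p)"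
  have fin: "finite ((\<lambda>u. count u i) ` keys p)" "(\<lambda>u. count u i) ` keys p \<noteq> {}"
    using p(2) by (auto simp: keys_empty_iff)
  have rep: "u = replicate_mset (count u i) i" if "u \<in> keys p" for u
    using that p(3) by (intro replicate_mset_of_set_mset) blast
  have le: "count u i \<le> D" if "u \<in> keys p" for u unfolding D_def using fin that by (intro Max_ge) auto
  have "D \<in> (\<lambda>u. count u i) ` keys p" unfolding D_def by (rule Max_in[OF fin])
  then have top: "replicate_mset D i \<in> keys p" using rep by force
  define a where "a = lookup p (replicate_mset D i)"
  have a: "a \<noteq> 0" using top by (simp add: a_def in_keys_iff)
  define y where "y = single 0 (inverse a) * p"
  have y: "lookup y u = inverse a * lookup p u" for u unfolding y_def by (rule lookup_const_mult)
  have yP: "y \<in> P" unfolding y_def using prime_idlD(1)[OF P] p(1) by (rule idl_mult_left)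
  have monic: "monic_in i D y"
    unfolding monic_in_def
  proof
    fix u assume u: "u \<in> keys (y - X i ^ D)"
    have ne: "u \<noteq> replicate_mset D i"
    proof
      assume "u = replicate_mset D i"
      then have "lookup (y - X i ^ D) u = 0" using a by (simp add: lookup_minus y X_power a_def)
      then show False using u by (simp add: in_keys_iff)
    qed
    then have "lookup (X i ^ D) u = (0 :: 'k)" by (simp add: X_power lookup_single when_def)
    then have up: "u \<in> keys p" using u y by (auto simp: in_keys_iff lookup_minus)
    then have "count u i \<noteq> D" using ne rep by metis
    then have "count u i < D" using le[OF up] by simp
    then show "u \<in> (\<lambda>k. replicate_mset k i) ` {..<D}" using rep[OF up] by blast
  qed
  have "D > 0"
  proof (rule ccontr)
    assume "\<not> D > 0"
    then have "y = 1" using monic by (simp add: monic_in_def keys_empty_iff)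
    then show False using yP prime_idlD(2)[OF P] by simp
  qed
  then show ?thesis using monic yP by blast
qed

lemma exists_monic_in_uniform:
  fixes P :: "'k::field mpoly set"
  assumes V: "finite V" "\<And>j. j \<notin> V \<Longrightarrow> X j \<in> P" and max: "maximal_idl P"
  shows "\<exists>D y. D > 0 \<and> (\<forall>i\<in>V. y i \<in> P \<and> monic_in i D (y i))"
proof -
  have P: "prime_idl P" using max by (simp add: maximal_idl_def)
  have "\<exists>D y. D > 0 \<and> y \<in> P \<and> monic_in i D y" for i
    using maximal_idl_algebraic[OF V max, of i] exists_monic_in[OF P, of _ i] by blast
  then obtain d z where dz: "\<And>i. d i > 0 \<and> z i \<in> P \<and> monic_in i (d i) (z i)" by metis
  \<comment> \<open>Raising \<open>z i\<close> to the product of the other degrees gives all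
    polynomials the degree \<open>D\<close>, which cancels when leading terms in different variables
    are compared.\<close>
  define D where "D = (\<Prod>i\<in>V. d i)"
  have "z i ^ (\<Prod>j\<in>V - {i}. d j) \<in> P \<and> monic_in i D (z i ^ (\<Prod>j\<in>V - {i}. d j))" if i: "i \<in> V" for i
  proof
    have "(\<Prod>j\<in>V - {i}. d j) > 0" using dz by (intro prod_pos) simp
    then obtain k where "(\<Prod>j\<in>V - {i}. d j) = Suc k" by (metis gr0_implies_Suc)
    then show "z i ^ (\<Prod>j\<in>V - {i}. d j) \<in> P"
      using dz[of i] prime_idlD(1)[OF P] by (simp add: idl_mult_right)
    have "D = d i * (\<Prod>j\<in>V - {i}. d j)" unfolding D_def by (rule prod.remove[OF V(1) i])
    then show "monic_in i D (z i ^ (\<Prod>j\<in>V - {i}. d j))"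
      using monic_in_power[of i "d i" "z i" "\<Prod>j\<in>V - {i}. d j"] dz[of i] by (simp add: mult.commute)
  qed
  moreover have "D > 0" unfolding D_def using dz by (intro prod_pos) simp
  ultimately show ?thesis
    by (intro exI[of _ D] exI[of _ "\<lambda>i. z i ^ (\<Prod>j\<in>V - {i}. d j)"]) blast
qed

text \<open>
  The exponents form a tropical Vandermonde matrix: on every face \<open>F\<close> of size \<open>d\<close> there are
  weights for which the \<open>k\<close>-th parameter has the \<open>k\<close>-th vertex of \<open>F\<close> as leading variable.
\<close>

definition parameter :: "nat \<Rightarrow> (nat \<Rightarrow> 'k::field mpoly) \<Rightarrow> nat \<Rightarrow> 'k mpoly" where
  "parameter n y k = (\<Sum>i\<in>{1..n}. y i ^ (4 ^ (k * i)))"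

definition parameters :: "nat \<Rightarrow> (nat \<Rightarrow> 'k::field mpoly) \<Rightarrow> nat \<Rightarrow> 'k mpoly list" where
  "parameters n y d = map (\<lambda>k. parameter n y (Suc k)) [0..<d]"

text \<open>A convex function of \<open>i\<close>. If \<open>i\<close> is the k-th vertex of
  \<open>F\<close>, then 2 * k * j minus \<open>slope_sum F j\<close> has its only maximum at j = i:
  its increments 2 * k - (2 * card (F \<inter> {..s}) + 1) are positive for s < i and negative from
  \<open>i\<close> on. Being odd, they never vanish.\<close>

definition slope_sum :: "nat set \<Rightarrow> nat \<Rightarrow> nat" where
  "slope_sum F i = (\<Sum>s<i. 2 * card (F \<inter> {..s}) + 1)"

lemma slope_sum_diff: "i \<le> j \<Longrightarrow> slope_sum F j = slope_sum F i + (\<Sum>s\<in>{i..<j}. 2 * card (F \<inter> {..s}) + 1)"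
  unfolding slope_sum_def by (simp add: sum.atLeastLessThan_concat lessThan_atLeast0)

lemma slope_sum_strict:
  assumes "finite F" "i \<in> F" "j \<noteq> i" and k: "k = card (F \<inter> {..i})"
  shows "2 * (k * j) + slope_sum F i < 2 * (k * i) + slope_sum F j"
proof -
  have k0: "k > 0" using assms by (auto simp: card_gt_0_iff)
  show ?thesis
  proof (cases "j < i")
    case True
    have "2 * card (F \<inter> {..s}) + 1 \<le> 2 * k - 1" if "s \<in> {j..<i}" for s
    proof -
      have "F \<inter> {..s} \<subseteq> F \<inter> {..i}" "i \<in> F \<inter> {..i}" "i \<notin> F \<inter> {..s}" using that assms(2) by auto
      then have "F \<inter> {..s} \<subset> F \<inter> {..i}" by blast
      then have "card (F \<inter> {..s}) < k" unfolding k using assms(1) by (intro psubset_card_mono) auto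
      then show ?thesis by simp
    qed
    then have "(\<Sum>s\<in>{j..<i}. 2 * card (F \<inter> {..s}) + 1) \<le> (i - j) * (2 * k - 1)"
      using sum_bounded_above[of "{j..<i}" "\<lambda>s. 2 * card (F \<inter> {..s}) + 1" "2 * k - 1"] by simp
    also have "\<dots> < (i - j) * (2 * k)" using True k0 by simp
    also have "\<dots> = 2 * (k * i) - 2 * (k * j)" by (simp add: algebra_simps)
    finally show ?thesis using slope_sum_diff[of j i F] True by simp
  next
    case False
    then have ij: "i < j" using assms(3) by simp
    have "2 * k + 1 \<le> 2 * card (F \<inter> {..s}) + 1" if "s \<in> {i..<j}" for s
      unfolding k using that assms(1) by (auto intro!: card_mono)
    then have "(j - i) * (2 * k + 1) \<le> (\<Sum>s\<in>{i..<j}. 2 * card (F \<inter> {..s}) + 1)"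
      using sum_bounded_below[of "{i..<j}" "2 * k + 1" "\<lambda>s. 2 * card (F \<inter> {..s}) + 1"] by simp
    moreover have "(j - i) * (2 * k) < (j - i) * (2 * k + 1)" using ij by simp
    moreover have "(j - i) * (2 * k) = 2 * (k * j) - 2 * (k * i)" by (simp add: algebra_simps)
    moreover have "k * i \<le> k * j" using ij by simp
    ultimately show ?thesis using slope_sum_diff[of i j F] ij by simp
  qed
qed

text \<open>Base 4 in the parameters against base 2 here doubles k * i in the exponent, as
  \<open>slope_sum_strict\<close> requires. Subtracting from \<open>slope_sum F n\<close> reverses
  the sign while the exponents stay natural numbers.\<close>

definition slope_weight :: "nat \<Rightarrow> nat set \<Rightarrow> nat \<Rightarrow> nat" where
  "slope_weight n F i = 2 ^ (slope_sum F n - slope_sum F i)"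

lemma slope_weight_strict:
  assumes "finite F" "i \<in> F" "j \<noteq> i" "i \<le> n" "j \<le> n" "k = card (F \<inter> {..i})"
  shows "4 ^ (k * j) * slope_weight n F j < 4 ^ (k * i) * slope_weight n F i"
proof -
  have "slope_sum F i \<le> slope_sum F n" "slope_sum F j \<le> slope_sum F n"
    using slope_sum_diff[of i n F] slope_sum_diff[of j n F] assms by simp_all
  then have "2 * (k * j) + (slope_sum F n - slope_sum F j) < 2 * (k * i) + (slope_sum F n - slope_sum F i)"
    using slope_sum_strict[OF assms(1-3,6)] by linarith
  moreover have "4 ^ m * 2 ^ l = (2 :: nat) ^ (2 * m + l)" for m l
    by (simp add: power_add power_mult)
  ultimately show ?thesis by (simp add: slope_weight_def)
qed

text \<open>The j-th summand of the parameter has top power \<open>X j ^ (4 ^ (k * j) * D)\<close>.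
  By \<open>slope_weight_strict\<close> its weight is greatest for the k-th vertex \<open>i\<close>
  of \<open>F\<close>, and for it alone.\<close>

lemma leads_restrict_parameter:
  fixes y :: "nat \<Rightarrow> 'k::field mpoly"
  assumes F: "F \<subseteq> {1..n}" "i \<in> F" and D: "D > 0" and y: "\<And>i. i \<in> {1..n} \<Longrightarrow> monic_in i D (y i)"
    and k: "k = card (F \<inter> {..i})"
  shows "leads (slope_weight n F) (restrict_vars F (parameter n y k)) (replicate_mset (4 ^ (k * i) * D) i)"
proof -
  let ?w = "slope_weight n F" and ?N = "4 ^ (k * i) * D"
  have fin: "finite F" using F(1) finite_subset by blast
  have i: "i \<in> {1..n}" using F by blast
  have wi: "?w i > 0" by (simp add: slope_weight_def)
  let ?U = "{v. weight ?w v < ?N * ?w i}"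
  have yk: "monic_in j (4 ^ (k * j) * D) (y j ^ (4 ^ (k * j)))" if "j \<in> {1..n}" for j
    using y[OF that] by (rule monic_in_power)
  have "restrict_vars F (y j ^ (4 ^ (k * j))) \<in> {p. keys p \<subseteq> ?U}" if j: "j \<in> {1..n} - {i}" for j
  proof -
    have "weight ?w u < ?N * ?w i" if u: "u \<in> keys (restrict_vars F (y j ^ (4 ^ (k * j))))" for u
    proof -
      obtain m where m: "u = replicate_mset m j" "m \<le> 4 ^ (k * j) * D" "set_mset u \<subseteq> F"
        using u monic_in_keys[OF yk[of j]] j by (auto simp: keys_restrict_vars)
      show ?thesis
      proof (cases "m = 0")
        case True
        then show ?thesis using m(1) wi D by (simp add: weight_def)
      next
        case False
        have "m * ?w j \<le> (4 ^ (k * j) * ?w j) * D"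
          using mult_right_mono[OF m(2), of "?w j"] by (simp add: algebra_simps)
        also have "\<dots> < (4 ^ (k * i) * ?w i) * D"
          using slope_weight_strict[OF fin F(2), of j n k] i j k D by simp
        finally show ?thesis using m(1) by (simp add: algebra_simps)
      qed
    qed
    then show ?thesis by blast
  qed
  then have rest: "keys (\<Sum>j\<in>{1..n} - {i}. restrict_vars F (y j ^ (4 ^ (k * j)))) \<subseteq> ?U"
    by (intro keys_sum_subset) blast
  have own: "keys (restrict_vars F (y i ^ (4 ^ (k * i)) - X i ^ ?N)) \<subseteq> ?U"
    using yk[OF i] wi by (auto simp: keys_restrict_vars monic_in_def)
  have Xr: "restrict_vars F (X i ^ ?N) = X i ^ ?N"
    using F(2) by (intro restrict_vars_id) (auto simp: X_power split: if_splits)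
  have sum: "restrict_vars F (\<Sum>j\<in>J. g j) = (\<Sum>j\<in>J. restrict_vars F (g j))" for J and g :: "nat \<Rightarrow> 'k mpoly"
    by (induction J rule: infinite_finite_induct) (simp_all add: restrict_vars_add)
  have "restrict_vars F (parameter n y k) - X i ^ ?N
      = restrict_vars F (y i ^ (4 ^ (k * i)) - X i ^ ?N) + (\<Sum>j\<in>{1..n} - {i}. restrict_vars F (y j ^ (4 ^ (k * j))))"
    unfolding parameter_def sum restrict_vars_diff Xr using i by (subst sum.remove[of _ i]) auto
  then show ?thesis
    using keys_add_subset[OF own rest] by (simp add: leads_def flip: X_power)
qed

text \<open>Modulo \<open>nonface_ideal (Pow F)\<close> a parameter may be replaced by its
  restriction to \<open>F\<close>. The variables outside \<open>F\<close> and the restricted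
  parameters, each indexed by the vertex whose power leads it, form a family as in
  \<open>power_leading_terms\<close>.\<close>

lemma weakly_regular_parameters_simplex:
  fixes y :: "nat \<Rightarrow> 'k::field mpoly"
  assumes F: "F \<subseteq> {1..n}" and D: "D > 0" and y: "\<And>i. i \<in> {1..n} \<Longrightarrow> monic_in i D (y i)"
  shows "weakly_regular (nonface_ideal (Pow F)) (parameters n y (card F))"
  unfolding weakly_regular_def
proof (intro allI impI)
  have fin: "finite F" using F finite_subset by blast
  let ?pos = "\<lambda>i. card (F \<inter> {..i})"
  let ?I = "nonface_ideal (Pow F) :: 'k mpoly set"
  define f where "f = (\<lambda>i. if i \<in> F then restrict_vars F (parameter n y (?pos i)) else X i)"
  define N where "N = (\<lambda>i. if i \<in> F then 4 ^ (?pos i * i) * D else 1)"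
  interpret power_leading_terms "slope_weight n F" N f
  proof
    fix i
    show "N i > 0" using D by (simp add: N_def)
    show "leads (slope_weight n F) (f i) (replicate_mset (N i) i)"
    proof (cases "i \<in> F")
      case True
      then show ?thesis using leads_restrict_parameter[OF F True D y refl] by (simp add: f_def N_def)
    next
      case False
      then show ?thesis by (simp add: f_def N_def leads_def X_def)
    qed
  qed
  have pos_inj: "inj_on ?pos F"
  proof (rule linorder_inj_onI')
    fix i j assume ij: "i \<in> F" "j \<in> F" "i < j"
    then have "F \<inter> {..i} \<subseteq> F \<inter> {..j}" "j \<in> F \<inter> {..j}" "j \<notin> F \<inter> {..i}" by auto
    then have "F \<inter> {..i} \<subset> F \<inter> {..j}" by blast
    then have "?pos i < ?pos j" using fin by (intro psubset_card_mono) auto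
    then show "?pos i \<noteq> ?pos j" by simp
  qed
  have "?pos ` F \<subseteq> {1..card F}"
  proof
    fix m assume "m \<in> ?pos ` F"
    then obtain i where i: "i \<in> F" "m = ?pos i" by blast
    have "m \<le> card F" unfolding i(2) using fin by (intro card_mono) auto
    moreover have "m > 0" unfolding i(2) using fin i(1) by (auto simp: card_gt_0_iff)
    ultimately show "m \<in> {1..card F}" by simp
  qed
  moreover have "card (?pos ` F) = card {1..card F}" using card_image[OF pos_inj] by simp
  ultimately have pos: "?pos ` F = {1..card F}" by (intro card_subset_eq) auto
  fix k a assume k: "k < length (parameters n y (card F))"
    and a: "parameters n y (card F) ! k * a \<in>
      idl.span (?I \<union> set (take k (parameters n y (card F))))"
  have kF: "k < card F" using k by (simp add: parameters_def)
  \<comment> \<open>The ideal at stage \<open>k\<close> is generated by the variables outside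
    \<open>F\<close> and the parameters of the first \<open>k\<close> vertices of
    \<open>F\<close>.\<close>
  define L where "L = - F \<union> {i \<in> F. ?pos i \<le> k}"
  have take: "set (take k (parameters n y (card F))) = parameter n y ` {1..k}"
  proof -
    have "take k (parameters n y (card F)) = map (\<lambda>k. parameter n y (Suc k)) [0..<k]"
      using kF by (simp add: parameters_def take_map)
    then show ?thesis
      by (simp add: image_Suc_atLeastLessThan atLeastLessThanSuc_atLeastAtMost
        flip: image_image[of "parameter n y" Suc])
  qed
  have I_L: "?I \<subseteq> idl.span (f ` L)"
    by (rule nonface_Pow_subset) (auto intro!: idl.span_base image_eqI simp: f_def L_def)
  have diff: "p - restrict_vars F p \<in> ?I" for p
    by (simp add: restrict_vars_diff flip: restrict_vars_eq_0_iff)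
  have span: "idl.span (?I \<union> parameter n y ` {1..k}) = idl.span (f ` L)"
  proof (intro equalityI idl.span_minimal Un_least)
    show "parameter n y ` {1..k} \<subseteq> idl.span (f ` L)"
    proof
      fix x assume "x \<in> parameter n y ` {1..k}"
      then obtain m where m: "m \<in> {1..k}" "x = parameter n y m" by blast
      then have "m \<in> ?pos ` F" using kF pos by auto
      then obtain i where i: "i \<in> F" "m = ?pos i" by blast
      then have "f i \<in> idl.span (f ` L)" using m by (intro idl.span_base imageI) (auto simp: L_def)
      moreover have "f i = restrict_vars F x" using i m by (simp add: f_def)
      moreover have "x - restrict_vars F x \<in> idl.span (f ` L)" using diff I_L by blast
      ultimately show "x \<in> idl.span (f ` L)" using idl_diff_cancel[of "idl.span (f ` L)"] by simp
    qed
    show "f ` L \<subseteq> idl.span (?I \<union> parameter n y ` {1..k})"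
    proof
      fix x assume "x \<in> f ` L"
      then obtain i where i: "i \<in> L" "x = f i" by blast
      show "x \<in> idl.span (?I \<union> parameter n y ` {1..k})"
      proof (cases "i \<in> F")
        case True
        let ?p = "parameter n y (?pos i)"
        have "?pos i \<in> {1..k}" using True i pos by (auto simp: L_def)
        then have "?p \<in> idl.span (?I \<union> parameter n y ` {1..k})" by (intro idl.span_base) auto
        moreover have "?p - x \<in> idl.span (?I \<union> parameter n y ` {1..k})"
          using diff[of ?p] True i by (intro idl.span_base) (simp add: f_def)
        ultimately show ?thesis using idl_diff_cancel'[of "idl.span (?I \<union> parameter n y ` {1..k})"] by simp
      next
        case False
        then have "x \<in> ?I" using i by (simp add: f_def X_nonface)
        then show ?thesis by (intro idl.span_base) simp
      qed
    qed
  qed (use I_L in auto)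
  have "Suc k \<in> ?pos ` F" using kF pos by auto
  then obtain i where i: "i \<in> F" "Suc k = ?pos i" by blast
  then have iL: "i \<notin> L" by (auto simp: L_def)
  let ?p = "parameter n y (Suc k)"
  have "parameters n y (card F) ! k = ?p" using kF by (simp add: parameters_def)
  then have "?p * a \<in> idl.span (f ` L)" using a unfolding take span by (simp only:)
  moreover have "(?p - f i) * a \<in> idl.span (f ` L)"
    using diff[of ?p] I_L i by (intro idl_mult_right) (auto simp: f_def)
  ultimately have "?p * a - (?p - f i) * a \<in> idl.span (f ` L)" by (rule idl.span_diff)
  then have "f i * a \<in> idl.span (f ` L)" by (simp add: algebra_simps)
  then have "a \<in> idl.span (f ` L)" by (rule nonzerodivisor_mod_span[OF iL])
  then show "a \<in> idl.span (?I \<union> set (take k (parameters n y (card F))))" unfolding take span .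
qed

text \<open>If \<open>C\<close> contains no vertex of \<Gamma>, this is the join of \<Gamma> with
  the simplex on \<open>C\<close>.\<close>

definition cone :: "nat set set \<Rightarrow> nat set \<Rightarrow> nat set set" where
  "cone \<Gamma> C = {F. F - C \<in> \<Gamma>}"

text \<open>Whether \<open>X v\<close> times a monomial has a face as support does not depend on the
  exponent of \<open>v\<close> in that monomial. So \<open>v\<close> becomes a cone point over its
  link.\<close>

lemma colon_nonface_cone:
  assumes \<Gamma>: "\<And>F G. F \<in> \<Gamma> \<Longrightarrow> G \<subseteq> F \<Longrightarrow> G \<in> \<Gamma>" and v: "v \<notin> C"
  shows "colon (nonface_ideal (cone \<Gamma> C)) (X v) = (nonface_ideal (cone (link \<Gamma> v) (insert v C)) :: 'k::field mpoly set)"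
proof -
  have key: "set_mset ({#v#} + u) \<in> cone \<Gamma> C \<longleftrightarrow> set_mset u \<in> cone (link \<Gamma> v) (insert v C)" for u
  proof -
    have "set_mset ({#v#} + u) - C = (set_mset u - insert v C) \<union> {v}" using v by auto
    moreover have "set_mset u - insert v C \<in> \<Gamma>" if "(set_mset u - insert v C) \<union> {v} \<in> \<Gamma>"
      using \<Gamma>[OF that] by blast
    ultimately show ?thesis by (auto simp: cone_def link_def)
  qed
  have "p * X v \<in> nonface_ideal (cone \<Gamma> C) \<longleftrightarrow> p \<in> nonface_ideal (cone (link \<Gamma> v) (insert v C))" for p :: "'k mpoly"
  proof -
    have "keys (X v * p) = (\<lambda>u. {#v#} + u) ` keys p"
      unfolding X_def by (rule keys_monic_monomial_mult)
    then show ?thesis using key by (simp add: nonface_ideal_def mult.commute[of p])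
  qed
  then show ?thesis by (auto simp: colon_def)
qed

lemma cone_down_closed:
  assumes "\<And>F G. F \<in> \<Gamma> \<Longrightarrow> G \<subseteq> F \<Longrightarrow> G \<in> \<Gamma>" "F \<in> cone \<Gamma> C" "G \<subseteq> F"
  shows "G \<in> cone \<Gamma> C"
  using assms(1)[of "F - C" "G - C"] assms(2,3) by (auto simp: cone_def)

lemma subspace_nonface_cone:
  assumes "\<And>F G. F \<in> \<Gamma> \<Longrightarrow> G \<subseteq> F \<Longrightarrow> G \<in> \<Gamma>"
  shows "idl.subspace (nonface_ideal (cone \<Gamma> C))"
proof (rule subspace_nonface_ideal)
  show "G \<in> cone \<Gamma> C" if "F \<in> cone \<Gamma> C" "G \<subseteq> F" for F G
    by (rule cone_down_closed[OF assms that])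
qed

lemma span_nonface_cone:
  assumes \<Gamma>: "\<And>F G. F \<in> \<Gamma> \<Longrightarrow> G \<subseteq> F \<Longrightarrow> G \<in> \<Gamma>" and v: "v \<notin> C"
  shows "idl.span (insert (X v) (nonface_ideal (cone \<Gamma> C))) = (nonface_ideal (cone (deletion \<Gamma> v) C) :: 'k::field mpoly set)"
    (is "idl.span ?A = ?B")
proof (intro equalityI subsetI)
  have "G \<in> deletion \<Gamma> v" if "F \<in> deletion \<Gamma> v" "G \<subseteq> F" for F G
    using that \<Gamma>[of F G] by (auto simp: deletion_def)
  then have "idl.subspace ?B"
    by (rule subspace_nonface_cone)
  moreover have "?A \<subseteq> ?B"
    using v nonface_ideal_mono[of "cone (deletion \<Gamma> v) C" "cone \<Gamma> C"]
    by (auto simp: X_nonface cone_def deletion_def)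
  ultimately show "p \<in> ?B" if "p \<in> idl.span ?A" for p using that idl.span_minimal by blast
next
  fix p :: "'k mpoly" assume p: "p \<in> ?B"
  show "p \<in> idl.span ?A"
  proof (rule mpoly_mem_subspaceI)
    fix u assume "u \<in> keys p"
    then have u: "set_mset u - C \<notin> deletion \<Gamma> v" using p by (auto simp: nonface_ideal_def cone_def)
    show "single u (lookup p u) \<in> idl.span ?A"
    proof (cases "v \<in># u")
      case True
      then have "single u (lookup p u) = single (u - {#v#}) (lookup p u) * X v"
        by (simp add: X_def mult_single)
      moreover have "X v \<in> idl.span ?A" by (intro idl.span_base) simp
      ultimately show ?thesis by (simp add: idl_mult_left)
    next
      case False
      then have "single u (lookup p u) \<in> nonface_ideal (cone \<Gamma> C)"
        using u by (auto simp: deletion_def nonface_ideal_def cone_def)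
      then show ?thesis by (intro idl.span_base) simp
    qed
  qed simp
qed

lemma exists_facet_above:
  assumes "finite \<Gamma>" "F \<in> \<Gamma>"
  shows "\<exists>G. facet \<Gamma> G \<and> F \<subseteq> G"
  using finite_has_maximal2[OF assms] by (auto simp: facet_def)

text \<open>\<open>C\<close> collects the vertices at which links have been taken. The number
  \<open>e + card C\<close> never changes: facets of the deletion are facets of \<Gamma>, which is
  where shedding enters, and passing to the link lowers \<open>e\<close> by one and adds
  \<open>v\<close> to \<open>C\<close>. So both ends of the exact sequence for \<open>X v\<close>
  are regular for the same list, and a cone over a simplex is again a simplex.\<close>

theorem weakly_regular_parameters_cone:
  fixes y :: "nat \<Rightarrow> 'k::field mpoly"
  assumes "vertex_decomposable \<Gamma>" and D: "D > 0" and y: "\<And>i. i \<in> {1..n} \<Longrightarrow> monic_in i D (y i)"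
    and "\<Gamma> \<subseteq> Pow {1..n}" "\<And>F G. F \<in> \<Gamma> \<Longrightarrow> G \<subseteq> F \<Longrightarrow> G \<in> \<Gamma>" "C \<subseteq> {1..n}" "C \<inter> \<Union>\<Gamma> = {}"
    and "\<And>F. facet \<Gamma> F \<Longrightarrow> card F = e"
  shows "weakly_regular (nonface_ideal (cone \<Gamma> C)) (parameters n y (e + card C))"
  using assms(1,4-)
proof (induction arbitrary: C e rule: vertex_decomposable.induct)
  case (simplex A)
  have "facet (Pow A) A" by (auto simp: facet_def)
  then have "card A = e" by (rule simplex.prems(5))
  moreover have "finite C" using finite_subset[OF simplex.prems(3)] by simp
  moreover have "C \<inter> A = {}" using simplex.prems by auto
  ultimately have "card (A \<union> C) = e + card C" using simplex.hyps by (subst card_Un_disjoint) auto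
  moreover have "cone (Pow A) C = Pow (A \<union> C)" by (auto simp: cone_def)
  moreover have "A \<union> C \<subseteq> {1..n}" using simplex.prems by auto
  then have "weakly_regular (nonface_ideal (Pow (A \<union> C))) (parameters n y (card (A \<union> C)))"
    by (rule weakly_regular_parameters_simplex[OF _ D y])
  ultimately show ?case by (simp only:)
next
  case (shed v \<Gamma>)
  note \<Gamma> = shed.prems(2)
  have fin\<Gamma>: "finite \<Gamma>" using shed.prems(1) finite_subset by blast
  have vC: "v \<notin> C" using shed.hyps(1) shed.prems(4) by auto
  have vn: "v \<in> {1..n}" using shed.hyps(1) shed.prems(1) by auto
  have finC: "finite C" using finite_subset[OF shed.prems(3)] by simp
  show ?case
  proof (rule weakly_regular_exact[where x = "X v"])
    show "idl.subspace (nonface_ideal (cone \<Gamma> C) :: 'k mpoly set)"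
      using \<Gamma> by (rule subspace_nonface_cone)
    have "weakly_regular (nonface_ideal (cone (deletion \<Gamma> v) C)) (parameters n y (e + card C))"
    proof (rule shed.IH(1))
      show "G \<in> deletion \<Gamma> v" if "F \<in> deletion \<Gamma> v" "G \<subseteq> F" for F G
        using that \<Gamma>[of F G] by (auto simp: deletion_def)
      show "card F = e" if "facet (deletion \<Gamma> v) F" for F using shed.hyps that shed.prems(5) by blast
    qed (use shed.prems in \<open>auto simp: deletion_def\<close>)
    moreover have "idl.span (insert (X v) (nonface_ideal (cone \<Gamma> C))) =
        (nonface_ideal (cone (deletion \<Gamma> v) C) :: 'k mpoly set)"
      using \<Gamma> vC by (rule span_nonface_cone)
    ultimately show "weakly_regular (idl.span (insert (X v) (nonface_ideal (cone \<Gamma> C)))) (parameters n y (e + card C))"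
      by (simp only:)
    obtain G where G: "facet \<Gamma> G" "{v} \<subseteq> G" using exists_facet_above[OF fin\<Gamma> shed.hyps(1)] by blast
    have "finite G" using G(1) shed.prems(1) by (auto simp: facet_def intro: finite_subset)
    \<comment> \<open>\<open>v\<close> lies in a facet, so \<open>e - 1\<close> below is a true
      difference.\<close>
    then have e: "e > 0" using shed.prems(5)[OF G(1)] G(2) by (auto simp: card_gt_0_iff)
    have "weakly_regular (nonface_ideal (cone (link \<Gamma> v) (insert v C))) (parameters n y ((e - 1) + card (insert v C)))"
    proof (rule shed.IH(2))
      show "G \<in> link \<Gamma> v" if "F \<in> link \<Gamma> v" "G \<subseteq> F" for F G
        using that \<Gamma>[of F G] \<Gamma>[of "F \<union> {v}" "G \<union> {v}"] by (auto simp: link_def)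
      show "card F = e - 1" if F: "facet (link \<Gamma> v) F" for F
      proof -
        have F1: "F \<union> {v} \<in> \<Gamma>" "v \<notin> F" using F by (auto simp: facet_def link_def)
        have "H = F \<union> {v}" if H: "H \<in> \<Gamma>" "F \<union> {v} \<subseteq> H" for H
        proof -
          have "H - {v} \<in> link \<Gamma> v" using H \<Gamma>[OF H(1), of "H - {v}"] by (auto simp: link_def insert_absorb)
          then have "H - {v} = F" using F H F1 by (auto simp: facet_def)
          then show ?thesis using H by auto
        qed
        then have "facet \<Gamma> (F \<union> {v})" using F1(1) unfolding facet_def by blast
        then have "card (F \<union> {v}) = e" by (rule shed.prems(5))
        moreover have "F \<subseteq> {1..n}" using F1(1) shed.prems(1) by blast
        then have "finite F" by (rule finite_subset) simp
        ultimately show ?thesis using F1(2) by simp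
      qed
    qed (use shed.prems vn in \<open>auto simp: link_def\<close>)
    moreover have "(e - 1) + card (insert v C) = e + card C" using e vC finC by simp
    moreover have "colon (nonface_ideal (cone \<Gamma> C)) (X v) =
        (nonface_ideal (cone (link \<Gamma> v) (insert v C)) :: 'k mpoly set)"
      using \<Gamma> vC by (rule colon_nonface_cone)
    ultimately show "weakly_regular (colon (nonface_ideal (cone \<Gamma> C)) (X v)) (parameters n y (e + card C))"
      by (simp only:)
  qed
qed

section \<open>Transfer to the Stanley-Reisner ring\<close>

text \<open>The bridge from ideals of a type to rings with a carrier: ideals of \<open>R\<close>
  correspond to the ideals of the source above the kernel, by preimage and image under
  \<open>\<phi>\<close>.\<close>

locale ring_presentation = cring R for R :: "('b, 'c) ring_scheme" (structure) +
  fixes \<phi> :: "'a::comm_ring_1 \<Rightarrow> 'b"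
  assumes phi_add: "\<phi> (a + b) = \<phi> a \<oplus> \<phi> b"
    and phi_mult: "\<phi> (a * b) = \<phi> a \<otimes> \<phi> b"
    and phi_one: "\<phi> 1 = \<one>"
    and phi_surj: "range \<phi> = carrier R"
begin

definition ker :: "'a set" where
  "ker = {a. \<phi> a = \<zero>}"

definition pull :: "'b set \<Rightarrow> 'a set" where
  "pull J = {a. \<phi> a \<in> J}"

lemma phi_closed [simp]: "\<phi> a \<in> carrier R"
  using phi_surj by blast

lemma phi_zero [simp]: "\<phi> 0 = \<zero>"
proof -
  have "\<phi> 0 = \<phi> 0 \<oplus> \<phi> 0" using phi_add[of 0 0] by simp
  then show ?thesis by (metis add.l_cancel_one' phi_closed)
qed

lemma phi_uminus: "\<phi> (- a) = \<ominus> \<phi> a"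
proof -
  have "\<phi> (- a) \<oplus> \<phi> a = \<zero>" using phi_add[of "- a" a] by simp
  then show ?thesis by (metis minus_equality phi_closed)
qed

lemma phi_eq_iff: "\<phi> a = \<phi> b \<longleftrightarrow> a - b \<in> ker"
proof -
  have "\<phi> (a - b) = \<phi> a \<ominus> \<phi> b" using phi_add[of a "- b"] by (simp add: phi_uminus a_minus_def)
  then show ?thesis by (simp add: ker_def)
qed

lemma subspace_pull:
  assumes "ideal J R"
  shows "idl.subspace (pull J)"
proof -
  interpret J: ideal J R by fact
  show ?thesis
    by (rule idl.subspaceI) (simp_all add: pull_def phi_add phi_mult J.I_l_closed)
qed

lemma subspace_ker: "idl.subspace ker"
  using subspace_pull[OF zeroideal] by (simp add: pull_def ker_def)

lemma ker_subset_pull: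
  assumes "ideal J R"
  shows "ker \<subseteq> pull J"
proof -
  interpret J: ideal J R by fact
  show ?thesis by (auto simp: pull_def ker_def)
qed

lemma phi_image_pull: "J \<subseteq> carrier R \<Longrightarrow> \<phi> ` pull J = J"
  using phi_surj by (auto simp: pull_def)

lemma phi_mem_image_iff:
  assumes "idl.subspace K" "ker \<subseteq> K"
  shows "\<phi> a \<in> \<phi> ` K \<longleftrightarrow> a \<in> K"
proof
  assume "\<phi> a \<in> \<phi> ` K"
  then obtain b where "b \<in> K" "a - b \<in> ker" by (auto simp: phi_eq_iff)
  then show "a \<in> K" using assms idl_diff_cancel by blast
qed simp

lemma phi_image_psubset:
  assumes "idl.subspace K" "ker \<subseteq> K" "idl.subspace L" "ker \<subseteq> L" "K \<subset> L"
  shows "\<phi> ` K \<subset> \<phi> ` L"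
proof -
  obtain a where a: "a \<in> L" "a \<notin> K" using assms(5) by blast
  then have "\<phi> a \<in> \<phi> ` L" "\<phi> a \<notin> \<phi> ` K" using phi_mem_image_iff[OF assms(1,2)] by simp_all
  then show ?thesis using assms(5) by blast
qed

lemma pull_psubset: "L \<subseteq> carrier R \<Longrightarrow> J \<subset> L \<Longrightarrow> pull J \<subset> pull L"
proof -
  assume L: "L \<subseteq> carrier R" and JL: "J \<subset> L"
  then obtain x where x: "x \<in> L" "x \<notin> J" by blast
  then obtain a where "x = \<phi> a" using L phi_surj by blast
  then have "a \<in> pull L" "a \<notin> pull J" using x by (simp_all add: pull_def)
  moreover have "pull J \<subseteq> pull L" using JL by (auto simp: pull_def)
  ultimately show "pull J \<subset> pull L" by blast
qed

lemma ideal_phi_image: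
  assumes "idl.subspace K"
  shows "ideal (\<phi> ` K) R"
proof (rule idealI)
  show "ring R" by (rule ring_axioms)
  show "subgroup (\<phi> ` K) (add_monoid R)"
  proof
    show "\<phi> ` K \<subseteq> carrier (add_monoid R)" by auto
    show "\<one>\<^bsub>add_monoid R\<^esub> \<in> \<phi> ` K"
      using idl.subspace_0[OF assms] phi_zero by (metis image_eqI monoid.simps(2))
    fix x assume "x \<in> \<phi> ` K"
    then obtain a where a: "a \<in> K" "x = \<phi> a" by blast
    have "inv\<^bsub>add_monoid R\<^esub> x = \<phi> (- a)" by (simp add: a phi_uminus flip: a_inv_def)
    then show "inv\<^bsub>add_monoid R\<^esub> x \<in> \<phi> ` K" using idl.subspace_neg[OF assms a(1)] by simp
    fix y assume "y \<in> \<phi> ` K"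
    then obtain b where b: "b \<in> K" "y = \<phi> b" by blast
    have "x \<otimes>\<^bsub>add_monoid R\<^esub> y = \<phi> (a + b)" by (simp add: a b phi_add)
    then show "x \<otimes>\<^bsub>add_monoid R\<^esub> y \<in> \<phi> ` K" using idl.subspace_add[OF assms a(1) b(1)] by simp
  qed
  fix a x assume "a \<in> \<phi> ` K" "x \<in> carrier R"
  then obtain b c where bc: "b \<in> K" "a = \<phi> b" "x = \<phi> c" using phi_surj by blast
  have "c * b \<in> K" using idl_mult_left[OF assms bc(1)] .
  then show "x \<otimes> a \<in> \<phi> ` K" using bc by (auto simp flip: phi_mult)
  have "b * c \<in> K" using idl_mult_right[OF assms bc(1)] .
  then show "a \<otimes> x \<in> \<phi> ` K" using bc by (auto simp flip: phi_mult)
qed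

lemma genideal_phi_image: "genideal R (\<phi> ` A) = \<phi> ` idl.span (ker \<union> A)"
proof
  show "genideal R (\<phi> ` A) \<subseteq> \<phi> ` idl.span (ker \<union> A)"
    by (rule genideal_minimal[OF ideal_phi_image]) (auto intro!: imageI idl.span_base)
  let ?J = "genideal R (\<phi> ` A)"
  have J: "ideal ?J R" by (rule genideal_ideal) auto
  have "\<phi> ` A \<subseteq> ?J" by (rule genideal_self) auto
  then have "A \<subseteq> pull ?J" by (auto simp: pull_def)
  then have "idl.span (ker \<union> A) \<subseteq> pull ?J"
    using ker_subset_pull[OF J] subspace_pull[OF J] by (intro idl.span_minimal) auto
  then show "\<phi> ` idl.span (ker \<union> A) \<subseteq> ?J" by (auto simp: pull_def)
qed

lemma prime_pull:
  assumes "primeideal Q R"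
  shows "prime_idl (pull Q)"
proof -
  interpret Q: primeideal Q R by fact
  show ?thesis
    unfolding prime_idl_def
  proof (intro conjI allI impI)
    show "idl.subspace (pull Q)" by (rule subspace_pull) (rule Q.is_ideal)
    show "1 \<notin> pull Q" using Q.I_notcarr Q.one_imp_carrier by (auto simp: pull_def phi_one)
    show "a \<in> pull Q \<or> b \<in> pull Q" if "a * b \<in> pull Q" for a b
      using that Q.I_prime[of "\<phi> a" "\<phi> b"] by (simp add: pull_def phi_mult)
  qed
qed

lemma primeideal_phi_image:
  assumes "prime_idl Q" "ker \<subseteq> Q"
  shows "primeideal (\<phi> ` Q) R"
proof (rule primeidealI[OF ideal_phi_image])
  note Q = prime_idlD(1)[OF assms(1)] assms(2)
  show "idl.subspace Q" by (rule Q)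
  show "cring R" by (rule cring_axioms)
  show "carrier R \<noteq> \<phi> ` Q"
    using phi_mem_image_iff[OF Q, of 1] prime_idlD(2)[OF assms(1)] phi_closed by metis
  fix x y assume "x \<in> carrier R" "y \<in> carrier R" and xy: "x \<otimes> y \<in> \<phi> ` Q"
  then obtain a b where ab: "x = \<phi> a" "y = \<phi> b" using phi_surj by blast
  then have "a * b \<in> Q" using xy phi_mem_image_iff[OF Q, of "a * b"] by (simp add: phi_mult)
  then show "x \<in> \<phi> ` Q \<or> y \<in> \<phi> ` Q" using prime_idlD(3)[OF assms(1)] ab by blast
qed

lemma maximal_pull:
  assumes "maximalideal P R"
  shows "maximal_idl (pull P)"
proof -
  interpret P: maximalideal P R by fact
  have sub: "idl.subspace (pull P)" "ker \<subseteq> pull P"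
    using subspace_pull ker_subset_pull P.is_ideal by blast+
  have "\<exists>b. a * b - 1 \<in> pull P" if a: "a \<notin> pull P" for a
  proof -
    let ?K = "idl.span (insert a (pull P))"
    have K: "pull P \<subseteq> ?K" "a \<in> ?K" by (auto intro: idl.span_base)
    have "P \<subseteq> \<phi> ` ?K" using image_mono[OF K(1), of \<phi>] phi_image_pull[OF P.a_subset] by simp
    moreover have "\<phi> ` ?K \<noteq> P" using K(2) a by (auto simp: pull_def)
    moreover have "\<phi> ` ?K \<subseteq> carrier R" by auto
    ultimately have "\<phi> ` ?K = carrier R"
      using P.I_maximal[OF ideal_phi_image[of ?K]] by blast
    then have "1 \<in> ?K" using phi_mem_image_iff[of ?K 1] sub K(1) by auto
    then obtain r where "1 - r * a \<in> pull P" using sub(1) by (auto simp: idl.span_breakdown_eq idl_span_self)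
    then have "- (1 - r * a) \<in> pull P" using idl.subspace_neg[OF sub(1)] by blast
    then have "a * r - 1 \<in> pull P" by (simp add: mult.commute)
    then show ?thesis by blast
  qed
  moreover have "prime_idl (pull P)"
    using prime_pull[OF maximalideal_prime[OF assms]] .
  ultimately show ?thesis by (simp add: maximal_idl_def)
qed

lemma maximalideal_phi_image:
  assumes "maximal_idl K" "ker \<subseteq> K"
  shows "maximalideal (\<phi> ` K) R"
proof -
  have K: "prime_idl K" "idl.subspace K" using assms(1) by (auto simp: maximal_idl_def prime_idl_def)
  interpret prime: primeideal "\<phi> ` K" R by (rule primeideal_phi_image[OF K(1) assms(2)])
  show ?thesis
  proof (rule maximalidealI[OF prime.is_ideal])
    show "carrier R \<noteq> \<phi> ` K" using prime.I_notcarr .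
    fix J assume J: "ideal J R" "\<phi> ` K \<subseteq> J" "J \<subseteq> carrier R"
    show "J = \<phi> ` K \<or> J = carrier R"
    proof (cases "pull J \<subseteq> K")
      case True
      then have "J \<subseteq> \<phi> ` K" using phi_image_pull[OF J(3)] by blast
      then show ?thesis using J(2) by blast
    next
      case False
      then obtain a where a: "a \<in> pull J" "a \<notin> K" by blast
      then obtain b where "a * b - 1 \<in> K" using assms(1) unfolding maximal_idl_def by blast
      note ab = a(1) this
      have subJ: "idl.subspace (pull J)" by (rule subspace_pull[OF J(1)])
      have "a * b - 1 \<in> pull J" using ab(2) J(2) by (auto simp: pull_def)
      then have "1 \<in> pull J"
        using idl_mult_right[OF subJ ab(1), of b] idl_diff_cancel'[OF subJ] by blast
      then have "\<one> \<in> J" by (simp add: pull_def phi_one)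
      then show ?thesis using ideal.one_imp_carrier[OF J(1)] by blast
    qed
  qed
qed

lemma noetherian:
  assumes "noetherian_above ker"
  shows "noetherian_ring R"
proof (rule noetherian_ringI)
  fix J assume J: "ideal J R"
  obtain B where B: "finite B" "pull J = idl.span (ker \<union> B)"
    using assms subspace_pull[OF J] ker_subset_pull[OF J] by (auto simp: noetherian_above_def)
  have "J = genideal R (\<phi> ` B)"
    unfolding genideal_phi_image B(2)[symmetric]
    using phi_image_pull ideal.axioms(1)[OF J] additive_subgroup.a_subset by metis
  then show "\<exists>A\<subseteq>carrier R. finite A \<and> J = genideal R A" using B(1) by (intro exI[of _ "\<phi> ` B"]) auto
qed

lemma regular_seq_map_iff:
  "regular_seq R (map \<phi> fs) \<longleftrightarrow> weakly_regular ker fs \<and> idl.span (ker \<union> set fs) \<noteq> UNIV"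
proof -
  let ?I = "\<lambda>k. idl.span (ker \<union> set (take k fs))"
  have sub: "idl.subspace (idl.span (ker \<union> A))" "ker \<subseteq> idl.span (ker \<union> A)" for A
    using idl.span_superset[of "ker \<union> A"] by auto
  have gen: "genideal R (set (take k (map \<phi> fs))) = \<phi> ` ?I k" for k
    by (simp add: take_map genideal_phi_image)
  have "(\<forall>a\<in>carrier R. map \<phi> fs ! k \<otimes> a \<in> \<phi> ` ?I k \<longrightarrow> a \<in> \<phi> ` ?I k) \<longleftrightarrow>
      (\<forall>a. fs ! k * a \<in> ?I k \<longrightarrow> a \<in> ?I k)" if "k < length fs" for k
    using that phi_mem_image_iff[OF sub] by (simp flip: phi_surj phi_mult)
  moreover have "genideal R (set (map \<phi> fs)) = carrier R \<longleftrightarrow> idl.span (ker \<union> set fs) = UNIV"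
  proof -
    have "genideal R (set (map \<phi> fs)) = carrier R \<longleftrightarrow> (\<forall>a. \<phi> a \<in> \<phi> ` idl.span (ker \<union> set fs))"
    proof -
      have "\<phi> ` K = range \<phi> \<longleftrightarrow> (\<forall>a. \<phi> a \<in> \<phi> ` K)" for K by auto
      then show ?thesis unfolding phi_surj[symmetric] set_map genideal_phi_image .
    qed
    also have "\<dots> \<longleftrightarrow> idl.span (ker \<union> set fs) = UNIV" using phi_mem_image_iff[OF sub] by auto
    finally show ?thesis .
  qed
  moreover have "set (map \<phi> fs) \<subseteq> carrier R" by auto
  ultimately show ?thesis
    unfolding regular_seq_def weakly_regular_def gen by (simp del: set_map)
qed

lemma list_presentation: "set xs \<subseteq> carrier R \<Longrightarrow> \<exists>fs. xs = map \<phi> fs"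
  using phi_surj by (metis ex_map_conv subset_iff rangeE)

lemma prime_chain_pull:
  assumes "sorted_wrt (\<subset>) (Qs @ [P])" "\<And>Q. Q \<in> set (Qs @ [P]) \<Longrightarrow> primeideal Q R"
  shows "\<And>i. i \<le> length Qs \<Longrightarrow> prime_idl (pull ((Qs @ [P]) ! i)) \<and> ker \<subseteq> pull ((Qs @ [P]) ! i)"
    "\<And>i. i < length Qs \<Longrightarrow> pull ((Qs @ [P]) ! i) \<subset> pull ((Qs @ [P]) ! Suc i)"
proof -
  let ?L = "Qs @ [P]"
  have L: "primeideal (?L ! i) R" if "i \<le> length Qs" for i
    using that by (intro assms(2) nth_mem) simp
  have Li: "ideal (?L ! i) R" "?L ! i \<subseteq> carrier R" if "i \<le> length Qs" for i
    using L[OF that] primeideal.axioms(1) ideal.axioms(1) additive_subgroup.a_subset by blast+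
  show "prime_idl (pull (?L ! i)) \<and> ker \<subseteq> pull (?L ! i)" if "i \<le> length Qs" for i
    using prime_pull[OF L[OF that]] ker_subset_pull[OF Li(1)[OF that]] by blast
  show "pull (?L ! i) \<subset> pull (?L ! Suc i)" if "i < length Qs" for i
    using that sorted_wrt_nth_less[OF assms(1), of i "Suc i"] Li(2)[of "Suc i"]
    by (intro pull_psubset) auto
qed

lemma prime_height_ge:
  assumes "sorted_wrt (\<subset>) (Qs @ [P])" "\<And>Q. Q \<in> set (Qs @ [P]) \<Longrightarrow> prime_idl Q \<and> ker \<subseteq> Q"
  shows "enat (length Qs) \<le> prime_height R (\<phi> ` P)"
proof -
  have "sorted_wrt (\<lambda>K L. \<phi> ` K \<subset> \<phi> ` L) (Qs @ [P])"
    using assms(1)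
  proof (rule sorted_wrt_mono_rel[rotated])
    fix K L assume "K \<in> set (Qs @ [P])" "L \<in> set (Qs @ [P])" "K \<subset> L"
    then show "\<phi> ` K \<subset> \<phi> ` L"
      using assms(2)[of K] assms(2)[of L] prime_idlD(1) by (intro phi_image_psubset) blast+
  qed
  then have "sorted_wrt (\<subset>) (map ((`) \<phi>) Qs @ [\<phi> ` P])"
    using sorted_wrt_map[of "(\<subset>)" "(`) \<phi>" "Qs @ [P]"] by simp
  moreover have "\<forall>Q\<in>set (map ((`) \<phi>) Qs). primeideal Q R"
    using assms(2) primeideal_phi_image by auto
  ultimately show ?thesis
    unfolding prime_height_def
    by (intro Sup_upper CollectI exI[of _ "map ((`) \<phi>) Qs"]) auto
qed

lemma ideal_depth_le_prime_height:
  assumes "primeideal P R"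
  shows "ideal_depth R P \<le> prime_height R P"
  unfolding ideal_depth_def
proof (rule Sup_least)
  interpret P: primeideal P R by fact
  fix d assume "d \<in> {enat (length xs) | xs. regular_seq R xs \<and> set xs \<subseteq> P}"
  then obtain xs where xs: "d = enat (length xs)" "regular_seq R xs" "set xs \<subseteq> P" by blast
  then have "set xs \<subseteq> carrier R" by (simp add: regular_seq_def)
  then obtain fs where fs: "xs = map \<phi> fs" using list_presentation by blast
  have P: "prime_idl (pull P)" "ker \<subseteq> pull P" "\<phi> ` pull P = P"
    using prime_pull[OF assms] ker_subset_pull[OF P.is_ideal] phi_image_pull[OF P.a_subset] by auto
  have "weakly_regular ker fs" "set fs \<subseteq> pull P"
    using xs(2,3) by (auto simp: fs regular_seq_map_iff pull_def)
  then obtain Qs where "length Qs = length fs" "sorted_wrt (\<subset>) (Qs @ [pull P])"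
    "\<forall>Q\<in>set Qs. prime_idl Q \<and> ker \<subseteq> Q"
    using weakly_regular_imp_prime_chain[OF _ P(1,2)] by blast
  moreover have "prime_idl Q \<and> ker \<subseteq> Q" if "Q \<in> set (Qs @ [pull P])" for Q
    using that P \<open>\<forall>Q\<in>set Qs. prime_idl Q \<and> ker \<subseteq> Q\<close> by auto
  ultimately show "d \<le> prime_height R P"
    using prime_height_ge[of Qs "pull P"] P(3) by (simp add: xs(1) fs)
qed

end

lemma cring_poly_ring: "cring (poly_ring n :: ('k::field mpoly) ring)"
proof (rule cringI)
  let ?S = "poly_ring n :: ('k mpoly) ring"
  have carr: "p \<in> carrier ?S \<longleftrightarrow> keys p \<subseteq> {u. set_mset u \<subseteq> {1..n}}" for p
    by (auto simp: poly_ring_def)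
  have neg: "keys (- p) = keys p" for p :: "'k mpoly" by (auto simp: in_keys_iff)
  have mult: "p * q \<in> carrier ?S" if "p \<in> carrier ?S" "q \<in> carrier ?S" for p q
    using that unfolding carr
    by (intro keys_mult_subset[of p "{u. set_mset u \<subseteq> {1..n}}" q "{u. set_mset u \<subseteq> {1..n}}"]) auto
  have ops: "x \<oplus>\<^bsub>?S\<^esub> y = x + y" "x \<otimes>\<^bsub>?S\<^esub> y = x * y" "\<zero>\<^bsub>?S\<^esub> = 0" "\<one>\<^bsub>?S\<^esub> = 1" for x y
    by (simp_all add: poly_ring_def)
  show "abelian_group ?S"
  proof (rule abelian_groupI)
    show "\<exists>y\<in>carrier ?S. y \<oplus>\<^bsub>?S\<^esub> x = \<zero>\<^bsub>?S\<^esub>" if "x \<in> carrier ?S" for x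
      using that by (intro bexI[of _ "- x"]) (simp_all add: carr neg ops)
  qed (simp_all add: ops carr keys_add_subset algebra_simps)
  show "comm_monoid ?S"
    by (rule comm_monoidI) (use mult in \<open>simp_all add: ops carr algebra_simps\<close>)
qed (simp add: poly_ring_def algebra_simps)

lemma poly_ring_simps:
  "x \<oplus>\<^bsub>poly_ring n\<^esub> y = x + y" "x \<otimes>\<^bsub>poly_ring n\<^esub> y = x * y"
  "\<zero>\<^bsub>poly_ring n\<^esub> = 0" "\<one>\<^bsub>poly_ring n\<^esub> = 1"
  by (simp_all add: poly_ring_def)

lemma poly_ring_minus:
  assumes "x \<in> carrier (poly_ring n :: ('k::field mpoly) ring)" "y \<in> carrier (poly_ring n)"
  shows "x \<ominus>\<^bsub>poly_ring n\<^esub> y = x - y"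
proof -
  interpret cring "poly_ring n :: ('k mpoly) ring" by (rule cring_poly_ring)
  have "- y \<in> carrier (poly_ring n)" using assms(2) by (simp add: poly_ring_def in_keys_iff)
  then have "\<ominus>\<^bsub>poly_ring n\<^esub> y = - y"
    using assms(2) by (intro minus_equality) (simp_all add: poly_ring_simps)
  then show ?thesis by (simp add: a_minus_def poly_ring_simps)
qed

text \<open>The squarefree monomial of a support divides every monomial with that support, so
  membership can be read off monomial by monomial.\<close>

lemma stanley_reisner_ideal_eq:
  assumes "simplicial_complex n \<Gamma>"
  shows "stanley_reisner_ideal n \<Gamma> = (carrier (poly_ring n) \<inter> nonface_ideal \<Gamma> :: 'k::field mpoly set)"
    (is "_ = ?J")
proof
  let ?S = "poly_ring n :: ('k mpoly) ring"
  let ?G = "{face_poly F | F. F \<subseteq> {1..n} \<and> F \<notin> \<Gamma>} :: 'k mpoly set"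
  interpret S: cring ?S by (rule cring_poly_ring)
  have nf: "idl.subspace (nonface_ideal \<Gamma> :: 'k mpoly set)"
    using assms by (intro subspace_nonface_ideal) (auto simp: simplicial_complex_def)
  have G: "?G \<subseteq> ?J"
  proof clarify
    fix F assume F: "F \<subseteq> {1..n}" "F \<notin> \<Gamma>"
    have "finite F" using finite_subset[OF F(1)] by simp
    then show "face_poly F \<in> ?J"
      using F unfolding face_poly_def face_mon_def poly_ring_def nonface_ideal_def by simp
  qed
  have "ideal ?J ?S"
  proof (rule idealI)
    show "subgroup ?J (add_monoid ?S)"
    proof (rule S.add.subgroupI)
      show "\<ominus>\<^bsub>?S\<^esub> a \<in> ?J" if "a \<in> ?J" for a
      proof -
        have "\<ominus>\<^bsub>?S\<^esub> a = \<zero>\<^bsub>?S\<^esub> \<ominus>\<^bsub>?S\<^esub> a" using that by (simp add: S.minus_eq)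
        also have "\<dots> = - a" using that S.zero_closed by (subst poly_ring_minus) (simp_all add: poly_ring_simps)
        finally have "\<ominus>\<^bsub>?S\<^esub> a = - a" .
        then show ?thesis using that idl.subspace_neg[OF nf, of a] S.a_inv_closed[of a] by simp
      qed
      show "a \<oplus>\<^bsub>?S\<^esub> b \<in> ?J" if "a \<in> ?J" "b \<in> ?J" for a b
        using that idl.subspace_add[OF nf, of a b] S.a_closed[of a b] by (simp add: poly_ring_simps)
      have "\<zero>\<^bsub>?S\<^esub> \<in> ?J" using idl.subspace_0[OF nf] S.zero_closed by (simp add: poly_ring_simps)
      then show "?J \<noteq> {}" by blast
    qed auto
    fix a x assume "a \<in> ?J" "x \<in> carrier ?S"
    then show "x \<otimes>\<^bsub>?S\<^esub> a \<in> ?J" "a \<otimes>\<^bsub>?S\<^esub> x \<in> ?J"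
      using S.m_closed[of x a] S.m_closed[of a x] idl_mult_left[OF nf, of a x] idl_mult_right[OF nf, of a x]
      by (simp_all add: poly_ring_simps)
  qed (rule S.ring_axioms)
  then show "stanley_reisner_ideal n \<Gamma> \<subseteq> ?J"
    unfolding stanley_reisner_ideal_def using G by (rule S.genideal_minimal)
  have "?G \<subseteq> carrier ?S" using G by blast
  then interpret I: ideal "stanley_reisner_ideal n \<Gamma>" ?S
    unfolding stanley_reisner_ideal_def by (rule S.genideal_ideal)
  have GI: "?G \<subseteq> stanley_reisner_ideal n \<Gamma>"
    unfolding stanley_reisner_ideal_def using \<open>?G \<subseteq> carrier ?S\<close> by (rule S.genideal_self)
  show "?J \<subseteq> stanley_reisner_ideal n \<Gamma>"
  proof
    fix p assume p: "p \<in> ?J"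
    have mono: "single u c \<in> stanley_reisner_ideal n \<Gamma>" if "u \<in> keys p" for u and c :: 'k
    proof -
      let ?F = "set_mset u"
      have F: "?F \<subseteq> {1..n}" "?F \<notin> \<Gamma>" using p that by (auto simp: poly_ring_def nonface_ideal_def)
      let ?m = "single (u - mset_set ?F) c :: 'k mpoly"
      have "mset_set ?F \<subseteq># u" by (rule mset_set_set_mset_msubset)
      then have "single u c = ?m \<otimes>\<^bsub>?S\<^esub> face_poly ?F"
        by (simp add: face_poly_def face_mon_def poly_ring_simps mult_single)
      moreover have "?m \<in> carrier ?S"
      proof -
        have "set_mset (u - mset_set ?F) \<subseteq> ?F" by (meson in_diffD subsetI)
        then have "set_mset (u - mset_set ?F) \<subseteq> {1..n}" using F(1) by (rule order_trans)
        then show ?thesis unfolding poly_ring_def by simp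
      qed
      moreover have "(face_poly ?F :: 'k mpoly) \<in> stanley_reisner_ideal n \<Gamma>"
        using F by (intro subsetD[OF GI] CollectI exI[of _ ?F]) simp
      ultimately show ?thesis using I.I_l_closed by metis
    qed
    have "(\<Sum>u\<in>K. single u (lookup p u)) \<in> stanley_reisner_ideal n \<Gamma>"
      if "finite K" "K \<subseteq> keys p" for K
      using that
    proof (induction K)
      case empty
      then show ?case using I.zero_closed by (simp add: poly_ring_simps)
    next
      case (insert u K)
      then show ?case using I.a_closed[of "single u (lookup p u)"] mono by (simp add: poly_ring_simps)
    qed
    from this[of "keys p"] show "p \<in> stanley_reisner_ideal n \<Gamma>" by (simp flip: mpoly_sum_monomials)
  qed
qed

text \<open>Variables outside [n] are set to 0 first, which defines the map on the whole type and
  makes its kernel all of \<open>nonface_ideal \<Gamma>\<close>.\<close>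

definition sr_map :: "nat \<Rightarrow> nat set set \<Rightarrow> 'k::field mpoly \<Rightarrow> 'k mpoly set" where
  "sr_map n \<Gamma> p = stanley_reisner_ideal n \<Gamma> +>\<^bsub>poly_ring n\<^esub> restrict_vars {1..n} p"

lemma stanley_reisner_presentation:
  assumes \<Gamma>: "simplicial_complex n \<Gamma>"
  shows "ring_presentation (stanley_reisner_ring TYPE('k::field) n \<Gamma>) (sr_map n \<Gamma>)"
    and "ring_presentation.ker (stanley_reisner_ring TYPE('k) n \<Gamma>) (sr_map n \<Gamma>) = nonface_ideal \<Gamma>"
proof -
  let ?S = "poly_ring n :: ('k mpoly) ring" and ?I = "stanley_reisner_ideal n \<Gamma> :: 'k mpoly set"
  let ?R = "stanley_reisner_ring TYPE('k) n \<Gamma>"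
  let ?r = "restrict_vars {1..n} :: 'k mpoly \<Rightarrow> 'k mpoly"
  interpret S: cring ?S by (rule cring_poly_ring)
  have "{face_poly F | F. F \<subseteq> {1..n} \<and> F \<notin> \<Gamma>} \<subseteq> carrier ?S"
    using finite_subset by (fastforce simp: face_poly_def face_mon_def poly_ring_def)
  then interpret I: ideal ?I ?S
    unfolding stanley_reisner_ideal_def by (rule S.genideal_ideal)
  have r: "?r p \<in> carrier ?S" for p by (auto simp: poly_ring_def keys_restrict_vars)
  have r_id: "?r p = p" if "p \<in> carrier ?S" for p
    using that by (intro restrict_vars_id) (auto simp: poly_ring_def)
  have hom: "(+>\<^bsub>?S\<^esub>) ?I \<in> ring_hom ?S ?R"
    unfolding stanley_reisner_ring_def by (rule I.rcos_ring_hom)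
  show pres: "ring_presentation ?R (sr_map n \<Gamma>)"
  proof (rule ring_presentation.intro)
    show "cring ?R" unfolding stanley_reisner_ring_def using S.cring_axioms by (rule I.quotient_is_cring)
    show "ring_presentation_axioms ?R (sr_map n \<Gamma> :: 'k mpoly \<Rightarrow> _)"
    proof
      show "sr_map n \<Gamma> (a + b) = sr_map n \<Gamma> a \<oplus>\<^bsub>?R\<^esub> sr_map n \<Gamma> b" for a b :: "'k mpoly"
        using ring_hom_add[OF hom r r, of a b] by (simp add: sr_map_def restrict_vars_add poly_ring_simps)
      show "sr_map n \<Gamma> (a * b) = sr_map n \<Gamma> a \<otimes>\<^bsub>?R\<^esub> sr_map n \<Gamma> b" for a b :: "'k mpoly"
        using ring_hom_mult[OF hom r r, of a b] by (simp add: sr_map_def restrict_vars_mult poly_ring_simps)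
      show "sr_map n \<Gamma> (1 :: 'k mpoly) = \<one>\<^bsub>?R\<^esub>"
        using ring_hom_one[OF hom] by (simp add: sr_map_def poly_ring_simps)
      show "range (sr_map n \<Gamma> :: 'k mpoly \<Rightarrow> _) = carrier ?R"
      proof
        show "range (sr_map n \<Gamma> :: 'k mpoly \<Rightarrow> _) \<subseteq> carrier ?R"
          using ring_hom_closed[OF hom r] by (auto simp: sr_map_def)
        show "carrier ?R \<subseteq> range (sr_map n \<Gamma> :: 'k mpoly \<Rightarrow> _)"
        proof
          fix x assume "x \<in> carrier ?R"
          then obtain p where "p \<in> carrier ?S" "x = ?I +>\<^bsub>?S\<^esub> p"
            by (auto simp: stanley_reisner_ring_def FactRing_def A_RCOSETS_def')
          then have "x = sr_map n \<Gamma> p" using r_id by (simp add: sr_map_def)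
          then show "x \<in> range (sr_map n \<Gamma> :: 'k mpoly \<Rightarrow> _)" by blast
        qed
      qed
    qed
  qed
  have "p \<in> ring_presentation.ker ?R (sr_map n \<Gamma>) \<longleftrightarrow> p \<in> nonface_ideal \<Gamma>" for p
  proof -
    have zero: "\<zero>\<^bsub>?R\<^esub> = ?I" by (simp add: stanley_reisner_ring_def FactRing_def)
    have "p \<in> ring_presentation.ker ?R (sr_map n \<Gamma>) \<longleftrightarrow> ?I +>\<^bsub>?S\<^esub> ?r p = ?I"
      by (simp add: ring_presentation.ker_def[OF pres] sr_map_def zero)
    also have "\<dots> \<longleftrightarrow> ?r p \<in> ?I"
      using I.a_rcos_const r[of p] I.rcos_const_imp_mem by blast
    also have "\<dots> \<longleftrightarrow> ?r p \<in> nonface_ideal \<Gamma>" using r by (simp add: stanley_reisner_ideal_eq[OF \<Gamma>])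
    also have "\<dots> \<longleftrightarrow> p \<in> nonface_ideal \<Gamma>"
      using \<Gamma> by (auto simp: nonface_ideal_def keys_restrict_vars simplicial_complex_def)
    finally show ?thesis .
  qed
  then show "ring_presentation.ker ?R (sr_map n \<Gamma>) = nonface_ideal \<Gamma>" by blast
qed

section \<open>Depth and height in the Stanley-Reisner ring\<close>

lemma simplicial_complexD:
  assumes "simplicial_complex n \<Gamma>"
  shows "\<Gamma> \<subseteq> Pow {1..n}" "finite \<Gamma>" "{} \<in> \<Gamma>" "\<And>F G. F \<in> \<Gamma> \<Longrightarrow> G \<subseteq> F \<Longrightarrow> G \<in> \<Gamma>"
    "\<And>F. F \<in> \<Gamma> \<Longrightarrow> finite F"
proof -
  show sub: "\<Gamma> \<subseteq> Pow {1..n}" and "{} \<in> \<Gamma>" and "\<And>F G. F \<in> \<Gamma> \<Longrightarrow> G \<subseteq> F \<Longrightarrow> G \<in> \<Gamma>"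
    using assms by (auto simp: simplicial_complex_def)
  show "finite \<Gamma>" using sub by (rule finite_subset) simp
  show "finite F" if "F \<in> \<Gamma>" for F
    using subsetD[OF sub that] finite_subset[of F "{1..n}"] by simp
qed

text \<open>\<open>nonface_ideal (Pow {})\<close> consists of the polynomials without constant term;
  an element outside becomes 1 modulo it after division by its constant term.\<close>

lemma maximal_idl_irrelevant: "maximal_idl (nonface_ideal (Pow {}) :: 'k::field mpoly set)"
  unfolding maximal_idl_def
proof (intro conjI allI impI)
  show "prime_idl (nonface_ideal (Pow {}) :: 'k mpoly set)" by (rule prime_nonface_Pow)
  have mem: "p \<in> nonface_ideal (Pow {}) \<longleftrightarrow> lookup p {#} = 0" for p :: "'k mpoly"
    by (auto simp: nonface_ideal_def in_keys_iff)
  fix a :: "'k mpoly" assume "a \<notin> nonface_ideal (Pow {})"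
  then have a: "lookup a {#} \<noteq> 0" using mem by blast
  let ?b = "single 0 (inverse (lookup a {#})) :: 'k mpoly"
  have "lookup (a * ?b - 1) {#} = 0"
    using a lookup_const_mult[of "inverse (lookup a {#})" a "{#}"]
    by (simp add: lookup_minus lookup_one mult.commute[of a])
  then show "\<exists>b. a * b - 1 \<in> nonface_ideal (Pow {})" using mem by blast
qed

text \<open>As \<open>F\<close> is a facet, its union with the support of a monomial is a face only
  if that support lies in \<open>F\<close>. So every facet prime is an associated prime.\<close>

lemma colon_facet:
  assumes "facet \<Gamma> F" "finite F" "\<And>F G. F \<in> \<Gamma> \<Longrightarrow> G \<subseteq> F \<Longrightarrow> G \<in> \<Gamma>"
  shows "colon (nonface_ideal \<Gamma>) (single (mset_set F) 1) = (nonface_ideal (Pow F) :: 'k::field mpoly set)"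
proof -
  have F: "F \<in> \<Gamma>" "\<And>G. G \<in> \<Gamma> \<Longrightarrow> F \<subseteq> G \<Longrightarrow> G = F" using assms(1) by (auto simp: facet_def)
  have "set_mset (mset_set F + u) \<in> \<Gamma> \<longleftrightarrow> set_mset u \<subseteq> F" for u
  proof -
    have "F \<union> set_mset u \<in> \<Gamma> \<longleftrightarrow> set_mset u \<subseteq> F" using F by (metis Un_upper1 Un_upper2 sup.absorb1)
    then show ?thesis using assms(2) by simp
  qed
  moreover have "keys (a * single (mset_set F) 1) = (\<lambda>v. mset_set F + v) ` keys a" for a :: "'k mpoly"
    using keys_monic_monomial_mult[of "mset_set F" a] by (simp only: mult.commute)
  ultimately have "a * single (mset_set F) 1 \<in> nonface_ideal \<Gamma> \<longleftrightarrow> a \<in> nonface_ideal (Pow F)"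
    for a :: "'k mpoly"
    by (simp add: nonface_ideal_def)
  then show ?thesis by (auto simp: colon_def)
qed

context
  fixes n :: nat and \<Gamma> :: "nat set set" and R :: "('k::field mpoly) set ring"
  assumes \<Gamma>: "simplicial_complex n \<Gamma>"
  defines "R \<equiv> stanley_reisner_ring TYPE('k) n \<Gamma>"
begin

interpretation ring_presentation R "sr_map n \<Gamma>"
  unfolding R_def by (rule stanley_reisner_presentation(1)[OF \<Gamma>])

lemma ker_eq: "ker = nonface_ideal \<Gamma>"
  unfolding R_def by (rule stanley_reisner_presentation(2)[OF \<Gamma>])

lemma noetherian_above_ker: "noetherian_above ker"
  unfolding ker_eq using simplicial_complexD[OF \<Gamma>] by (intro noetherian_above_nonface_ideal[of "{1..n}"]) auto

lemma ker_subset_face_prime: "F \<in> \<Gamma> \<Longrightarrow> ker \<subseteq> nonface_ideal (Pow F)"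
  unfolding ker_eq using simplicial_complexD(4)[OF \<Gamma>] by (intro nonface_ideal_mono) blast

text \<open>The lowest prime of a chain contains the prime of some face, above which no chain is
  longer than the size of that face.\<close>

lemma prime_height_le_dim:
  assumes "\<And>F. F \<in> \<Gamma> \<Longrightarrow> card F \<le> d" "primeideal P R"
  shows "prime_height R P \<le> enat d"
  unfolding prime_height_def
proof (rule Sup_least)
  fix h assume "h \<in> {enat (length Qs) | Qs. sorted_wrt (\<subset>) (Qs @ [P]) \<and> (\<forall>Q\<in>set Qs. primeideal Q R)}"
  then obtain Qs where Qs: "h = enat (length Qs)" "sorted_wrt (\<subset>) (Qs @ [P])" "\<And>Q. Q \<in> set (Qs @ [P]) \<Longrightarrow> primeideal Q R"
    using assms(2) by auto
  note chain = prime_chain_pull[OF Qs(2,3)]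
  have "\<exists>F\<in>\<Gamma>. nonface_ideal (Pow F) \<subseteq> pull ((Qs @ [P]) ! 0)"
    using chain(1)[of 0] simplicial_complexD(2)[OF \<Gamma>] by (intro prime_contains_face_prime) (auto simp: ker_eq)
  then obtain F where F: "F \<in> \<Gamma>" "nonface_ideal (Pow F) \<subseteq> pull ((Qs @ [P]) ! 0)" by blast
  have "length Qs \<le> card F"
    by (rule prime_chain_length_le_card[OF simplicial_complexD(5)[OF \<Gamma> F(1)], where Q = "\<lambda>i. pull ((Qs @ [P]) ! i)"])
      (use F(2) chain in auto)
  then show "h \<le> enat d" using assms(1)[OF F(1)] Qs(1) by simp
qed

lemma ideal_depth_ge_dim:
  assumes "vertex_decomposable \<Gamma>" "\<And>F. facet \<Gamma> F \<Longrightarrow> card F = d" "maximalideal P R"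
  shows "enat d \<le> ideal_depth R P"
proof -
  interpret P: maximalideal P R by fact
  have max: "maximal_idl (pull P)" by (rule maximal_pull[OF assms(3)])
  then have prime: "prime_idl (pull P)" by (simp add: maximal_idl_def)
  have sub: "idl.subspace (pull P)" "1 \<notin> pull P" using prime_idlD[OF prime] by blast+
  have ker: "ker \<subseteq> pull P" by (rule ker_subset_pull[OF P.is_ideal])
  have "X j \<in> pull P" if "j \<notin> {1..n}" for j
  proof -
    have "{j} \<notin> \<Gamma>" using that simplicial_complexD(1)[OF \<Gamma>] by blast
    then show ?thesis using ker by (auto simp: ker_eq X_nonface)
  qed
  then obtain D y where Dy: "D > 0" "\<forall>i\<in>{1..n}. y i \<in> pull P \<and> monic_in i D (y i)"
    using exists_monic_in_uniform[of "{1..n}", OF _ _ max] by (metis finite_atLeastAtMost)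
  have D: "D > 0" and y: "\<And>i. i \<in> {1..n} \<Longrightarrow> y i \<in> pull P" "\<And>i. i \<in> {1..n} \<Longrightarrow> monic_in i D (y i)"
    using Dy by blast+
  let ?fs = "parameters n y d"
  have "weakly_regular (nonface_ideal (cone \<Gamma> {})) (parameters n y (d + card ({} :: nat set)))"
    using simplicial_complexD[OF \<Gamma>] assms(2) by (intro weakly_regular_parameters_cone[OF assms(1) D y(2)]) auto
  then have reg: "weakly_regular ker ?fs" by (simp add: ker_eq cone_def)
  have "y i ^ m \<in> pull P" if "i \<in> {1..n}" "m > 0" for i m
    using that y(1) idl_mult_right[OF sub(1)] by (cases m) auto
  then have fsP: "set ?fs \<subseteq> pull P"
    by (auto simp: parameters_def parameter_def intro!: idl.subspace_sum[OF sub(1)])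
  have "idl.span (ker \<union> set ?fs) \<subseteq> pull P" using ker fsP sub(1) by (intro idl.span_minimal) auto
  then have "regular_seq R (map (sr_map n \<Gamma>) ?fs)" using reg sub(2) by (auto simp: regular_seq_map_iff)
  moreover have "set (map (sr_map n \<Gamma>) ?fs) \<subseteq> P" using fsP by (auto simp: pull_def)
  moreover have "length (map (sr_map n \<Gamma>) ?fs) = d" by (simp add: parameters_def)
  ultimately show ?thesis
    unfolding ideal_depth_def by (intro Sup_upper CollectI exI[of _ "map (sr_map n \<Gamma>) ?fs"]) auto
qed

lemma ideal_depth_le_facet:
  assumes F: "facet \<Gamma> F"
  shows "ideal_depth R (sr_map n \<Gamma> ` nonface_ideal (Pow {})) \<le> enat (card F)"
  unfolding ideal_depth_def
proof (rule Sup_least)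
  let ?m = "nonface_ideal (Pow {}) :: 'k mpoly set"
  have FG: "F \<in> \<Gamma>" "finite F" using F simplicial_complexD(5)[OF \<Gamma>] by (auto simp: facet_def)
  fix h assume "h \<in> {enat (length xs) | xs. regular_seq R xs \<and> set xs \<subseteq> sr_map n \<Gamma> ` ?m}"
  then obtain xs where xs: "h = enat (length xs)" "regular_seq R xs" "set xs \<subseteq> sr_map n \<Gamma> ` ?m" by blast
  then have "set xs \<subseteq> carrier R" by (simp add: regular_seq_def)
  then obtain fs where fs: "xs = map (sr_map n \<Gamma>) fs" using list_presentation by blast
  have m: "prime_idl ?m" "ker \<subseteq> ?m"
    using prime_nonface_Pow ker_subset_face_prime simplicial_complexD(3)[OF \<Gamma>] by blast+
  have fm: "set fs \<subseteq> ?m"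
  proof
    fix f assume "f \<in> set fs"
    then have "sr_map n \<Gamma> f \<in> sr_map n \<Gamma> ` ?m" using xs(3) by (auto simp: fs)
    then show "f \<in> ?m" using phi_mem_image_iff[OF prime_idlD(1)[OF m(1)] m(2)] by blast
  qed
  let ?z = "single (mset_set F) 1 :: 'k mpoly"
  have colon: "colon ker ?z = nonface_ideal (Pow F)"
    unfolding ker_eq by (rule colon_facet[OF F FG(2)]) (rule simplicial_complexD(4)[OF \<Gamma>])
  have z: "prime_idl (colon ker ?z)" "colon ker ?z \<subseteq> ?m"
    unfolding colon by (rule prime_nonface_Pow) (rule nonface_ideal_mono, simp)
  have "weakly_regular ker fs" using xs(2) by (simp add: fs regular_seq_map_iff)
  then obtain Q where Q: "Q 0 = colon ker ?z" "\<And>i. i \<le> length fs \<Longrightarrow> prime_idl (Q i)"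
    "\<And>i. i < length fs \<Longrightarrow> Q i \<subset> Q (Suc i)"
    using weakly_regular_prime_chain_above[OF subspace_ker noetherian_above_ker _ m fm z] by blast
  have "length fs \<le> card F"
  proof (rule prime_chain_length_le_card[OF FG(2)])
    show "nonface_ideal (Pow F) \<subseteq> Q 0" by (simp add: Q(1) colon)
  qed (rule Q; assumption)+
  then show "h \<le> enat (card F)" by (simp add: xs(1) fs)
qed

lemma prime_height_ge_face:
  assumes F: "F \<in> \<Gamma>"
  shows "enat (card F) \<le> prime_height R (sr_map n \<Gamma> ` nonface_ideal (Pow {}))"
proof -
  define g where "g = sorted_list_of_set F"
  have g: "set g = F" "distinct g" "length g = card F"
    using simplicial_complexD(5)[OF \<Gamma> F] by (simp_all add: g_def)
  \<comment> \<open>Removing the vertices of \<open>F\<close> one by one adds one variable at a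
    time, from the prime of \<open>F\<close> up to the irrelevant ideal.\<close>
  define Q where "Q = (\<lambda>i. nonface_ideal (Pow (set (drop i g))) :: 'k mpoly set)"
  have strict: "Q i \<subset> Q j" if "i < j" "j \<le> card F" for i j
  proof -
    have sub: "set (drop j g) \<subseteq> set (drop i g)" using that by (intro set_drop_subset_set_drop) simp
    have i: "i < length g" using that g(3) by simp
    have "g ! i \<notin> set (drop j g)"
      using i that g(2) by (auto simp: in_set_conv_nth nth_eq_iff_index_eq)
    moreover have "g ! i \<in> set (drop i g)" using i by (metis Cons_nth_drop_Suc list.set_intros(1))
    ultimately have "X (g ! i) \<in> Q j" "X (g ! i) \<notin> Q i" by (simp_all add: Q_def X_nonface)
    moreover have "Q i \<subseteq> Q j" unfolding Q_def using sub by (intro nonface_ideal_mono) auto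
    ultimately show ?thesis by blast
  qed
  have last: "Q (card F) = nonface_ideal (Pow {})" by (simp add: Q_def g(3)[symmetric])
  have "sorted_wrt (\<lambda>i j. Q i \<subset> Q j) [0..<Suc (card F)]"
  proof (rule sorted_wrt_mono_rel[OF _ sorted_wrt_upt])
    show "Q i \<subset> Q j" if "j \<in> set [0..<Suc (card F)]" "i < j" for i j
      using that by (intro strict) auto
  qed
  then have "sorted_wrt (\<subset>) (map Q [0..<Suc (card F)])" unfolding sorted_wrt_map .
  then have sorted: "sorted_wrt (\<subset>) (map Q [0..<card F] @ [nonface_ideal (Pow {})])" by (simp add: last)
  have "prime_idl (Q i) \<and> ker \<subseteq> Q i" for i
  proof -
    have "set (drop i g) \<in> \<Gamma>"
      using g(1) set_drop_subset[of i g] by (intro simplicial_complexD(4)[OF \<Gamma> F]) simp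
    then show ?thesis unfolding Q_def using prime_nonface_Pow ker_subset_face_prime by blast
  qed
  then have "prime_idl K \<and> ker \<subseteq> K" if "K \<in> set (map Q [0..<card F] @ [nonface_ideal (Pow {})])" for K
    using that unfolding last[symmetric] by auto
  from prime_height_ge[OF sorted this] show ?thesis by simp
qed

theorem cohen_macaulay_imp_pure:
  assumes "cohen_macaulay_complex TYPE('k) n \<Gamma>"
  shows "pure_complex \<Gamma>"
proof -
  let ?m = "sr_map n \<Gamma> ` (nonface_ideal (Pow {}) :: 'k mpoly set)"
  have "maximalideal ?m R"
    using ker_subset_face_prime[OF simplicial_complexD(3)[OF \<Gamma>]]
    by (rule maximalideal_phi_image[OF maximal_idl_irrelevant])
  then have eq: "ideal_depth R ?m = prime_height R ?m"
    using assms by (simp add: cohen_macaulay_complex_def cohen_macaulay_ring_def R_def)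
  have "card G \<le> card F" if "facet \<Gamma> F" "facet \<Gamma> G" for F G
    using ideal_depth_le_facet[OF that(1)] prime_height_ge_face[of G] that(2) eq
    by (simp add: facet_def) (metis enat_ord_simps(1) order_trans)
  then show ?thesis by (auto simp: pure_complex_def face_dim_def intro: antisym)
qed

theorem pure_vertex_decomposable_imp_cohen_macaulay:
  assumes "vertex_decomposable \<Gamma>" "pure_complex \<Gamma>"
  shows "cohen_macaulay_complex TYPE('k) n \<Gamma>"
proof -
  obtain F0 where F0: "facet \<Gamma> F0"
    using exists_facet_above[OF simplicial_complexD(2,3)[OF \<Gamma>]] by blast
  have facets: "card F = card F0" if "facet \<Gamma> F" for F
  proof -
    have "face_dim F = face_dim F0" using assms(2) F0 that unfolding pure_complex_def by blast
    then show ?thesis by (simp add: face_dim_def)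
  qed
  have faces: "card F \<le> card F0" if F: "F \<in> \<Gamma>" for F
  proof -
    obtain G where G: "facet \<Gamma> G" "F \<subseteq> G" using exists_facet_above[OF simplicial_complexD(2)[OF \<Gamma>] F] by blast
    then have "G \<in> \<Gamma>" by (simp add: facet_def)
    then have "card F \<le> card G" using G(2) by (intro card_mono simplicial_complexD(5)[OF \<Gamma>])
    then show ?thesis using facets[OF G(1)] by simp
  qed
  have "ideal_depth R P = prime_height R P" if P: "maximalideal P R" for P
  proof (rule antisym)
    have prime: "primeideal P R" by (rule maximalideal_prime[OF P])
    show "ideal_depth R P \<le> prime_height R P" by (rule ideal_depth_le_prime_height[OF prime])
    have "prime_height R P \<le> enat (card F0)" by (rule prime_height_le_dim[OF faces prime])
    also have "\<dots> \<le> ideal_depth R P" by (rule ideal_depth_ge_dim[OF assms(1) facets P])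
    finally show "prime_height R P \<le> ideal_depth R P" .
  qed
  then show ?thesis
    using noetherian[OF noetherian_above_ker] cring_axioms
    by (simp add: cohen_macaulay_complex_def cohen_macaulay_ring_def R_def)
qed

end

theorem corollary4p3:
  fixes n d :: nat and \<Gamma> :: "nat set set"
  assumes "simplicial_complex n \<Gamma>"
    and "flag_complex n d \<Gamma>"
    and "sortable \<Gamma>"
  shows "vertex_decomposable \<Gamma> \<and>
    (cohen_macaulay_complex TYPE('k::field) n \<Gamma> \<longleftrightarrow> pure_complex \<Gamma>)"
proof -
  obtain J where "\<Gamma> = capacity_complex {1..n} J"
    using sortable_flag_eq_capacity_complex[OF assms(1,3,2)] by blast
  then have "vertex_decomposable \<Gamma>" by (simp add: vertex_decomposable_capacity_complex)
  then show ?thesis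
    using cohen_macaulay_imp_pure[OF assms(1), where 'k = 'k]
      pure_vertex_decomposable_imp_cohen_macaulay[OF assms(1), where 'k = 'k] by blast
qed

end
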